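(* If $\Gamma\subset\mathsf{PSL}(2,\mathbb R)$ is a Fuchsian group and $\rho:\Gamma\to\mathsf{PSL}(d,\mathbb R)$ is a Hitchin representation, then $$\dim_H(\Lambda_\Delta(\rho(\Gamma)))\le1.$$
   Context: A Fuchsian group is a discrete (non-elementary) subgroup $\Gamma\subset\mathsf{PSL}(2,\mathbb R)$, with limit set $\Lambda(\Gamma)\subset\partial\mathbb H^2$. Hitchin representations. $\mathcal F$ is the space of complete flags in $\mathbb R^d$. For a transverse pair of flags $(F_1,F_2)$, an ordered basis $\mathcal B=(b_1,\dots,b_d)$ of $\mathbb R^d$ is compatible with $(F_1,F_2)$ if $b_i\in F_1^i\cap F_2^{d-i+1}$ for all $i$. $U_{>0}(\mathcal B)\subset\mathsf{SL}(d,\mathbb R)$ is the set of unipotent elements which in the basis $\mathcal B$ are upper triangular with all minors, except those forced to be $0$ by upper triangularity, strictly positive. A tuple $(F_1,\dots,F_k)$ in $\mathcal F$ is positive if there are an ordered basis $\mathcal B$ compatible with $(F_1,F_k)$ and $u_2,\dots,u_{k-1}\in U_{>0}(\mathcal B)$ with $F_i=u_{k-1}\cdots u_iF_k$ for $i=2,\dots,k-1$. A map $\xi:X\to\mathcal F$ with $X\subset\partial\mathbb H^2$ is positive if $(\xi(x_1),\dots,\xi(x_n))$ is positive for every cyclically ordered tuple of distinct points of $X$. $\rho:\Gamma\to\mathsf{PSL}(d,\mathbb R)$ is Hitchin if there is a continuous, positive, $\rho$-equivariant map $\xi:\Lambda(\Gamma)\to\mathcal F$. Limit set. $\Delta=\{1,\dots,d-1\}$.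 For $g\in\mathsf{PGL}(d,\mathbb R)$ with singular values $\sigma_1(g)\ge\dots\ge\sigma_d(g)$ (of a lift of determinant $\pm1$), write $g=\ell am$ with $\ell,m\in\mathsf{PO}(d)$ and $a$ diagonal with entries $\sigma_1(g),\dots,\sigma_d(g)$; if $\sigma_k(g)>\sigma_{k+1}(g)$ then $U_k(g)=\ell(\langle e_1,\dots,e_k\rangle)$ is well defined. For the image of a Hitchin representation, $\sigma_k/\sigma_{k+1}\to\infty$ along sequences of pairwise distinct elements for every $k\in\Delta$, so $U_\Delta(\gamma)=(U_k(\gamma))_{k\in\Delta}\in\mathcal F$ is defined for all but finitely many $\gamma\in\rho(\Gamma)$; $\Lambda_\Delta(\rho(\Gamma))\subset\mathcal F$ is the set of all limits of $U_\Delta(\gamma_n)$ along sequences of pairwise distinct elements $\gamma_n\in\rho(\Gamma)$. $\dim_H$ is Hausdorff dimension with respect to any Riemannian metric on $\mathcal F$. *)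

theory Defs
  imports "HOL-Analysis.Analysis" "HOL-Algebra.Coset" "HOL-Combinatorics.Permutations"
begin

section \<open>The groups PSL(d,R)\<close>

text \<open>Throughout, d is \<^term>\<open>CARD('d)\<close>. Elements of PSL(d,R) are the cosets \<open>{A, -A}\<close> (d even) or
  \<open>{A}\<close> (d odd) of the centre of SL(d,R); the members of such a coset are the lifts of the element.\<close>

definition SL :: "(real^'d^'d) monoid" where
  "SL = \<lparr>carrier = {A. det A = 1}, mult = (**), one = mat 1\<rparr>"

definition SL_centre :: "(real^'d^'d) set" where
  "SL_centre = {A. det A = 1 \<and> (A = mat 1 \<or> A = - mat 1)}"

definition PSL :: "(real^'d^'d) set monoid" where
  "PSL = SL Mod SL_centre"

section \<open>Fuchsian groups\<close>

text \<open>The hyperbolic plane together with its boundary circle is the closed unit disk of the complex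
  plane. The Cayley transform \<open>C z = (z - i)/(z + i)\<close> takes the upper half plane to the open disk
  and conjugates the Moebius map \<open>z \<mapsto> (a z + b)/(c z + d)\<close> to the following map; it depends only
  on the class of \<open>A\<close> in PSL(2,R).\<close>

definition disk_act :: "real^2^2 \<Rightarrow> complex \<Rightarrow> complex" where
  "disk_act A w =
     (let \<alpha> = Complex ((A$1$1 + A$2$2) / 2) ((A$1$2 - A$2$1) / 2);
          \<beta> = Complex ((A$1$1 - A$2$2) / 2) (- (A$1$2 + A$2$1) / 2)
      in (\<alpha> * w + \<beta>) / (cnj \<beta> * w + cnj \<alpha>))"

definition disk_orbit :: "(real^2^2) set set \<Rightarrow> complex \<Rightarrow> complex set" where
  "disk_orbit \<Gamma> z = {disk_act A z | A. A \<in> \<Union>\<Gamma>}"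

definition limit_set :: "(real^2^2) set set \<Rightarrow> complex set" where
  "limit_set \<Gamma> = {\<zeta> \<in> sphere 0 1. \<exists>z\<in>ball 0 1. \<zeta> islimpt disk_orbit \<Gamma> z}"

text \<open>A subgroup of PSL(2,R) is discrete iff its preimage \<open>\<Union>\<Gamma>\<close> in SL(2,R) is. It is
  elementary if it has a finite orbit in the closed disk.\<close>

definition fuchsian :: "(real^2^2) set set \<Rightarrow> bool" where
  "fuchsian \<Gamma> \<longleftrightarrow> subgroup \<Gamma> PSL \<and> discrete (\<Union>\<Gamma>) \<and>
     (\<forall>z\<in>cball 0 1. infinite (disk_orbit \<Gamma> z))"

section \<open>Complete flags\<close>

text \<open>A complete flag is the family of its subspaces \<open>F k\<close> of dimension \<open>k = 0, ..., d\<close>, padded by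
  \<open>F k = R^d\<close> for \<open>k > d\<close> so that equality of flags is equality of functions.\<close>

type_synonym 'd flag = "nat \<Rightarrow> (real^'d) set"

definition flags :: "'d::finite flag set" where
  "flags = {F. mono F \<and> (\<forall>k. subspace (F k) \<and> dim (F k) = min k CARD('d))}"

definition flag_act :: "real^'d^'d \<Rightarrow> 'd flag \<Rightarrow> 'd flag" where
  "flag_act A F = (\<lambda>k. (\<lambda>v. A *v v) ` F k)"

text \<open>The index type carries no order, so an enumeration of it is fixed; the ordered
  standard basis is \<open>std_basis 1, ..., std_basis d\<close>.\<close>

definition coord :: "nat \<Rightarrow> 'd::finite" where
  "coord = (SOME f. bij_betw f {1..CARD('d)} UNIV)"

definition std_basis :: "nat \<Rightarrow> real^'d" where
  "std_basis k = axis (coord k) 1"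

definition std_flag :: "'d::finite flag" where
  "std_flag k = span (std_basis ` {1..k})"

text \<open>The topology of the flag manifold is the quotient topology under the orbit map
  \<open>A \<mapsto> A std_flag\<close> from GL(d,R), which is open in the space of matrices.\<close>

definition flag_topology :: "'d::finite flag topology" where
  "flag_topology =
     topology (\<lambda>U. U \<subseteq> flags \<and> open {A. invertible A \<and> flag_act A std_flag \<in> U})"

lemma istopology_flag:
  "istopology (\<lambda>U :: 'd::finite flag set. U \<subseteq> flags \<and> open {A. invertible A \<and> flag_act A std_flag \<in> U})"
proof -
  have *: "{A. invertible A \<and> flag_act A std_flag \<in> S \<inter> T} =
      {A. invertible A \<and> flag_act A std_flag \<in> S} \<inter> {A. invertible A \<and> flag_act A std_flag \<in> T}"
    for S T :: "'d flag set" by auto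
  have **: "{A. invertible A \<and> flag_act A std_flag \<in> \<Union>K} =
      (\<Union>S\<in>K. {A. invertible A \<and> flag_act A std_flag \<in> S})" for K :: "'d flag set set" by auto
  show ?thesis
    unfolding istopology_def * ** by blast
qed

lemma openin_flag_topology:
  "openin flag_topology U \<longleftrightarrow> U \<subseteq> flags \<and> open {A. invertible A \<and> flag_act A std_flag \<in> U}"
  unfolding flag_topology_def by (simp add: istopology_flag)

section \<open>Positivity and Hitchin representations\<close>

definition transverse :: "'d::finite flag \<Rightarrow> 'd flag \<Rightarrow> bool" where
  "transverse F G \<longleftrightarrow> (\<forall>k\<le>CARD('d). F k \<inter> G (CARD('d) - k) = {0})"

text \<open>Ordered bases are families indexed by \<open>{1..d}\<close>.\<close>

definition ordered_basis :: "(nat \<Rightarrow> real^'d) \<Rightarrow> bool" where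
  "ordered_basis b \<longleftrightarrow> inj_on b {1..CARD('d)} \<and> independent (b ` {1..CARD('d)})"

definition compatible_basis :: "(nat \<Rightarrow> real^'d) \<Rightarrow> 'd flag \<Rightarrow> 'd flag \<Rightarrow> bool" where
  "compatible_basis b F G \<longleftrightarrow> ordered_basis b \<and>
     (\<forall>i\<in>{1..CARD('d)}. b i \<in> F i \<inter> G (CARD('d) - i + 1))"

text \<open>Matrices with respect to an ordered basis have indices in \<open>{1..n}\<close>. The minor with rows
  \<open>r 1 < ... < r k\<close> and columns \<open>s 1 < ... < s k\<close> is given by the Leibniz formula.\<close>

definition minor :: "nat \<Rightarrow> (nat \<Rightarrow> nat) \<Rightarrow> (nat \<Rightarrow> nat) \<Rightarrow> (nat \<Rightarrow> nat \<Rightarrow> real) \<Rightarrow> real" where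
  "minor k r s c =
     (\<Sum>p | p permutes {1..k}. of_int (sign p) * (\<Prod>i\<in>{1..k}. c (r i) (s (p i))))"

definition minor_index :: "nat \<Rightarrow> nat \<Rightarrow> (nat \<Rightarrow> nat) \<Rightarrow> bool" where
  "minor_index n k r \<longleftrightarrow> strict_mono_on {1..k} r \<and> r ` {1..k} \<subseteq> {1..n}"

definition upper_triangular :: "nat \<Rightarrow> (nat \<Rightarrow> nat \<Rightarrow> real) \<Rightarrow> bool" where
  "upper_triangular n c \<longleftrightarrow> (\<forall>i\<in>{1..n}. \<forall>j\<in>{1..n}. j < i \<longrightarrow> c i j = 0)"

definition forced_zero_minor :: "nat \<Rightarrow> nat \<Rightarrow> (nat \<Rightarrow> nat) \<Rightarrow> (nat \<Rightarrow> nat) \<Rightarrow> bool" where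
  "forced_zero_minor n k r s \<longleftrightarrow> (\<forall>c. upper_triangular n c \<longrightarrow> minor k r s c = 0)"

text \<open>An upper triangular element is unipotent iff its diagonal entries are 1.\<close>

definition U_pos :: "(nat \<Rightarrow> real^'d) \<Rightarrow> (real^'d^'d) set" where
  "U_pos b = {u. \<exists>c.
     (\<forall>j\<in>{1..CARD('d)}. u *v b j = (\<Sum>i\<in>{1..CARD('d)}. c i j *\<^sub>R b i)) \<and>
     upper_triangular CARD('d) c \<and> (\<forall>i\<in>{1..CARD('d)}. c i i = 1) \<and>
     (\<forall>k\<in>{1..CARD('d)}. \<forall>r s. minor_index CARD('d) k r \<and> minor_index CARD('d) k s \<and>
        \<not> forced_zero_minor CARD('d) k r s \<longrightarrow> minor k r s c > 0)}"

text \<open>\<open>desc_prod u i n\<close> is the product \<open>u (i + n - 1) ** ... ** u (i + 1) ** u i\<close> of \<open>n\<close> factors.\<close>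

primrec desc_prod :: "(nat \<Rightarrow> real^'d^'d) \<Rightarrow> nat \<Rightarrow> nat \<Rightarrow> real^'d^'d" where
  "desc_prod u i 0 = mat 1"
| "desc_prod u i (Suc n) = u (i + n) ** desc_prod u i n"

definition positive_tuple :: "nat \<Rightarrow> (nat \<Rightarrow> 'd::finite flag) \<Rightarrow> bool" where
  "positive_tuple k F \<longleftrightarrow> transverse (F 1) (F k) \<and>
     (\<exists>b u. compatible_basis b (F 1) (F k) \<and> (\<forall>i\<in>{2..<k}. u i \<in> U_pos b) \<and>
        (\<forall>i\<in>{2..<k}. F i = flag_act (desc_prod u i (k - i)) (F k)))"

text \<open>Counterclockwise order; the points are then automatically distinct points of the circle.\<close>

definition cyclically_ordered :: "nat \<Rightarrow> (nat \<Rightarrow> complex) \<Rightarrow> bool" where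
  "cyclically_ordered n x \<longleftrightarrow>
     (\<exists>t. (\<forall>k\<in>{1..n}. x k = cis (t k)) \<and> strict_mono_on {1..n} t \<and> t n < t 1 + 2 * pi)"

definition positive_map :: "complex set \<Rightarrow> (complex \<Rightarrow> 'd::finite flag) \<Rightarrow> bool" where
  "positive_map X \<xi> \<longleftrightarrow>
     (\<forall>n\<ge>2. \<forall>x. cyclically_ordered n x \<and> x ` {1..n} \<subseteq> X \<longrightarrow> positive_tuple n (\<lambda>k. \<xi> (x k)))"

definition hitchin :: "(real^2^2) set set \<Rightarrow> ((real^2^2) set \<Rightarrow> (real^'d^'d) set) \<Rightarrow> bool" where
  "hitchin \<Gamma> \<rho> \<longleftrightarrow> \<rho> \<in> hom (PSL\<lparr>carrier := \<Gamma>\<rparr>) PSL \<and>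
     (\<exists>\<xi>. continuous_map (top_of_set (limit_set \<Gamma>)) flag_topology \<xi> \<and>
          positive_map (limit_set \<Gamma>) \<xi> \<and>
          (\<forall>\<gamma>\<in>\<Gamma>. \<forall>A\<in>\<gamma>. \<forall>B\<in>\<rho> \<gamma>. \<forall>x\<in>limit_set \<Gamma>. \<xi> (disk_act A x) = flag_act B (\<xi> x)))"

section \<open>The limit set in the flag manifold\<close>

text \<open>\<open>cartan g l s m\<close>: \<open>g = l a m\<close> with \<open>l, m\<close> orthogonal and \<open>a\<close> diagonal with positive weakly
  decreasing entries \<open>s 1, ..., s d\<close>, which are then the singular values of \<open>g\<close>.\<close>

definition cartan :: "real^'d^'d \<Rightarrow> real^'d^'d \<Rightarrow> (nat \<Rightarrow> real) \<Rightarrow> real^'d^'d \<Rightarrow> bool" where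
  "cartan g l s m \<longleftrightarrow> orthogonal_matrix l \<and> orthogonal_matrix m \<and>
     (\<forall>k\<in>{1..CARD('d)}. s k > 0) \<and> (\<forall>k\<in>{1..<CARD('d)}. s k \<ge> s (Suc k)) \<and>
     (\<exists>a. (\<forall>k\<in>{1..CARD('d)}. a *v std_basis k = s k *\<^sub>R std_basis k) \<and> g = l ** a ** m)"

text \<open>\<open>U_Delta g F\<close>: the flag \<open>(U_k g)\<close> is defined, and equals \<open>F\<close>. When all gaps are strict
  \<open>F\<close> does not depend on the choice of \<open>l\<close> and \<open>m\<close>, nor on the sign of \<open>g\<close>.\<close>

definition U_Delta :: "real^'d^'d \<Rightarrow> 'd::finite flag \<Rightarrow> bool" where
  "U_Delta g F \<longleftrightarrow> (\<exists>l s m. cartan g l s m \<and> (\<forall>k\<in>{1..<CARD('d)}. s k > s (Suc k)) \<and>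
     F = flag_act l std_flag)"

definition flag_limit_set :: "(real^'d^'d) set set \<Rightarrow> 'd::finite flag set" where
  "flag_limit_set G = {F. \<exists>\<gamma> Fs. inj \<gamma> \<and> range \<gamma> \<subseteq> G \<and>
     (\<forall>n::nat. \<exists>g\<in>\<gamma> n. U_Delta g (Fs n)) \<and> limitin flag_topology Fs F sequentially}"

section \<open>Riemannian metrics on the flag manifold\<close>

primrec Ck_on :: "nat \<Rightarrow> ('a::real_normed_vector \<Rightarrow> 'b::real_normed_vector) \<Rightarrow> 'a set \<Rightarrow> bool" where
  "Ck_on 0 f S \<longleftrightarrow> continuous_on S f"
| "Ck_on (Suc n) f S \<longleftrightarrow> (\<forall>x\<in>S. f differentiable (at x)) \<and>
     (\<forall>v. Ck_on n (\<lambda>x. frechet_derivative f (at x) v) S)"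

text \<open>The action of GL(d,R) on the flag manifold is transitive, so the tangent space at \<open>F\<close> is the
  quotient of the Lie algebra of all matrices by the stabilizer algebra of \<open>F\<close>.\<close>

definition flag_stabilizer :: "'d::finite flag \<Rightarrow> (real^'d^'d) set" where
  "flag_stabilizer F = {X. \<forall>k. \<forall>v\<in>F k. X *v v \<in> F k}"

text \<open>A Riemannian metric is thus a family of positive semidefinite symmetric bilinear forms
  \<open>g F\<close> on matrices whose null vectors are exactly the stabilizer algebra of \<open>F\<close>. The vector fields
  given by matrices span every tangent space, and a function on the flag manifold is smooth iff its
  pullback under the orbit map (a submersion) is; so smoothness is as stated.\<close>

definition flag_riemannian_metric ::
    "('d::finite flag \<Rightarrow> real^'d^'d \<Rightarrow> real^'d^'d \<Rightarrow> real) \<Rightarrow> bool" where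
  "flag_riemannian_metric g \<longleftrightarrow>
     (\<forall>F\<in>flags. bilinear (g F) \<and> (\<forall>X Y. g F X Y = g F Y X) \<and> (\<forall>X. g F X X \<ge> 0) \<and>
        (\<forall>X. g F X X = 0 \<longleftrightarrow> X \<in> flag_stabilizer F)) \<and>
     (\<forall>X Y n. Ck_on n (\<lambda>A. g (flag_act A std_flag) X Y) {A. invertible A})"

text \<open>Every \<open>C^1\<close> path of flags lifts to a \<open>C^1\<close> path \<open>A t\<close> in GL(d,R), and the velocity of
  \<open>A t std_flag\<close> is the class of \<open>A' t ** matrix_inv (A t)\<close>.\<close>

definition flag_path_length ::
    "('d::finite flag \<Rightarrow> real^'d^'d \<Rightarrow> real^'d^'d \<Rightarrow> real) \<Rightarrow> (real \<Rightarrow> real^'d^'d) \<Rightarrow> real" where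
  "flag_path_length g A = integral {0..1} (\<lambda>t.
     let X = vector_derivative A (at t) ** matrix_inv (A t)
     in sqrt (g (flag_act (A t) std_flag) X X))"

definition flag_dist ::
    "('d::finite flag \<Rightarrow> real^'d^'d \<Rightarrow> real^'d^'d \<Rightarrow> real) \<Rightarrow> 'd flag \<Rightarrow> 'd flag \<Rightarrow> real" where
  "flag_dist g F G = Inf {flag_path_length g A | A.
     A C1_differentiable_on {0..1} \<and> (\<forall>t\<in>{0..1}. invertible (A t)) \<and>
     flag_act (A 0) std_flag = F \<and> flag_act (A 1) std_flag = G}"

section \<open>Hausdorff dimension\<close>

text \<open>Here \<open>M\<close> is a set with a distance function \<open>dst\<close>. Restricting to exponents \<open>s > 0\<close> does not
  change the dimension and avoids the convention for \<open>0^0\<close>.\<close>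

definition diam_wrt :: "('a \<Rightarrow> 'a \<Rightarrow> real) \<Rightarrow> 'a set \<Rightarrow> real" where
  "diam_wrt dst U = (if U = {} then 0 else SUP (x, y)\<in>U \<times> U. dst x y)"

definition hausdorff_premeasure ::
    "'a set \<Rightarrow> ('a \<Rightarrow> 'a \<Rightarrow> real) \<Rightarrow> real \<Rightarrow> real \<Rightarrow> 'a set \<Rightarrow> ennreal" where
  "hausdorff_premeasure M dst s \<delta> S =
     (INF U\<in>{U :: nat \<Rightarrow> 'a set. S \<subseteq> (\<Union>i. U i) \<and>
                (\<forall>i. U i \<subseteq> M \<and> (\<forall>x\<in>U i. \<forall>y\<in>U i. dst x y \<le> \<delta>))}.
        \<Sum>i. ennreal (diam_wrt dst (U i) powr s))"

definition hausdorff_measure ::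
    "'a set \<Rightarrow> ('a \<Rightarrow> 'a \<Rightarrow> real) \<Rightarrow> real \<Rightarrow> 'a set \<Rightarrow> ennreal" where
  "hausdorff_measure M dst s S = (SUP \<delta>\<in>{0<..}. hausdorff_premeasure M dst s \<delta> S)"

definition hausdorff_dim :: "'a set \<Rightarrow> ('a \<Rightarrow> 'a \<Rightarrow> real) \<Rightarrow> 'a set \<Rightarrow> ennreal" where
  "hausdorff_dim M dst S = Inf {ennreal s | s. s > 0 \<and> hausdorff_measure M dst s S = 0}"

end

theory Submission
  imports Defs
begin

text \<open>
  The limit set of a Hitchin representation has dimension at most 1 because it lies on the positive
  curve \<open>\<xi>\<close> of flags, and positive curves are monotone: their arcs are parametrized, in a locally
  Lipschitz way, by subsets of the real line.

  Monotonicity. Fix two points \<open>a\<close>, \<open>q\<close> of the limit set. For \<open>x\<close> in the open arc from \<open>a\<close> to \<open>q\<close>,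
  positivity writes \<open>\<xi> x = T \<xi> q\<close> with \<open>T\<close> unipotent in the stabilizer of \<open>\<xi> a\<close>, and \<open>T\<close> is
  unique by transversality (\<open>unipotent_unique\<close>). If \<open>(a, x, x', q)\<close> is cyclically ordered, then
  \<open>T x = T x' u\<close>, and in a suitable basis \<open>T x'\<close> and \<open>u\<close> are unipotent with nonnegative entries. So the
  absolute values of all entries of \<open>T\<close> in a fixed basis increase as \<open>x\<close> moves from \<open>q\<close> to \<open>a\<close>
  (\<open>entry_sum_monotone\<close>), and their sum \<open>f\<close> is a real parameter with
  \<open>norm (T x - T x') \<le> K * \<bar>f x - f x'\<bar>\<close>. The Riemannian distance of flags is bounded by the distance of
  their unipotent matrices as long as these stay bounded (\<open>flag_dist_lipschitz\<close>). So each arc is a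
  countable union of Lipschitz images of bounded sets of reals, and all its Hausdorff measures of
  dimension \<open>s > 1\<close> vanish (\<open>hausdorff_measure_positive_arc\<close>).

  Inclusion. Let \<open>\<rho> (\<alpha> n)\<close> be distinct elements whose Cartan flags converge. By discreteness a subsequence
  of \<open>\<alpha> n\<close> converges to a constant \<open>x\<close> away from one point \<open>y\<close> (\<open>fuchsian_dynamics\<close>), and equivariance and
  continuity of \<open>\<xi>\<close> transfer this to the flags \<open>\<xi> w\<close>. Convergence on the curve alone would not determine the
  Cartan flags, as the curve need not span the exterior powers. Positivity of one
  triple supplies what is missing: with respect to convergent bases given by transverse pairs of flags,
  \<open>\<rho> (\<alpha> n)\<close> is diagonal, and nonvanishing minors force the ratios of successive diagonal entries to tend to
  0. A comparison with the Cartan decomposition then shows that the Cartan flags converge to \<open>\<xi> x\<close>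
  (\<open>cartan_flag_limit\<close>).
\<close>

section \<open>Matrices with columns indexed by natural numbers\<close>

text \<open>The index type has no order of its own; its positions \<open>idx j\<close> in the fixed enumeration turn matrices
  over it into matrices indexed by \<open>{1..d}\<close>, where triangular shape and minors make sense.\<close>

definition idx :: "'d::finite \<Rightarrow> nat" where
  "idx = inv_into {1..CARD('d)} coord"

definition cols :: "(nat \<Rightarrow> real^'d) \<Rightarrow> real^'d^'d" where
  "cols b = (\<chi> r j. b (idx j) $ r)"

lemma bij_coord: "bij_betw (coord :: nat \<Rightarrow> 'd::finite) {1..CARD('d)} UNIV"
proof -
  have "\<exists>f :: nat \<Rightarrow> 'd. bij_betw f {1..CARD('d)} UNIV"
    by (rule finite_same_card_bij) auto
  then show ?thesis unfolding coord_def by (rule someI_ex)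
qed

lemma coord_idx [simp]: "coord (idx j) = j"
  unfolding idx_def using bij_coord by (metis UNIV_I bij_betw_inv_into_right)

lemma idx_coord: "i \<in> {1..CARD('d)} \<Longrightarrow> idx (coord i :: 'd::finite) = i"
  unfolding idx_def using bij_coord by (metis bij_betw_inv_into_left)

lemma idx_range: "idx (j :: 'd::finite) \<in> {1..CARD('d)}"
  unfolding idx_def using bij_coord by (metis UNIV_I bij_betw_imp_surj_on inv_into_into)

lemma idx_std: "1 \<le> idx (j :: 'd::finite)" "idx (j :: 'd) \<le> CARD('d)"
  using idx_range[of j] by auto

lemma sum_coord: "(\<Sum>j\<in>(UNIV :: 'd::finite set). f j) = (\<Sum>i\<in>{1..CARD('d)}. f (coord i))"
  by (rule sum.reindex_bij_betw[OF bij_coord, symmetric])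

lemma cols_std_basis: "i \<in> {1..CARD('d)} \<Longrightarrow> cols b *v std_basis i = (b i :: real^'d)"
  unfolding std_basis_def cols_def matrix_vector_mult_basis
  by (simp add: column_def vec_eq_iff idx_coord)

lemma cols_mult: "cols b *v y = (\<Sum>i\<in>{1..CARD('d)}. y $ coord i *\<^sub>R (b i :: real^'d))"
proof -
  have "cols b *v y = (\<Sum>j\<in>UNIV. y $ j *\<^sub>R b (idx j))"
    by (simp add: cols_def matrix_vector_mult_def vec_eq_iff mult.commute)
  also have "\<dots> = (\<Sum>i\<in>{1..CARD('d)}. y $ coord i *\<^sub>R b i)"
    unfolding sum_coord by (intro sum.cong refl) (simp add: idx_coord)
  finally show ?thesis .
qed

lemma matrix_mult_cols: "A ** cols b = cols (\<lambda>i. A *v (b i :: real^'d))"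
  by (simp add: cols_def matrix_matrix_mult_def matrix_vector_mult_def vec_eq_iff)

lemma cols_of_matrix: "cols (\<lambda>i. A *v std_basis i) = (A :: real^'d^'d)"
  unfolding std_basis_def
  by (simp add: matrix_vector_mult_basis cols_def vec_eq_iff column_def)

lemma std_basis_nth: "i \<in> {1..CARD('d)} \<Longrightarrow>
    (std_basis i :: real^'d) $ j = (if idx j = i then 1 else 0)"
  by (auto simp: std_basis_def axis_def idx_coord)

lemma invertible_iff_inj: "invertible (A :: real^'d^'d) \<longleftrightarrow> (\<forall>y. A *v y = 0 \<longrightarrow> y = 0)"
  by (simp add: invertible_left_inverse matrix_left_invertible_ker)

section \<open>Bases adapted to flags\<close>

lemma std_flag_iff:
  "y \<in> (std_flag k :: (real^'d) set) \<longleftrightarrow> (\<forall>i\<in>{1..CARD('d)}. k < i \<longrightarrow> y $ coord i = 0)"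
proof
  assume "y \<in> (std_flag k :: (real^'d) set)"
  then have y: "y \<in> span (std_basis ` {1..k})" by (simp add: std_flag_def)
  show "\<forall>i\<in>{1..CARD('d)}. k < i \<longrightarrow> y $ coord i = 0"
  proof (intro ballI impI)
    fix i assume i: "i \<in> {1..CARD('d)}" "k < i"
    have sub: "subspace {v :: real^'d. v $ coord i = 0}"
      by (auto simp: subspace_def)
    have "std_basis ` {1..k} \<subseteq> {v :: real^'d. v $ coord i = 0}"
      using i by (auto simp: std_basis_nth idx_coord)
    from span_minimal[OF this sub] y show "y $ coord i = 0" by auto
  qed
next
  assume z: "\<forall>i\<in>{1..CARD('d)}. k < i \<longrightarrow> y $ coord i = 0"
  have "y = mat 1 *v y" by simp
  also have "mat 1 = cols (\<lambda>i. std_basis i :: real^'d)"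
    using cols_of_matrix[of "mat 1 :: real^'d^'d"] by simp
  also have "\<dots> *v y = (\<Sum>i\<in>{1..CARD('d)}. y $ coord i *\<^sub>R std_basis i)"
    by (rule cols_mult)
  also have "\<dots> \<in> span (std_basis ` {1..k})"
  proof (rule span_sum)
    fix i assume i: "i \<in> {1..CARD('d)}"
    show "y $ coord i *\<^sub>R std_basis i \<in> span (std_basis ` {1..k} :: (real^'d) set)"
    proof (cases "k < i")
      case True then show ?thesis using z i by (simp add: span_zero)
    next
      case False then show ?thesis using i by (intro span_scale span_base) auto
    qed
  qed
  finally show "y \<in> (std_flag k :: (real^'d) set)" by (simp add: std_flag_def)
qed

lemma dim_std_flag: "dim (std_flag k :: (real^'d) set) = min k CARD('d)"
proof -
  have eq: "std_flag k = span (std_basis ` {1..min k CARD('d)} :: (real^'d) set)"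
  proof -
    have "std_flag k = (std_flag (min k CARD('d)) :: (real^'d) set)"
      by (auto simp: std_flag_iff)
    then show ?thesis by (simp add: std_flag_def)
  qed
  have inj: "inj_on (std_basis :: nat \<Rightarrow> real^'d) {1..min k CARD('d)}" for k
  proof (rule inj_onI)
    fix i j assume ij: "i \<in> {1..min k CARD('d)}" "j \<in> {1..min k CARD('d)}"
      and e: "(std_basis i :: real^'d) = std_basis j"
    from e have "(std_basis i :: real^'d) $ coord i = (std_basis j :: real^'d) $ coord i" by simp
    moreover have "i \<in> {1..CARD('d)}" "j \<in> {1..CARD('d)}" using ij by auto
    ultimately show "i = j" by (simp add: std_basis_nth idx_coord del: atLeastAtMost_iff split: if_splits)
  qed
  have "independent (std_basis ` {1..min k CARD('d)} :: (real^'d) set)"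
    by (rule independent_mono[OF independent_Basis]) (auto simp: std_basis_def axis_in_Basis_iff)
  then have "dim (std_basis ` {1..min k CARD('d)} :: (real^'d) set) = card (std_basis ` {1..min k CARD('d)} :: (real^'d) set)"
    by (rule dim_eq_card_independent)
  also have "\<dots> = min k CARD('d)"
    using inj by (subst card_image) auto
  finally show ?thesis unfolding eq by (simp add: dim_span)
qed

lemma flagsD:
  assumes "F \<in> flags"
  shows "subspace (F k :: (real^'d) set)" "dim (F k) = min k CARD('d)" "j \<le> k \<Longrightarrow> F j \<subseteq> F k"
  using assms by (auto simp: flags_def mono_def le_fun_def)

lemma flag_UNIV:
  assumes "F \<in> flags" "CARD('d) \<le> k"
  shows "F k = (UNIV :: (real^'d) set)"
proof -
  have "dim (F k) = DIM(real^'d)" using assms flagsD(2)[of F k] by (simp add: min_def)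
  then have "span (F k) = UNIV" unfolding dim_eq_full .
  moreover have "span (F k) = F k" using flagsD(1)[OF assms(1)] by simp
  ultimately show ?thesis by simp
qed

lemma flag_zero:
  assumes "F \<in> flags"
  shows "F 0 = ({0} :: (real^'d) set)"
proof -
  have "dim (F 0) = 0" using flagsD(2)[OF assms, of 0] by simp
  moreover have "0 \<in> F 0" using flagsD(1)[OF assms, of 0] by (rule subspace_0)
  ultimately show ?thesis by (auto simp: dim_eq_0)
qed

lemma std_flag_flags: "std_flag \<in> flags"
proof -
  have "mono (std_flag :: 'a flag)"
    unfolding mono_def std_flag_def le_fun_def by (auto intro!: span_mono image_mono)
  then show ?thesis by (simp add: flags_def dim_std_flag) (simp add: std_flag_def)
qed

lemma dim_image_invertible:
  assumes "invertible (A :: real^'d^'d)"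
  shows "dim ((\<lambda>v. A *v v) ` S) = dim S"
proof -
  have "inj ((*v) A)"
    using assms by (simp add: invertible_left_inverse matrix_left_invertible_injective)
  then show ?thesis by (intro dim_image_eq) (auto intro: inj_on_subset)
qed

lemma flag_act_flags:
  assumes "invertible (A :: real^'d^'d)" "F \<in> flags"
  shows "flag_act A F \<in> flags"
proof -
  have "mono (flag_act A F)"
    unfolding mono_def le_fun_def flag_act_def using flagsD(3)[OF assms(2)] by (auto intro!: image_mono)
  moreover have "subspace (flag_act A F k)" "dim (flag_act A F k) = min k CARD('d)" for k
    unfolding flag_act_def using flagsD[OF assms(2)] dim_image_invertible[OF assms(1)]
    by (auto intro!: linear_subspace_image)
  ultimately show ?thesis by (simp add: flags_def)
qed

lemma flag_act_compose: "flag_act A (flag_act B F) = flag_act (A ** B) F"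
  by (auto simp: flag_act_def image_image matrix_vector_mul_assoc)

lemma flag_act_id [simp]: "flag_act (mat 1) F = F"
  by (simp add: flag_act_def)

lemma invertible_mult_mem_image:
  assumes "invertible (A :: real^'d^'d)"
  shows "A *v v \<in> (\<lambda>v. A *v v) ` S \<longleftrightarrow> v \<in> S"
proof -
  have "inj ((*v) A)"
    using assms by (simp add: invertible_left_inverse matrix_left_invertible_injective)
  then show ?thesis by (rule inj_image_mem_iff)
qed

lemma flags_eqI:
  assumes "F \<in> flags" "G \<in> flags" "\<And>k. F k \<subseteq> (G k :: (real^'d) set)"
  shows "F = G"
proof
  fix k
  show "F k = G k"
    using assms(3) flagsD[OF assms(1)] flagsD[OF assms(2)] by (intro subspace_dim_equal) auto
qed

text \<open>In a linear relation between the \<open>b k\<close>, the last vector with a nonzero coefficient would lie in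
  the preceding subspace of the flag. So the vectors are independent, and the two flags agree because
  one is contained in the other and dimensions match.\<close>

lemma adapted_basis:
  fixes b :: "nat \<Rightarrow> real^'d"
  assumes F: "F \<in> flags" and b: "\<And>k. k \<in> {1..CARD('d)} \<Longrightarrow> b k \<in> F k \<and> b k \<notin> F (k - 1)"
  shows "invertible (cols b)" "flag_act (cols b) std_flag = F"
proof -
  show inv: "invertible (cols b)"
    unfolding invertible_iff_inj
  proof (intro allI impI, rule ccontr)
    fix y assume y0: "cols b *v y = 0" and "y \<noteq> 0"
    define M where "M = {i \<in> {1..CARD('d)}. y $ coord i \<noteq> 0}"
    have "M \<noteq> {}"
    proof -
      from \<open>y \<noteq> 0\<close> obtain j where "y $ j \<noteq> 0" by (auto simp: vec_eq_iff)
      then have "idx j \<in> M" using idx_range[of j] by (simp add: M_def)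
      then show ?thesis by auto
    qed
    have fin: "finite M" by (simp add: M_def)
    define m where "m = Max M"
    have m: "m \<in> M" "\<And>i. i \<in> M \<Longrightarrow> i \<le> m"
      using fin \<open>M \<noteq> {}\<close> by (auto simp: m_def)
    then have m1: "m \<in> {1..CARD('d)}" "y $ coord m \<noteq> 0" by (auto simp: M_def)
    have "0 = (\<Sum>i\<in>{1..CARD('d)}. y $ coord i *\<^sub>R b i)" using y0 by (simp add: cols_mult)
    also have "\<dots> = y $ coord m *\<^sub>R b m + (\<Sum>i\<in>{1..CARD('d)} - {m}. y $ coord i *\<^sub>R b i)"
      by (rule sum.remove) (use m1 in auto)
    finally have e: "y $ coord m *\<^sub>R b m = - (\<Sum>i\<in>{1..CARD('d)} - {m}. y $ coord i *\<^sub>R b i)"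
      by (simp add: eq_neg_iff_add_eq_0)
    have "(\<Sum>i\<in>{1..CARD('d)} - {m}. y $ coord i *\<^sub>R b i) \<in> F (m - 1)"
    proof (rule subspace_sum[OF flagsD(1)[OF F]])
      fix i assume i: "i \<in> {1..CARD('d)} - {m}"
      show "y $ coord i *\<^sub>R b i \<in> F (m - 1)"
      proof (cases "y $ coord i = 0")
        case True then show ?thesis using subspace_0[OF flagsD(1)[OF F]] by simp
      next
        case False
        then have "i \<in> M" using i by (simp add: M_def)
        then have "i \<le> m - 1" using m(2)[of i] i by auto
        then have "b i \<in> F (m - 1)" using b[of i] i flagsD(3)[OF F, of i "m - 1"] by auto
        then show ?thesis by (rule subspace_scale[OF flagsD(1)[OF F]])
      qed
    qed
    then have "y $ coord m *\<^sub>R b m \<in> F (m - 1)"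
      unfolding e by (rule subspace_neg[OF flagsD(1)[OF F]])
    then have "(1 / (y $ coord m)) *\<^sub>R (y $ coord m *\<^sub>R b m) \<in> F (m - 1)"
      by (rule subspace_scale[OF flagsD(1)[OF F]])
    then show False using m1 b[of m] by simp
  qed
  show "flag_act (cols b) std_flag = F"
  proof (rule flags_eqI)
    show "flag_act (cols b) std_flag \<in> flags" using inv std_flag_flags by (rule flag_act_flags)
    show "F \<in> flags" by fact
    fix k
    show "flag_act (cols b) std_flag k \<subseteq> F k"
    proof
      fix v assume "v \<in> flag_act (cols b) std_flag k"
      then obtain y where y: "y \<in> std_flag k" "v = cols b *v y" by (auto simp: flag_act_def)
      have "(\<Sum>i\<in>{1..CARD('d)}. y $ coord i *\<^sub>R b i) \<in> F k"
      proof (rule subspace_sum[OF flagsD(1)[OF F]])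
        fix i assume i: "i \<in> {1..CARD('d)}"
        show "y $ coord i *\<^sub>R b i \<in> F k"
        proof (cases "k < i")
          case True
          then show ?thesis using y(1) i subspace_0[OF flagsD(1)[OF F]] by (auto simp: std_flag_iff)
        next
          case False
          then have "b i \<in> F k" using b[of i] i flagsD(3)[OF F, of i k] by auto
          then show ?thesis by (rule subspace_scale[OF flagsD(1)[OF F]])
        qed
      qed
      then show "v \<in> F k" using y by (simp add: cols_mult)
    qed
  qed
qed

lemma flag_transitive:
  assumes F: "F \<in> flags"
  obtains A :: "real^'d^'d" where "invertible A" "F = flag_act A std_flag"
proof -
  have "\<exists>v. v \<in> F k \<and> v \<notin> F (k - 1)" if k: "k \<in> {1..CARD('d)}" for k
  proof (rule ccontr)
    assume "\<not> ?thesis"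
    then have "F k \<subseteq> F (k - 1)" by auto
    then have "dim (F k) \<le> dim (F (k - 1))" by (rule dim_subset)
    then show False using k flagsD(2)[OF F, of k] flagsD(2)[OF F, of "k - 1"] by auto
  qed
  then obtain b where "\<And>k. k \<in> {1..CARD('d)} \<Longrightarrow> b k \<in> F k \<and> b k \<notin> F (k - 1)" by metis
  from adapted_basis[OF F this] that show ?thesis by metis
qed

section \<open>Transverse flags\<close>

text \<open>Two transverse flags cut out the lines \<open>F i \<inter> G (d - i + 1)\<close>. A basis chosen from these lines is
  adapted to \<open>F\<close> and, in reverse order, to \<open>G\<close>, so both flags become coordinate flags.\<close>

lemma transverse_basis:
  fixes b :: "nat \<Rightarrow> real^'d"
  assumes F: "F \<in> flags" and G: "G \<in> flags" and tr: "transverse F G"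
    and b: "\<And>i. i \<in> {1..CARD('d)} \<Longrightarrow> b i \<noteq> 0 \<and> b i \<in> F i \<and> b i \<in> G (CARD('d) - i + 1)"
  shows "invertible (cols b)" "flag_act (cols b) std_flag = F"
    and "cols b *v y \<in> F k \<longleftrightarrow> (\<forall>i\<in>{1..CARD('d)}. k < i \<longrightarrow> y $ coord i = 0)"
    and "cols b *v y \<in> G k \<longleftrightarrow> (\<forall>i\<in>{1..CARD('d)}. i \<le> CARD('d) - k \<longrightarrow> y $ coord i = 0)"
proof -
  let ?d = "CARD('d)"
  have tr': "v = 0" if "v \<in> F k" "v \<in> G (?d - k)" "k \<le> ?d" for v k
    using tr that unfolding transverse_def by blast
  have bF: "b k \<in> F k \<and> b k \<notin> F (k - 1)" if k: "k \<in> {1..?d}" for k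
  proof -
    have "?d - (k - 1) = ?d - k + 1" using k by auto
    then have "b k \<notin> F (k - 1)" using tr'[of "b k" "k - 1"] b[OF k] k by fastforce
    then show ?thesis using b[OF k] by auto
  qed
  show inv: "invertible (cols b)" and act: "flag_act (cols b) std_flag = F"
    using adapted_basis[OF F bF] by auto
  show "cols b *v y \<in> F k \<longleftrightarrow> (\<forall>i\<in>{1..?d}. k < i \<longrightarrow> y $ coord i = 0)"
    unfolding act[symmetric] flag_act_def invertible_mult_mem_image[OF inv] std_flag_iff ..
  define b' where "b' k = b (?d + 1 - k)" for k
  have bG: "b' k \<in> G k \<and> b' k \<notin> G (k - 1)" if k: "k \<in> {1..?d}" for k
  proof -
    let ?j = "?d + 1 - k"
    have j: "?j \<in> {1..?d}" "?d - ?j + 1 = k" "?d - ?j = k - 1" using k by auto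
    have "b ?j \<notin> G (k - 1)" using tr'[of "b ?j" ?j] b[OF j(1)] j by auto
    then show ?thesis using b[OF j(1)] j(2) by (simp add: b'_def)
  qed
  have inv': "invertible (cols b')" and act': "flag_act (cols b') std_flag = G"
    using adapted_basis[OF G bG] by auto
  define y' :: "real^'d" where "y' = (\<chi> j. y $ coord (?d + 1 - idx j))"
  have y': "y' $ coord i = y $ coord (?d + 1 - i)" if "i \<in> {1..?d}" for i
    using that by (simp add: y'_def idx_coord)
  have "cols b *v y = (\<Sum>i\<in>{1..?d}. y $ coord (?d + 1 - i) *\<^sub>R b (?d + 1 - i))"
    unfolding cols_mult
    by (rule sum.reindex_bij_witness[of _ "\<lambda>i. ?d + 1 - i" "\<lambda>i. ?d + 1 - i"]) auto
  also have "\<dots> = cols b' *v y'"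
    unfolding cols_mult by (intro sum.cong refl) (simp add: b'_def y')
  finally have "cols b *v y \<in> G k \<longleftrightarrow> y' \<in> std_flag k"
    unfolding act'[symmetric] flag_act_def by (simp add: invertible_mult_mem_image[OF inv'])
  also have "\<dots> \<longleftrightarrow> (\<forall>i\<in>{1..?d}. k < i \<longrightarrow> y $ coord (?d + 1 - i) = 0)"
    unfolding std_flag_iff by (auto simp: y')
  also have "\<dots> \<longleftrightarrow> (\<forall>i\<in>{1..?d}. i \<le> ?d - k \<longrightarrow> y $ coord i = 0)"
  proof (intro iffI ballI impI)
    fix i assume h: "\<forall>i\<in>{1..?d}. k < i \<longrightarrow> y $ coord (?d + 1 - i) = 0" "i \<in> {1..?d}" "i \<le> ?d - k"
    have "?d + 1 - i \<in> {1..?d}" "k < ?d + 1 - i" "?d + 1 - (?d + 1 - i) = i" using h by auto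
    then show "y $ coord i = 0" using h(1) by metis
  next
    fix i assume h: "\<forall>i\<in>{1..?d}. i \<le> ?d - k \<longrightarrow> y $ coord i = 0" "i \<in> {1..?d}" "k < i"
    have "?d + 1 - i \<in> {1..?d}" "?d + 1 - i \<le> ?d - k" using h by auto
    then show "y $ coord (?d + 1 - i) = 0" using h(1) by metis
  qed
  finally show "cols b *v y \<in> G k \<longleftrightarrow> (\<forall>i\<in>{1..?d}. i \<le> ?d - k \<longrightarrow> y $ coord i = 0)" .
qed

lemma compatible_basis_nonzero:
  assumes "compatible_basis b F G" "i \<in> {1..CARD('d)}"
  shows "b i \<noteq> (0 :: real^'d)" "b i \<in> F i" "b i \<in> G (CARD('d) - i + 1)"
proof -
  have "b i \<in> b ` {1..CARD('d)}" "independent (b ` {1..CARD('d)})"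
    using assms by (auto simp: compatible_basis_def ordered_basis_def)
  then show "b i \<noteq> 0" using dependent_zero by metis
  show "b i \<in> F i" "b i \<in> G (CARD('d) - i + 1)"
    using assms unfolding compatible_basis_def by auto
qed

lemma unit_vector_in_Int:
  fixes S T :: "(real^'d) set"
  assumes "subspace S" "subspace T" "dim S + dim T > CARD('d)"
  obtains v where "norm v = 1" "v \<in> S" "v \<in> T"
proof -
  have "dim {x + y |x y. x \<in> S \<and> y \<in> T} + dim (S \<inter> T) = dim S + dim T"
    using assms by (intro dim_sums_Int)
  moreover have "dim {x + y |x y. x \<in> S \<and> y \<in> T} \<le> CARD('d)"
    using dim_subset_UNIV[of "{x + y |x y. x \<in> S \<and> y \<in> T}"] by simp
  ultimately have "dim (S \<inter> T) \<noteq> 0" using assms by linarith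
  then obtain w where w: "w \<in> S" "w \<in> T" "w \<noteq> 0" by (metis Int_iff dim_eq_0 subsetI singletonI)
  show ?thesis
    by (rule that[of "w /\<^sub>R norm w"]) (use w assms in \<open>auto intro: subspace_scale\<close>)
qed

text \<open>Each \<open>F i \<inter> G (d - i + 1)\<close> is a line, hence a basis compatible with a transverse pair is unique up
  to a diagonal rescaling. Positivity only ever provides some compatible basis; this lemma transports
  the information to a basis fixed in advance.\<close>

lemma transverse_lines:
  fixes b b' :: "nat \<Rightarrow> real^'d"
  assumes F: "F \<in> flags" and G: "G \<in> flags" and tr: "transverse F G"
    and b: "\<And>i. i \<in> {1..CARD('d)} \<Longrightarrow> b i \<noteq> 0 \<and> b i \<in> F i \<and> b i \<in> G (CARD('d) - i + 1)"
    and b': "\<And>i. i \<in> {1..CARD('d)} \<Longrightarrow> b' i \<noteq> 0 \<and> b' i \<in> F i \<and> b' i \<in> G (CARD('d) - i + 1)"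
  obtains t where "\<And>i. i \<in> {1..CARD('d)} \<Longrightarrow> t i \<noteq> 0 \<and> b' i = t i *\<^sub>R b i"
proof -
  let ?d = "CARD('d)"
  note B = transverse_basis[OF F G tr b]
  have "\<exists>t. t \<noteq> 0 \<and> b' i = t *\<^sub>R b i" if i: "i \<in> {1..?d}" for i
  proof -
    obtain y where y: "cols b *v y = b' i"
      using B(1) by (metis invertible_right_inverse matrix_right_invertible_surjective surjD)
    have z: "y $ coord j = 0" if j: "j \<in> {1..?d}" "j \<noteq> i" for j
    proof -
      have "cols b *v y \<in> F i" "cols b *v y \<in> G (?d - i + 1)" using y b'[OF i] by auto
      then have "i < j \<longrightarrow> y $ coord j = 0" "j \<le> ?d - (?d - i + 1) \<longrightarrow> y $ coord j = 0"
        using B(3)[of y i] B(4)[of y "?d - i + 1"] j by blast+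
      then show ?thesis using i j by (cases "i < j") auto
    qed
    have "b' i = (\<Sum>j\<in>{1..?d}. y $ coord j *\<^sub>R b j)" using y by (simp add: cols_mult)
    also have "\<dots> = (\<Sum>j\<in>{i}. y $ coord j *\<^sub>R b j)"
      by (rule sum.mono_neutral_right) (use i z in auto)
    finally have "b' i = y $ coord i *\<^sub>R b i" by simp
    then show ?thesis using b'[OF i] by (intro exI[of _ "y $ coord i"]) auto
  qed
  then show ?thesis using that by metis
qed

section \<open>Minors\<close>

text \<open>The Leibniz sum over columns instead of rows, in which a linear relation between columns can be
  inserted.\<close>

lemma minor_by_columns:
  "minor k r s c = (\<Sum>p | p permutes {1..k}. of_int (sign p) * (\<Prod>j\<in>{1..k}. c (r (p j)) (s j)))"
proof -
  let ?i = "inv_into UNIV :: (nat \<Rightarrow> nat) \<Rightarrow> nat \<Rightarrow> nat"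
  show ?thesis
    unfolding minor_def
  proof (rule sum.reindex_bij_witness[of _ "inv_into UNIV" "inv_into UNIV"])
    fix p assume "p \<in> {p. p permutes {1..k}}"
    then have p: "p permutes {1..k}" by simp
    show "?i (?i p) = p" by (rule permutes_inv_inv[OF p])
    show "?i p \<in> {p. p permutes {1..k}}" using permutes_inv[OF p] by simp
    have "(\<Prod>j\<in>{1..k}. c (r (?i p j)) (s j)) = (\<Prod>i\<in>{1..k}. c (r (?i p (p i))) (s (p i)))"
      using prod.permute[OF p, of "\<lambda>j. c (r (?i p j)) (s j)"] by (simp add: comp_def)
    also have "\<dots> = (\<Prod>i\<in>{1..k}. c (r i) (s (p i)))"
      by (simp add: permutes_inverses[OF p])
    finally show "of_int (sign (?i p)) * (\<Prod>j\<in>{1..k}. c (r (?i p j)) (s j)) =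
        of_int (sign p) * (\<Prod>i\<in>{1..k}. c (r i) (s (p i)))"
      by (simp add: sign_inverse permutes_imp_permutation[OF _ p])
  next
    fix p assume "p \<in> {p. p permutes {1..k}}"
    then have p: "p permutes {1..k}" by simp
    show "?i (?i p) = p" by (rule permutes_inv_inv[OF p])
    show "?i p \<in> {p. p permutes {1..k}}" using permutes_inv[OF p] by simp
  qed
qed

text \<open>A column \<open>j0\<close> with nonzero coefficient is a combination of the other columns. After inserting that
  combination, every term has two equal columns, and composing with their transposition cancels the
  summands in pairs.\<close>

lemma minor_eq_0_if_kernel:
  fixes c :: "nat \<Rightarrow> nat \<Rightarrow> real"
  assumes ker: "\<And>i. i \<in> {1..k} \<Longrightarrow> (\<Sum>j\<in>{1..k}. c (r i) (s j) * y j) = 0"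
    and j0: "j0 \<in> {1..k}" "y j0 \<noteq> 0"
  shows "minor k r s c = 0"
proof -
  let ?P = "{p. p permutes {1..k}}"
  let ?R = "\<lambda>p. \<Prod>j\<in>{1..k}-{j0}. c (r (p j)) (s j)"
  \<comment> \<open>The determinant with column \<open>j0\<close> replaced by column \<open>j1\<close>.\<close>
  define D where "D j1 = (\<Sum>p\<in>?P. of_int (sign p) * (c (r (p j0)) (s j1) * ?R p))" for j1
  have finP: "finite ?P" by (simp add: finite_permutations)
  have D0: "D j1 = 0" if j1: "j1 \<in> {1..k}" "j1 \<noteq> j0" for j1
  proof -
    let ?t = "Transposition.transpose j0 j1"
    let ?f = "\<lambda>p. of_int (sign p) * (c (r (p j0)) (s j1) * ?R p)"
    have t: "?t permutes {1..k}" using j0 j1 by (intro permutes_swap_id) auto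
    have split: "?R p = c (r (p j1)) (s j1) * (\<Prod>j\<in>{1..k}-{j0}-{j1}. c (r (p j)) (s j))" for p
      using j1 by (subst prod.remove[of _ j1]) auto
    have neg: "?f (p \<circ> ?t) = - ?f p" if p: "p \<in> ?P" for p
    proof -
      have pp: "p permutes {1..k}" using p by simp
      have "sign (p \<circ> ?t) = - sign p"
        using pp t j1(2) permutes_imp_permutation[of "{1..k}"]
        by (subst sign_compose) (auto simp: sign_swap_id)
      moreover have "(\<Prod>j\<in>{1..k}-{j0}-{j1}. c (r ((p \<circ> ?t) j)) (s j)) =
          (\<Prod>j\<in>{1..k}-{j0}-{j1}. c (r (p j)) (s j))"
        by (rule prod.cong) (auto simp: Transposition.transpose_def)
      ultimately show ?thesis unfolding split by simp
    qed
    have t': "?t permutes {Suc 0..k}" using t by simp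
    have "D j1 = (\<Sum>p\<in>?P. ?f (p \<circ> ?t))"
      unfolding D_def
      by (rule sum.reindex_bij_witness[of _ "\<lambda>p. p \<circ> ?t" "\<lambda>p. p \<circ> ?t"])
         (auto simp: comp_assoc intro: permutes_compose[OF t'])
    also have "\<dots> = (\<Sum>p\<in>?P. - ?f p)" by (rule sum.cong[OF refl neg])
    also have "\<dots> = - D j1" by (simp add: D_def sum_negf)
    finally show ?thesis by simp
  qed
  have m: "minor k r s c = D j0"
    unfolding minor_by_columns D_def using j0
    by (intro sum.cong refl) (subst prod.remove[of _ j0], auto)
  have "0 = (\<Sum>p\<in>?P. of_int (sign p) * ((\<Sum>j\<in>{1..k}. c (r (p j0)) (s j) * y j) * ?R p))"
  proof (rule sum.neutral[symmetric], rule ballI)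
    fix p assume "p \<in> ?P"
    then have "p j0 \<in> {1..k}" using permutes_in_image[of p "{1..k}" j0] j0 by simp
    then show "of_int (sign p) * ((\<Sum>j\<in>{1..k}. c (r (p j0)) (s j) * y j) * ?R p) = 0"
      using ker by simp
  qed
  also have "\<dots> = (\<Sum>p\<in>?P. \<Sum>j\<in>{1..k}. y j * (of_int (sign p) * (c (r (p j0)) (s j) * ?R p)))"
    by (simp add: sum_distrib_left sum_distrib_right mult_ac)
  also have "\<dots> = (\<Sum>j\<in>{1..k}. y j * D j)"
    by (subst sum.swap) (simp add: D_def sum_distrib_left)
  also have "\<dots> = (\<Sum>j\<in>{j0}. y j * D j)"
    by (rule sum.mono_neutral_right) (use j0 D0 in auto)
  finally show ?thesis using m j0 by simp
qed

text \<open>The 0-1 matrix with ones exactly at the positions \<open>(r e, s e)\<close> is upper triangular, and only the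
  identity permutation contributes to its minor.\<close>

lemma not_forced_zero:
  assumes r: "minor_index n k r" and s: "minor_index n k s"
    and le: "\<And>i. i \<in> {1..k} \<Longrightarrow> r i \<le> s i"
  shows "\<not> forced_zero_minor n k r s"
proof -
  define c :: "nat \<Rightarrow> nat \<Rightarrow> real" where
    "c i j = (if \<exists>e\<in>{1..k}. i = r e \<and> j = s e then 1 else 0)" for i j
  have inj: "inj_on r {1..k}" "inj_on s {1..k}"
    using r s strict_mono_on_imp_inj_on unfolding minor_index_def by blast+
  have up: "upper_triangular n c"
    unfolding upper_triangular_def c_def using le by fastforce
  have c1: "c (r i) (s j) = (if i = j then 1 else 0)" if "i \<in> {1..k}" "j \<in> {1..k}" for i j
  proof -
    have "(\<exists>e\<in>{1..k}. r i = r e \<and> s j = s e) \<longleftrightarrow> i = j"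
      using that inj_on_eq_iff[OF inj(1)] inj_on_eq_iff[OF inj(2)] by blast
    then show ?thesis by (simp add: c_def)
  qed
  have "minor k r s c = (\<Sum>p | p permutes {1..k}. if p = id then 1 else 0)"
    unfolding minor_def
  proof (rule sum.cong[OF refl])
    fix p assume "p \<in> {p. p permutes {1..k}}"
    then have p: "p permutes {1..k}" by simp
    have e: "(\<Prod>i\<in>{1..k}. c (r i) (s (p i))) = (\<Prod>i\<in>{1..k}. if i = p i then 1 else 0)"
      using c1 permutes_in_image[OF p] by (intro prod.cong) auto
    show "of_int (sign p) * (\<Prod>i\<in>{1..k}. c (r i) (s (p i))) = (if p = id then 1 else 0)"
    proof (cases "p = id")
      case False
      then obtain i where "p i \<noteq> i" by (auto simp: fun_eq_iff)
      then have "i \<in> {1..k}" using permutes_not_in[OF p] by metis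
      then have "(\<Prod>i\<in>{1..k}. if i = p i then 1 else (0::real)) = 0"
        using \<open>p i \<noteq> i\<close> by (intro prod_zero) (auto intro!: bexI[of _ i])
      then show ?thesis using e False by simp
    next
      case True
      then show ?thesis unfolding e by (simp add: sign_id)
    qed
  qed
  also have "\<dots> = 1"
    by (simp add: finite_permutations permutes_id)
  finally show ?thesis using up unfolding forced_zero_minor_def by (metis zero_neq_one)
qed

section \<open>Positive triples\<close>

text \<open>The total positivity of \<open>u\<close> enters here. Write \<open>w = u v\<close> with \<open>v\<close> in the span of the last \<open>k\<close> basis
  vectors. The first \<open>k - 1\<close> coordinates of \<open>w\<close> vanish since \<open>w\<close> lies in \<open>G (d - k + 1)\<close>. If coordinate
  \<open>e\<close> vanished as well, then \<open>v\<close> would be a kernel vector of the submatrix of \<open>u\<close> with rows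
  \<open>1, ..., k - 1, e\<close> and the last \<open>k\<close> columns, whose determinant is positive.\<close>

lemma U_pos_coordinates:
  fixes b :: "nat \<Rightarrow> real^'d"
  assumes F: "F \<in> flags" and G: "G \<in> flags" and tr: "transverse F G"
    and comp: "compatible_basis b F G" and u: "u \<in> U_pos b"
    and k: "k \<in> {1..CARD('d)}" and e: "e \<in> {k..CARD('d)}"
    and w: "w \<in> flag_act u G k" "w \<in> G (CARD('d) - k + 1)" "w \<noteq> 0"
    and y: "w = cols b *v y"
  shows "y $ coord e \<noteq> 0"
proof
  assume ye: "y $ coord e = 0"
  let ?d = "CARD('d)"
  have b: "\<And>i. i \<in> {1..?d} \<Longrightarrow> b i \<noteq> 0 \<and> b i \<in> F i \<and> b i \<in> G (?d - i + 1)"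
    using compatible_basis_nonzero[OF comp] by auto
  note B = transverse_basis[OF F G tr b]
  obtain c where c: "\<And>j. j \<in> {1..?d} \<Longrightarrow> u *v b j = (\<Sum>i\<in>{1..?d}. c i j *\<^sub>R b i)"
    and pos: "\<And>r s. minor_index ?d k r \<Longrightarrow> minor_index ?d k s \<Longrightarrow>
        \<not> forced_zero_minor ?d k r s \<Longrightarrow> minor k r s c > 0"
    using u k unfolding U_pos_def by blast
  obtain v where v: "v \<in> G k" "w = u *v v" using w(1) by (auto simp: flag_act_def)
  obtain x where x: "cols b *v x = v"
    using B(1) by (metis invertible_right_inverse matrix_right_invertible_surjective surjD)
  have x0: "x $ coord j = 0" if "j \<in> {1..?d}" "j \<le> ?d - k" for j
    using B(4)[of x k] x v that by auto
  define z :: "real^'d" where "z = (\<chi> i. \<Sum>j\<in>{1..?d}. c (idx i) j * x $ coord j)"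
  have "w = (\<Sum>j\<in>{1..?d}. x $ coord j *\<^sub>R (u *v b j))"
    unfolding v(2) x[symmetric] cols_mult
    by (simp add: linear_sum[OF matrix_vector_mul_linear] linear_scale[OF matrix_vector_mul_linear])
  also have "\<dots> = (\<Sum>j\<in>{1..?d}. \<Sum>i\<in>{1..?d}. (x $ coord j * c i j) *\<^sub>R b i)"
    by (intro sum.cong refl) (simp only: c scaleR_sum_right scaleR_scaleR)
  also have "\<dots> = (\<Sum>i\<in>{1..?d}. (\<Sum>j\<in>{1..?d}. x $ coord j * c i j) *\<^sub>R b i)"
    by (subst sum.swap) (simp add: scaleR_sum_left)
  also have "\<dots> = cols b *v z"
    unfolding cols_mult by (intro sum.cong refl) (simp add: z_def idx_coord mult.commute)
  finally have "cols b *v (y - z) = 0" using y by (simp add: matrix_vector_mult_diff_distrib)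
  then have yz: "y = z" using B(1) unfolding invertible_iff_inj by auto
  define s where "s j = ?d - k + j" for j
  define r where "r i = (if i < k then i else e)" for i
  have mi: "minor_index ?d k r" "minor_index ?d k s"
  proof -
    have "strict_mono_on {1..k} r" "strict_mono_on {1..k} s"
      using e by (auto simp: strict_mono_on_def r_def s_def)
    moreover have "r i \<in> {1..?d} \<and> s i \<in> {1..?d}" if "i \<in> {1..k}" for i
      using that k e by (auto simp: r_def s_def)
    ultimately show "minor_index ?d k r" "minor_index ?d k s"
      unfolding minor_index_def by blast+
  qed
  have "minor k r s c > 0"
  proof (rule pos[OF mi not_forced_zero[OF mi]])
    fix i assume "i \<in> {1..k}"
    then show "r i \<le> s i" using k e by (cases "i < k") (auto simp: r_def s_def)
  qed
  moreover have "minor k r s c = 0"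
  proof -
    have ys: "y $ coord i = (\<Sum>j\<in>{1..k}. c i (s j) * x $ coord (s j))" if i: "i \<in> {1..?d}" for i
    proof -
      have "y $ coord i = (\<Sum>j\<in>{1..?d}. c i j * x $ coord j)"
        using i by (simp add: yz z_def idx_coord)
      also have "\<dots> = (\<Sum>j\<in>{?d - k + 1..?d}. c i j * x $ coord j)"
        by (rule sum.mono_neutral_right) (use x0 in auto)
      also have "\<dots> = (\<Sum>j\<in>{1..k}. c i (s j) * x $ coord (s j))"
        by (rule sum.reindex_bij_witness[of _ s "\<lambda>j. j - (?d - k)"]) (use k in \<open>auto simp: s_def\<close>)
      finally show ?thesis .
    qed
    have y0: "y $ coord i = 0" if "i \<in> {1..?d}" "i < k" for i
      using B(4)[of y "?d - k + 1"] w(2) y that k by auto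
    have "\<exists>j0\<in>{1..k}. x $ coord (s j0) \<noteq> 0"
    proof (rule ccontr)
      assume h: "\<not> ?thesis"
      have "x $ coord j = 0" if j: "j \<in> {1..?d}" for j
      proof (cases "j \<le> ?d - k")
        case False
        then have "j = s (j - (?d - k))" "j - (?d - k) \<in> {1..k}" using j by (auto simp: s_def)
        then show ?thesis using h by metis
      qed (use x0 j in auto)
      then have "cols b *v x = 0" by (simp add: cols_mult)
      then show False using x v w(3) by simp
    qed
    then obtain j0 where j0: "j0 \<in> {1..k}" "x $ coord (s j0) \<noteq> 0" by auto
    show ?thesis
    proof (rule minor_eq_0_if_kernel[where y = "\<lambda>j. x $ coord (s j)", OF _ j0])
      fix i assume i: "i \<in> {1..k}"
      have "r i \<in> {1..?d}" using i k e by (auto simp: r_def)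
      moreover have "y $ coord (r i) = 0" using y0[of i] ye i k by (auto simp: r_def)
      ultimately show "(\<Sum>j\<in>{1..k}. c (r i) (s j) * x $ coord (s j)) = 0" using ys by simp
    qed
  qed
  ultimately show False by simp
qed

text \<open>Rescaling the basis vectors does not affect which coordinates vanish, so the previous lemma holds in
  every basis chosen from the lines of the pair \<open>(F 1, F 3)\<close>.\<close>

lemma positive_triple_coordinates:
  fixes b :: "nat \<Rightarrow> real^'d"
  assumes fl: "F 1 \<in> flags" "F 3 \<in> flags" and pos: "positive_tuple 3 F"
    and b: "\<And>i. i \<in> {1..CARD('d)} \<Longrightarrow> b i \<noteq> 0 \<and> b i \<in> F 1 i \<and> b i \<in> F 3 (CARD('d) - i + 1)"
    and k: "k \<in> {1..CARD('d)}" and e: "e \<in> {k..CARD('d)}"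
    and w: "cols b *v y \<in> F 2 k" "cols b *v y \<in> F 3 (CARD('d) - k + 1)" "y \<noteq> 0"
  shows "y $ coord e \<noteq> 0"
proof -
  let ?d = "CARD('d)"
  have tr: "transverse (F 1) (F 3)" using pos by (simp add: positive_tuple_def)
  obtain b' u where b': "compatible_basis b' (F 1) (F 3)"
    and us: "\<forall>i\<in>{2..<3}. u i \<in> U_pos b'"
    and Fs: "\<forall>i\<in>{2..<3}. F i = flag_act (desc_prod u i (3 - i)) (F 3)"
    using pos unfolding positive_tuple_def by (elim conjE exE)
  have two: "(2::nat) \<in> {2..<3}" by simp
  have u: "u 2 \<in> U_pos b'" using us two by (rule bspec)
  have "F 2 = flag_act (desc_prod u 2 (3 - 2)) (F 3)" using Fs two by (rule bspec)
  moreover have "desc_prod u 2 (3 - 2) = u 2"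
    using desc_prod.simps(2)[of u 2 0] by simp
  ultimately have F2': "F 2 = flag_act (u 2) (F 3)" by simp
  obtain t where t: "\<And>i. i \<in> {1..?d} \<Longrightarrow> t i \<noteq> 0 \<and> b i = t i *\<^sub>R b' i"
    using transverse_lines[OF fl tr, of b' b] b compatible_basis_nonzero[OF b'] by metis
  define y' :: "real^'d" where "y' = (\<chi> i. t (idx i) * y $ i)"
  have e': "cols b *v y = cols b' *v y'"
    unfolding cols_mult by (intro sum.cong refl) (use t in \<open>simp add: y'_def idx_coord\<close>)
  have "cols b *v y \<noteq> 0"
    using transverse_basis(1)[OF fl tr b] w(3) unfolding invertible_iff_inj by auto
  then have "y' $ coord e \<noteq> 0"
    using U_pos_coordinates[OF fl tr b' u k e, of "cols b *v y" y'] w e' F2' by simp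
  then show ?thesis by (simp add: y'_def)
qed

section \<open>Convergence of matrices and flags\<close>

lemma tendsto_det:
  assumes "(A \<longlongrightarrow> (A0 :: real^'d^'d)) net"
  shows "((\<lambda>n. det (A n)) \<longlongrightarrow> det A0) net"
  unfolding det_def by (intro tendsto_intros assms)

lemma tendsto_matrix_mult:
  assumes "(A \<longlongrightarrow> (A0 :: real^'d^'d)) net" "(B \<longlongrightarrow> B0) net"
  shows "((\<lambda>n. A n ** B n) \<longlongrightarrow> A0 ** (B0 :: real^'d^'d)) net"
  unfolding matrix_matrix_mult_def by (intro tendsto_intros assms)

lemma tendsto_matrix_vector_mult:
  assumes "(A \<longlongrightarrow> (A0 :: real^'d^'d)) net" "(B \<longlongrightarrow> B0) net"
  shows "((\<lambda>n. A n *v B n) \<longlongrightarrow> A0 *v B0) net"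
  unfolding matrix_vector_mult_def by (intro tendsto_intros assms)

lemma tendsto_transpose:
  assumes "(A \<longlongrightarrow> (A0 :: real^'d^'d)) net"
  shows "((\<lambda>n. transpose (A n)) \<longlongrightarrow> transpose A0) net"
  unfolding transpose_def by (intro tendsto_intros assms)

text \<open>By Cramer's rule the solution of a linear system is a continuous function of its data.\<close>

lemma tendsto_solve:
  fixes A :: "'n \<Rightarrow> real^'d^'d"
  assumes A: "(A \<longlongrightarrow> A0) net" and inv: "invertible A0"
    and v: "((\<lambda>n. A n *v x n) \<longlongrightarrow> A0 *v x0) net"
  shows "(x \<longlongrightarrow> x0) net"
proof (rule vec_tendstoI)
  fix k
  let ?N = "\<lambda>n. det (\<chi> i j. if j = k then (A n *v x n) $ i else A n $ i $ j)"
  have det: "det A0 \<noteq> 0" using inv by (simp add: invertible_det_nz)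
  have "((\<lambda>n. if j = k then (A n *v x n) $ i else A n $ i $ j) \<longlongrightarrow>
      (if j = k then (A0 *v x0) $ i else A0 $ i $ j)) net" for i j
    by (cases "j = k") (auto intro!: tendsto_vec_nth A v)
  then have "(?N \<longlongrightarrow> det (\<chi> i j. if j = k then (A0 *v x0) $ i else A0 $ i $ j)) net"
    by (intro tendsto_det tendsto_vec_lambda)
  then have "((\<lambda>n. ?N n / det (A n)) \<longlongrightarrow> (x0 $ k * det A0) / det A0) net"
    unfolding cramer_lemma by (intro tendsto_divide tendsto_det A det)
  moreover have "eventually (\<lambda>n. ?N n / det (A n) = x n $ k) net"
    using tendsto_imp_eventually_ne[OF tendsto_det[OF A] det]
    by eventually_elim (simp add: cramer_lemma)
  ultimately show "((\<lambda>n. x n $ k) \<longlongrightarrow> x0 $ k) net"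
    using det by (simp add: tendsto_cong)
qed

lemma open_invertible: "open {A :: real^'d^'d. invertible A}"
proof -
  have "continuous_on UNIV (\<lambda>A :: real^'d^'d. det A)"
    unfolding continuous_on_def by (auto intro: tendsto_det)
  then have "open {A :: real^'d^'d. det A \<noteq> 0}"
    by (intro open_Collect_neq continuous_on_const)
  then show ?thesis by (simp add: invertible_det_nz)
qed

lemma topspace_flag_topology: "topspace flag_topology = (flags :: 'd::finite flag set)"
proof
  show "topspace flag_topology \<subseteq> (flags :: 'd flag set)"
    using openin_topspace[of "flag_topology :: 'd flag topology"] unfolding openin_flag_topology by simp
  have "{A :: real^'d^'d. invertible A \<and> flag_act A std_flag \<in> flags} = {A. invertible A}"
    using flag_act_flags[OF _ std_flag_flags] by auto
  then have "openin flag_topology (flags :: 'd flag set)"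
    unfolding openin_flag_topology by (simp add: open_invertible)
  then show "flags \<subseteq> topspace (flag_topology :: 'd flag topology)"
    by (rule openin_subset)
qed

lemma invertible_cancel:
  assumes "invertible (A :: real^'d^'d)"
  shows "A ** matrix_inv A = mat 1" "matrix_inv A ** A = mat 1"
proof -
  have "A ** matrix_inv A = mat 1 \<and> matrix_inv A ** A = mat 1"
    using assms unfolding invertible_def matrix_inv_def by (rule someI_ex)
  then show "A ** matrix_inv A = mat 1" "matrix_inv A ** A = mat 1" by auto
qed

lemma invertible_matrix_inv: "invertible (A :: real^'d^'d) \<Longrightarrow> invertible (matrix_inv A)"
  using invertible_cancel unfolding invertible_def by blast

text \<open>The orbit map is open: the preimage of the image of a ball is the union of the translates of that ball
  by the stabilizer of the standard flag.\<close>

lemma openin_flag_ball: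
  fixes A :: "real^'d^'d"
  shows "openin flag_topology {flag_act B std_flag | B. invertible B \<and> dist B A < e}"
    (is "openin _ ?U")
  unfolding openin_flag_topology
proof
  show "?U \<subseteq> flags" using flag_act_flags[OF _ std_flag_flags] by auto
  define St where "St = {h :: real^'d^'d. invertible h \<and> flag_act h std_flag = std_flag}"
  have "{B. invertible B \<and> flag_act B std_flag \<in> ?U} =
      (\<Union>h\<in>St. {B. invertible B} \<inter> {B. dist (B ** h) A < e})" (is "?L = ?R")
  proof (intro equalityI subsetI)
    fix B assume "B \<in> ?L"
    then obtain C where C: "invertible B" "invertible C" "dist C A < e"
      "flag_act B std_flag = flag_act C std_flag" by auto
    define h where "h = matrix_inv B ** C"
    have "flag_act h std_flag = flag_act (matrix_inv B) (flag_act B std_flag)"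
      by (simp add: h_def C(4) flag_act_compose)
    also have "\<dots> = std_flag" using invertible_cancel[OF C(1)] by (simp add: flag_act_compose)
    finally have "h \<in> St"
      using C invertible_matrix_inv by (auto simp: St_def h_def intro: invertible_mult)
    moreover have "B ** h = C"
      using invertible_cancel[OF C(1)] by (simp add: h_def matrix_mul_assoc)
    ultimately show "B \<in> ?R" using C by auto
  next
    fix B assume "B \<in> ?R"
    then obtain h where h: "h \<in> St" "invertible B" "dist (B ** h) A < e" by auto
    then have "invertible (B ** h)" "flag_act B std_flag = flag_act (B ** h) std_flag"
      by (auto simp: St_def flag_act_compose[symmetric] intro: invertible_mult)
    then show "B \<in> ?L" using h by auto
  qed
  also have "open \<dots>"
  proof (intro open_UN ballI open_Int open_invertible open_Collect_less continuous_on_const continuous_on_dist)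
    fix h :: "real^'d^'d"
    show "continuous_on UNIV (\<lambda>B :: real^'d^'d. B ** h)"
      unfolding continuous_on_def by (auto intro!: tendsto_matrix_mult tendsto_const tendsto_ident_at)
  qed
  finally show "open {B. invertible B \<and> flag_act B std_flag \<in> ?U}" .
qed

text \<open>If for every tolerance suitable points exist eventually, then points that nearly minimize the distance
  to \<open>A\<close> form a convergent sequence.\<close>

lemma choose_convergent:
  fixes A :: "'a::metric_space"
  assumes "\<And>e. e > 0 \<Longrightarrow> eventually (\<lambda>n. \<exists>B. P n B \<and> dist B A < e) sequentially"
  obtains B where "B \<longlonglongrightarrow> A" "eventually (\<lambda>n. P n (B n)) sequentially"
proof -
  define D where "D n = {dist C A | C. P n C}" for n
  define B where "B n = (SOME C. P n C \<and> dist C A < Inf (D n) + 1 / Suc n)" for n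
  have bdd: "bdd_below (D n)" for n unfolding D_def by (intro bdd_belowI[of _ 0]) auto
  have B: "P n (B n) \<and> dist (B n) A < Inf (D n) + 1 / Suc n" if ne: "D n \<noteq> {}" for n
  proof -
    have "Inf (D n) < Inf (D n) + 1 / Suc n" by simp
    then obtain r where "r \<in> D n" "r < Inf (D n) + 1 / Suc n"
      using cInf_less_iff[OF ne bdd[of n]] by blast
    then have "\<exists>C. P n C \<and> dist C A < Inf (D n) + 1 / Suc n" by (auto simp: D_def)
    then show ?thesis unfolding B_def by (rule someI_ex)
  qed
  have "B \<longlonglongrightarrow> A"
  proof (rule tendstoI)
    fix e :: real assume "e > 0"
    then have e2: "e / 2 > 0" by simp
    have "(\<lambda>n. 1 / real (Suc n)) \<longlonglongrightarrow> 0" by (rule LIMSEQ_Suc[OF lim_1_over_n])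
    from order_tendstoD(2)[OF this e2] assms[OF e2]
    show "eventually (\<lambda>n. dist (B n) A < e) sequentially"
    proof eventually_elim
      case (elim n)
      then obtain C where C: "P n C" "dist C A < e / 2" by auto
      then have "dist C A \<in> D n" by (auto simp: D_def)
      then have "Inf (D n) \<le> dist C A" "D n \<noteq> {}" using bdd by (auto intro: cInf_lower)
      then show ?case using B[of n] C elim by linarith
    qed
  qed
  moreover have "eventually (\<lambda>n. P n (B n)) sequentially"
    using assms[of 1, simplified]
  proof eventually_elim
    case (elim n)
    then show ?case using B[of n] by (auto simp: D_def)
  qed
  ultimately show ?thesis using that by blast
qed

text \<open>Since the orbit map is open, a convergent sequence of flags lifts to a convergent sequence of matrices;
  after the change of coordinates all flags are the standard one, whose subspaces are closed. For
  flags this determines the limit, since nested subspaces of equal dimension coincide.\<close>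

lemma flag_limit_mem:
  fixes F :: "'d::finite flag"
  assumes lim: "limitin flag_topology Fs F sequentially"
    and v: "\<And>n. v n \<in> Fs n k" "v \<longlonglongrightarrow> w"
  shows "w \<in> F k"
proof -
  have "F \<in> flags" using limitin_topspace[OF lim] by (simp add: topspace_flag_topology)
  then obtain A where A: "invertible A" "F = flag_act A std_flag" by (rule flag_transitive)
  have "eventually (\<lambda>n. \<exists>B. (invertible B \<and> Fs n = flag_act B std_flag) \<and> dist B A < e) sequentially"
    if e: "e > 0" for e
  proof -
    let ?U = "{flag_act B std_flag | B. invertible B \<and> dist B A < e}"
    have "F \<in> ?U" using A e by auto
    then have "eventually (\<lambda>n. Fs n \<in> ?U) sequentially"
      using lim openin_flag_ball unfolding limitin_def by blast
    then show ?thesis by eventually_elim auto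
  qed
  then obtain B where B: "B \<longlonglongrightarrow> A"
    and ev: "eventually (\<lambda>n. invertible (B n) \<and> Fs n = flag_act (B n) std_flag) sequentially"
    by (rule choose_convergent)
  define s where "s n = matrix_inv (B n) *v v n" for n
  have ev2: "eventually (\<lambda>n. B n *v s n = v n \<and> s n \<in> std_flag k) sequentially"
    using ev
  proof eventually_elim
    case (elim n)
    have Bs: "B n *v s n = v n"
      using invertible_cancel[of "B n"] elim by (simp add: s_def matrix_vector_mul_assoc)
    moreover have "B n *v s n \<in> (\<lambda>v. B n *v v) ` std_flag k"
      using v(1)[of n] elim Bs by (simp add: flag_act_def)
    ultimately show ?case using invertible_mult_mem_image elim by metis
  qed
  define s0 where "s0 = matrix_inv A *v w"
  have As0: "A *v s0 = w" using invertible_cancel[OF A(1)] by (simp add: s0_def matrix_vector_mul_assoc)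
  have "(\<lambda>n. B n *v s n) \<longlonglongrightarrow> A *v s0"
    unfolding As0
  proof (rule Lim_transform_eventually[OF v(2)])
    show "eventually (\<lambda>n. v n = B n *v s n) sequentially"
      using ev2 by eventually_elim simp
  qed
  then have "s \<longlonglongrightarrow> s0" by (rule tendsto_solve[OF B A(1)])
  moreover have "closed (std_flag k :: (real^'d) set)"
    unfolding std_flag_def by (rule closed_span)
  moreover have "eventually (\<lambda>n. s n \<in> std_flag k) sequentially"
    using ev2 by (auto elim: eventually_mono)
  ultimately have "s0 \<in> std_flag k"
    by (intro Lim_in_closed_set[of "std_flag k" s sequentially s0]) auto
  then show ?thesis using A As0 by (auto simp: flag_act_def)
qed

section \<open>Cartan decompositions\<close>

text \<open>Think of \<open>a P = Q D\<close> with \<open>a\<close> the diagonal matrix of singular values and \<open>D\<close> the diagonal matrix of the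
  \<open>lam n j\<close>, whose successive ratios tend to 0. Then \<open>Q\<close> becomes upper triangular in the limit.\<close>

lemma cartan_ratio_upper_triangular:
  fixes P Q :: "nat \<Rightarrow> real^'d^'d"
  assumes P: "P \<longlonglongrightarrow> P0" and Q: "Q \<longlonglongrightarrow> Q0" and inv: "invertible P0"
    and s: "\<And>n k. k \<in> {1..CARD('d)} \<Longrightarrow> s n k > 0"
      "\<And>n k. k \<in> {1..<CARD('d)} \<Longrightarrow> s n (Suc k) \<le> s n k"
    and lam: "\<And>n k. k \<in> {1..CARD('d)} \<Longrightarrow> lam n k > 0"
      "\<And>k. k \<in> {1..<CARD('d)} \<Longrightarrow> (\<lambda>n. lam n (Suc k) / lam n k) \<longlonglongrightarrow> 0"
    and eq: "\<And>n i j. i \<in> {1..CARD('d)} \<Longrightarrow> j \<in> {1..CARD('d)} \<Longrightarrow>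
      s n i * P n $ coord i $ coord j = Q n $ coord i $ coord j * lam n j"
    and ij: "i \<in> {1..CARD('d)}" "j \<in> {1..CARD('d)}" "j < i"
  shows "Q0 $ coord i $ coord j = 0"
proof (rule ccontr)
  assume nz: "Q0 $ coord i $ coord j \<noteq> 0"
  let ?d = "CARD('d)"
  have s_mono: "s n b \<le> s n a" if "a \<le> b" "a \<in> {1..?d}" "b \<le> ?d" for n a b
    using that(1,3)
  proof (induction b rule: dec_induct)
    case base then show ?case by simp
  next
    case (step m)
    have "s n (Suc m) \<le> s n m" using step that by (intro s(2)) auto
    then show ?case using step by simp
  qed
  have ratio: "(\<lambda>n. lam n b / lam n a) \<longlonglongrightarrow> 0" if "Suc a \<le> b" "a \<in> {1..?d}" "b \<le> ?d" for a b
    using that(1,3)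
  proof (induction b rule: dec_induct)
    case base then show ?case using that by (intro lam(2)) auto
  next
    case (step m)
    have "(\<lambda>n. lam n (Suc m) / lam n m * (lam n m / lam n a)) \<longlonglongrightarrow> 0 * 0"
      using step that by (intro tendsto_mult lam(2)) auto
    moreover have "lam n (Suc m) / lam n m * (lam n m / lam n a) = lam n (Suc m) / lam n a" for n
      using lam(1)[of m n] step that by simp
    ultimately show ?case by (simp only: mult_zero_left)
  qed
  have PQ: "(\<lambda>n. P n $ coord i' $ coord j') \<longlonglongrightarrow> P0 $ coord i' $ coord j'"
    "(\<lambda>n. Q n $ coord i' $ coord j') \<longlonglongrightarrow> Q0 $ coord i' $ coord j'" for i' j'
    by (intro tendsto_vec_nth P Q)+
  have lams: "(\<lambda>n. lam n j / s n i) \<longlonglongrightarrow> P0 $ coord i $ coord j / Q0 $ coord i $ coord j"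
  proof -
    have "(\<lambda>n. P n $ coord i $ coord j / Q n $ coord i $ coord j) \<longlonglongrightarrow> P0 $ coord i $ coord j / Q0 $ coord i $ coord j"
      by (intro tendsto_divide PQ nz)
    moreover have "eventually (\<lambda>n. P n $ coord i $ coord j / Q n $ coord i $ coord j = lam n j / s n i) sequentially"
      using tendsto_imp_eventually_ne[OF PQ(2) nz]
    proof eventually_elim
      case (elim n)
      then show ?case using eq[OF ij(1,2), of n] s(1)[OF ij(1), of n]
        by (simp add: frac_eq_eq mult.commute)
    qed
    ultimately show ?thesis by (simp add: tendsto_cong)
  qed
  \<comment> \<open>An entry below the diagonal surviving in the limit forces a large block of zeros in \<open>P0\<close>.\<close>
  have zero: "P0 $ coord i' $ coord j' = 0" if h: "i' \<in> {1..i}" "j' \<in> {Suc j..?d}" for i' j'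
  proof -
    have i': "i' \<in> {1..?d}" and j': "j' \<in> {1..?d}" using h ij by auto
    let ?b = "\<lambda>n. \<bar>Q n $ coord i' $ coord j'\<bar> * (lam n j' / lam n j * (lam n j / s n i))"
    have "?b \<longlonglongrightarrow> \<bar>Q0 $ coord i' $ coord j'\<bar> * (0 * (P0 $ coord i $ coord j / Q0 $ coord i $ coord j))"
      using h ij by (intro tendsto_mult lams ratio tendsto_rabs PQ) auto
    then have b0: "?b \<longlonglongrightarrow> 0" by simp
    have "(\<lambda>n. P n $ coord i' $ coord j') \<longlonglongrightarrow> 0"
    proof (rule Lim_null_comparison[OF always_eventually b0], rule allI)
      fix n
      have pos: "s n i > 0" "s n i' > 0" "lam n j > 0" "lam n j' > 0" "s n i \<le> s n i'"
        using s(1) lam(1) s_mono[of i' i n] ij i' j' h by auto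
      have "P n $ coord i' $ coord j' = Q n $ coord i' $ coord j' * lam n j' / s n i'"
        using eq[OF i' j', of n] pos by (simp add: field_simps)
      then have "norm (P n $ coord i' $ coord j') = \<bar>Q n $ coord i' $ coord j'\<bar> * lam n j' / s n i'"
        using pos by (simp add: abs_mult)
      also have "\<dots> \<le> \<bar>Q n $ coord i' $ coord j'\<bar> * lam n j' / s n i"
        using pos by (intro divide_left_mono) auto
      also have "\<dots> = ?b n" using pos by simp
      finally show "norm (P n $ coord i' $ coord j') \<le> ?b n" .
    qed
    with PQ(1) show ?thesis by (rule LIMSEQ_unique)
  qed
  \<comment> \<open>The transpose of \<open>P0\<close> would map a space of dimension \<open>i\<close> injectively into one of dimension \<open>j\<close>.\<close>
  have invT: "invertible (transpose P0)" using inv by (simp add: invertible_det_nz)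
  have "(\<lambda>v. transpose P0 *v v) ` std_flag i \<subseteq> std_flag j"
  proof
    fix w assume "w \<in> (\<lambda>v. transpose P0 *v v) ` std_flag i"
    then obtain v where v: "v \<in> std_flag i" "w = transpose P0 *v v" by auto
    show "w \<in> std_flag j"
      unfolding std_flag_iff
    proof (intro ballI impI)
      fix j' assume j': "j' \<in> {1..?d}" "j < j'"
      have "w $ coord j' = (\<Sum>i'\<in>{1..?d}. P0 $ coord i' $ coord j' * v $ coord i')"
        unfolding v(2) by (simp add: matrix_vector_mult_def transpose_def sum_coord)
      also have "\<dots> = 0"
      proof (rule sum.neutral, rule ballI)
        fix i' assume i': "i' \<in> {1..?d}"
        show "P0 $ coord i' $ coord j' * v $ coord i' = 0"
          using zero[of i' j'] v(1) i' j' by (cases "i < i'") (auto simp: std_flag_iff)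
      qed
      finally show "w $ coord j' = 0" .
    qed
  qed
  then have "dim ((\<lambda>v. transpose P0 *v v) ` std_flag i) \<le> dim (std_flag j :: (real^'d) set)"
    by (rule dim_subset)
  then have "dim (std_flag i :: (real^'d) set) \<le> dim (std_flag j :: (real^'d) set)"
    unfolding dim_image_invertible[OF invT] .
  then show False using ij by (simp add: dim_std_flag)
qed

lemma diagonal_nth:
  fixes a :: "real^'d^'d"
  assumes "\<forall>k\<in>{1..CARD('d)}. a *v std_basis k = s k *\<^sub>R std_basis k"
  shows "(a *v v) $ i = s (idx i) * v $ i"
proof -
  have "a = cols (\<lambda>k. a *v std_basis k)" by (simp add: cols_of_matrix)
  also have "\<dots> = cols (\<lambda>k. s k *\<^sub>R std_basis k)"
    unfolding cols_def using assms idx_range[where 'd='d] by (subst vec_eq_iff, subst vec_eq_iff) auto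
  finally have "a = cols (\<lambda>k. s k *\<^sub>R std_basis k)" .
  then have "(a *v v) $ i = (\<Sum>k\<in>{1..CARD('d)}. v $ coord k * (s k * std_basis k $ i))"
    by (simp add: cols_mult mult.assoc)
  also have "\<dots> = (\<Sum>k\<in>{1..CARD('d)}. if k = idx i then s k * v $ coord k else 0)"
    by (intro sum.cong refl) (auto simp: std_basis_nth)
  also have "\<dots> = s (idx i) * v $ i"
    using idx_range[of i] by (simp add: idx_std)
  finally show ?thesis .
qed

lemma orthogonal_invertible: "orthogonal_matrix (l :: real^'d^'d) \<Longrightarrow> invertible l"
  unfolding orthogonal_matrix_def invertible_def by blast

lemma cartan_invertible:
  assumes "cartan (g :: real^'d^'d) l s m"
  shows "invertible g"
proof -
  obtain a where a: "\<forall>k\<in>{1..CARD('d)}. a *v std_basis k = s k *\<^sub>R std_basis k" "g = l ** a ** m"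
    and s: "\<forall>k\<in>{1..CARD('d)}. s k > 0" and o: "orthogonal_matrix l" "orthogonal_matrix m"
    using assms unfolding cartan_def by blast
  have "invertible a"
    unfolding invertible_iff_inj
  proof (intro allI impI)
    fix y assume "a *v y = 0"
    then have "s (idx i) * y $ i = 0" for i using diagonal_nth[OF a(1), of y i] by simp
    moreover have "s (idx i) \<noteq> 0" for i :: 'd using s idx_range[of i] by fastforce
    ultimately show "y = 0" by (simp add: vec_eq_iff)
  qed
  then show ?thesis
    unfolding a(2) by (intro invertible_mult orthogonal_invertible[OF o(1)] orthogonal_invertible[OF o(2)])
qed

lemma norm_orthogonal_matrix_mult:
  assumes "orthogonal_matrix (l :: real^'d^'d)"
  shows "norm (l *v v) = norm v"
  using assms orthogonal_transformation_matrix[of "(*v) l"] orthogonal_transformation_norm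
  by (metis matrix_of_matrix_vector_mul matrix_vector_mul_linear)

lemma norm_std_basis: "norm (std_basis i :: real^'d) = 1"
  by (simp add: std_basis_def)

text \<open>Matrices with unit columns range over a compact set.\<close>

lemma norm_cols_le:
  fixes b :: "nat \<Rightarrow> real^'d"
  assumes "\<And>i. i \<in> {1..CARD('d)} \<Longrightarrow> norm (b i) \<le> 1"
  shows "norm (cols b) \<le> real (CARD('d) * CARD('d))"
proof -
  have e: "\<bar>cols b $ r $ j\<bar> \<le> 1" for r j
    using component_le_norm_cart[of "b (idx j)" r] assms[OF idx_range[of j]] by (simp add: cols_def)
  have "norm (cols b) \<le> (\<Sum>r\<in>UNIV. norm (cols b $ r))"
    unfolding norm_vec_def[of "cols b"] by (rule L2_set_le_sum) simp
  also have "\<dots> \<le> (\<Sum>r\<in>(UNIV::'d set). \<Sum>j\<in>(UNIV::'d set). 1)"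
    by (intro sum_mono order_trans[OF norm_le_l1_cart] e)
  finally show ?thesis by simp
qed

text \<open>The linear algebra behind the inclusion of the limit set in the positive curve. Each \<open>g n\<close> maps the
  pair \<open>(T 1, Fy n)\<close> to \<open>(g n T 1, Fp)\<close>; the first pair converges to a transverse pair by positivity, the
  second to the transverse pair \<open>(Fx, Fp)\<close>. In unit vectors \<open>b\<close>, \<open>c\<close> from the lines of these pairs, \<open>g n\<close>
  is diagonal with positive entries \<open>lam n i\<close>. To compare consecutive entries, take a unit vector \<open>w\<close> in
  \<open>T 2 k \<inter> Fy n (d - k + 1)\<close>: in the limit its coordinates \<open>k\<close> and \<open>k + 1\<close> are nonzero because the triple
  \<open>T\<close> is positive, whereas \<open>g n w\<close> is attracted to \<open>Fx k\<close>, where coordinate \<open>k + 1\<close> vanishes. Hence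
  \<open>lam n (k + 1) / lam n k\<close> tends to 0, which identifies the limit of the Cartan flags with \<open>Fx\<close>.\<close>

lemma cartan_flag_limit:
  fixes g l m :: "nat \<Rightarrow> real^'d^'d"
  assumes fl: "T 1 \<in> flags" "T 2 \<in> flags" "T 3 \<in> flags" "Fx \<in> flags" "Fp \<in> flags" "\<And>n. Fy n \<in> flags"
    and pos: "positive_tuple 3 T" and tr: "transverse Fx Fp"
    and limy: "limitin flag_topology Fy (T 3) sequentially"
    and lim1: "limitin flag_topology (\<lambda>n. flag_act (g n) (T 1)) Fx sequentially"
    and lim2: "limitin flag_topology (\<lambda>n. flag_act (g n) (T 2)) Fx sequentially"
    and act: "\<And>n. flag_act (g n) (Fy n) = Fp"
    and cartan: "\<And>n. cartan (g n) (l n) (s n) (m n)"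
    and limF: "limitin flag_topology (\<lambda>n. flag_act (l n) std_flag) F sequentially"
  shows "F = Fx"
proof -
  let ?d = "CARD('d)"
  have Ff: "F \<in> flags" using limitin_topspace[OF limF] by (simp add: topspace_flag_topology)
  have tr13: "transverse (T 1) (T 3)" using pos by (simp add: positive_tuple_def)
  have g_inj: "g n *v v \<noteq> 0" if "v \<noteq> 0" for n v
    using cartan_invertible[OF cartan[of n]] that unfolding invertible_iff_inj by auto
  have ex: "\<exists>v. norm v = 1 \<and> v \<in> G i \<and> v \<in> Fy n (?d - i + 1)"
    if "G \<in> flags" "i \<in> {1..?d}" for G n i
  proof -
    have "dim (G i) + dim (Fy n (?d - i + 1)) > ?d"
      using that flagsD(2)[of G] flagsD(2)[OF fl(6)] by auto
    then show ?thesis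
      using unit_vector_in_Int[OF flagsD(1)[of G i] flagsD(1)[OF fl(6)]] that by metis
  qed
  define b where "b n i = (SOME u. norm u = 1 \<and> u \<in> T 1 i \<and> u \<in> Fy n (?d - i + 1))" for n i
  have b: "norm (b n i) = 1 \<and> b n i \<in> T 1 i \<and> b n i \<in> Fy n (?d - i + 1)" if "i \<in> {1..?d}" for n i
    unfolding b_def by (rule someI_ex) (rule ex[OF fl(1) that])
  define w where "w n i = (SOME u. norm u = 1 \<and> u \<in> T 2 i \<and> u \<in> Fy n (?d - i + 1))" for n i
  have w: "norm (w n i) = 1 \<and> w n i \<in> T 2 i \<and> w n i \<in> Fy n (?d - i + 1)" if "i \<in> {1..?d}" for n i
    unfolding w_def by (rule someI_ex) (rule ex[OF fl(2) that])
  define lam where "lam n i = norm (g n *v b n i)" for n i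
  define nu where "nu n i = norm (g n *v w n i)" for n i
  define c where "c n i = (g n *v b n i) /\<^sub>R lam n i" for n i
  define v where "v n i = (g n *v w n i) /\<^sub>R nu n i" for n i
  have lam: "lam n i > 0" "nu n i > 0" if "i \<in> {1..?d}" for n i
  proof -
    have "b n i \<noteq> 0" "w n i \<noteq> 0"
      using b[OF that, of n] w[OF that, of n] by (metis norm_zero zero_neq_one)+
    then show "lam n i > 0" "nu n i > 0" using g_inj by (simp_all add: lam_def nu_def)
  qed
  have gb: "g n *v b n i = lam n i *\<^sub>R c n i" "g n *v w n i = nu n i *\<^sub>R v n i"
    if "i \<in> {1..?d}" for n i using lam[OF that, of n] by (simp_all add: c_def v_def)
  have c1: "norm (c n i) = 1" "norm (v n i) = 1" if "i \<in> {1..?d}" for n i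
    using lam[OF that, of n] by (simp_all add: c_def v_def lam_def nu_def)
  have sub_act: "subspace (flag_act (g n) G j)" if "G \<in> flags" for n G j
    using flagsD(1)[OF flag_act_flags[OF cartan_invertible[OF cartan[of n]] that]] .
  have cF: "c n i \<in> flag_act (g n) (T 1) i" "c n i \<in> Fp (?d - i + 1)" if i: "i \<in> {1..?d}" for n i
  proof -
    have "g n *v b n i \<in> flag_act (g n) (T 1) i" "g n *v b n i \<in> flag_act (g n) (Fy n) (?d - i + 1)"
      using b[OF i, of n] by (auto simp: flag_act_def)
    then show "c n i \<in> flag_act (g n) (T 1) i" "c n i \<in> Fp (?d - i + 1)"
      unfolding c_def act[of n, symmetric] using sub_act fl by (auto intro: subspace_scale)
  qed
  have vF: "v n i \<in> flag_act (g n) (T 2) i" "v n i \<in> Fp (?d - i + 1)" if i: "i \<in> {1..?d}" for n i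
  proof -
    have "g n *v w n i \<in> flag_act (g n) (T 2) i" "g n *v w n i \<in> flag_act (g n) (Fy n) (?d - i + 1)"
      using w[OF i, of n] by (auto simp: flag_act_def)
    then show "v n i \<in> flag_act (g n) (T 2) i" "v n i \<in> Fp (?d - i + 1)"
      unfolding v_def act[of n, symmetric] using sub_act fl by (auto intro: subspace_scale)
  qed
  have orth: "orthogonal_matrix (l n)" "orthogonal_matrix (m n)" for n
    using cartan[of n] by (auto simp: cartan_def)
  \<comment> \<open>All columns are unit vectors, so one subsequence makes every matrix below converge. The limits
    of the bases are again bases because the limit flags are transverse.\<close>
  let ?K = "cball 0 (real (?d * ?d)) :: (real^'d^'d) set"
  let ?Z = "\<lambda>n. (cols (b n), cols (c n), cols (w n), cols (v n), l n, m n)"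
  have lm: "l n \<in> ?K" "m n \<in> ?K" for n
    using norm_cols_le[of "\<lambda>i. l n *v std_basis i"] norm_cols_le[of "\<lambda>i. m n *v std_basis i"]
    by (auto simp: cols_of_matrix norm_orthogonal_matrix_mult[OF orth(1)]
        norm_orthogonal_matrix_mult[OF orth(2)] norm_std_basis)
  have "?Z n \<in> ?K \<times> ?K \<times> ?K \<times> ?K \<times> ?K \<times> ?K" for n
  proof -
    have "norm (cols (b n)) \<le> real (?d * ?d)" "norm (cols (c n)) \<le> real (?d * ?d)"
      "norm (cols (w n)) \<le> real (?d * ?d)" "norm (cols (v n)) \<le> real (?d * ?d)"
      by (rule norm_cols_le; use b[of _ n] w[of _ n] c1[of _ n] in force)+
    then show ?thesis using lm[of n] by (simp del: of_nat_mult)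
  qed
  then have "\<forall>n. ?Z n \<in> ?K \<times> ?K \<times> ?K \<times> ?K \<times> ?K \<times> ?K" by (rule allI)
  moreover have "compact (?K \<times> ?K \<times> ?K \<times> ?K \<times> ?K \<times> ?K)" by (intro compact_Times compact_cball)
  ultimately have "\<exists>z\<in>?K \<times> ?K \<times> ?K \<times> ?K \<times> ?K \<times> ?K. \<exists>r. strict_mono r \<and> (?Z \<circ> r) \<longlonglongrightarrow> z"
    unfolding compact_def by (elim allE[of _ ?Z] impE)
  then obtain z r where r: "strict_mono r" and z: "(?Z \<circ> r) \<longlonglongrightarrow> z"
    by (elim bexE exE conjE)
  obtain B0 C0 W0 V0 l0 m0 where z_eq: "z = (B0, C0, W0, V0, l0, m0)" by (cases z) auto
  have lims: "(\<lambda>n. cols (b (r n))) \<longlonglongrightarrow> B0" "(\<lambda>n. cols (c (r n))) \<longlonglongrightarrow> C0"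
    "(\<lambda>n. cols (w (r n))) \<longlonglongrightarrow> W0" "(\<lambda>n. cols (v (r n))) \<longlonglongrightarrow> V0"
    "(\<lambda>n. l (r n)) \<longlonglongrightarrow> l0" "(\<lambda>n. m (r n)) \<longlonglongrightarrow> m0"
    using tendsto_fst[OF z] tendsto_fst[OF tendsto_snd[OF z]]
      tendsto_fst[OF tendsto_snd[OF tendsto_snd[OF z]]]
      tendsto_fst[OF tendsto_snd[OF tendsto_snd[OF tendsto_snd[OF z]]]]
      tendsto_fst[OF tendsto_snd[OF tendsto_snd[OF tendsto_snd[OF tendsto_snd[OF z]]]]]
      tendsto_snd[OF tendsto_snd[OF tendsto_snd[OF tendsto_snd[OF tendsto_snd[OF z]]]]]
    unfolding z_eq by (simp_all add: comp_def)
  define b0 where "b0 i = B0 *v std_basis i" for i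
  define c0 where "c0 i = C0 *v std_basis i" for i
  define w0 where "w0 i = W0 *v std_basis i" for i
  define v0 where "v0 i = V0 *v std_basis i" for i
  have BC: "B0 = cols b0" "C0 = cols c0"
    by (simp_all add: b0_def[abs_def] c0_def[abs_def] cols_of_matrix)
  have collim: "(\<lambda>n. a (r n) i) \<longlonglongrightarrow> A *v std_basis i"
    if "(\<lambda>n. cols (a (r n))) \<longlonglongrightarrow> A" "i \<in> {1..?d}" for a :: "nat \<Rightarrow> nat \<Rightarrow> real^'d" and A i
    using tendsto_matrix_vector_mult[OF that(1) tendsto_const, of "std_basis i"] that(2)
    by (simp add: cols_std_basis)
  note lim_b = collim[OF lims(1), folded b0_def] and lim_c = collim[OF lims(2), folded c0_def]
    and lim_w = collim[OF lims(3), folded w0_def] and lim_v = collim[OF lims(4), folded v0_def]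
  have norm1: "norm y = 1" if "f \<longlonglongrightarrow> y" "\<And>n. norm (f n) = 1" for f and y :: "real^'d"
    using tendsto_norm[OF that(1)] that(2) by (simp add: LIMSEQ_const_iff)
  have closed_mem: "y \<in> G k" if "f \<longlonglongrightarrow> y" "\<And>n. f n \<in> G k" "G \<in> flags" for f y G k
    using closed_subspace[OF flagsD(1)[OF that(3)]] that(1,2) by (meson closed_sequentially)
  note sub = limitin_subsequence[OF r]
  have b0: "b0 i \<noteq> 0 \<and> b0 i \<in> T 1 i \<and> b0 i \<in> T 3 (?d - i + 1)" if i: "i \<in> {1..?d}" for i
    using norm1[OF lim_b[OF i]] closed_mem[OF lim_b[OF i], of "T 1"]
      flag_limit_mem[OF sub[OF limy], of "\<lambda>n. b (r n) i", OF _ lim_b[OF i]] b[OF i] fl by fastforce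
  have c0: "c0 i \<noteq> 0 \<and> c0 i \<in> Fx i \<and> c0 i \<in> Fp (?d - i + 1)" if i: "i \<in> {1..?d}" for i
    using norm1[OF lim_c[OF i]] closed_mem[OF lim_c[OF i], of Fp]
      flag_limit_mem[OF sub[OF lim1], of "\<lambda>n. c (r n) i", OF _ lim_c[OF i]] cF[OF i] c1[OF i] fl by fastforce
  have w0: "w0 i \<noteq> 0 \<and> w0 i \<in> T 2 i \<and> w0 i \<in> T 3 (?d - i + 1)" if i: "i \<in> {1..?d}" for i
    using norm1[OF lim_w[OF i]] closed_mem[OF lim_w[OF i], of "T 2"]
      flag_limit_mem[OF sub[OF limy], of "\<lambda>n. w (r n) i", OF _ lim_w[OF i]] w[OF i] fl by fastforce
  have v0: "v0 i \<noteq> 0 \<and> v0 i \<in> Fx i \<and> v0 i \<in> Fp (?d - i + 1)" if i: "i \<in> {1..?d}" for i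
    using norm1[OF lim_v[OF i]] closed_mem[OF lim_v[OF i], of Fp]
      flag_limit_mem[OF sub[OF lim2], of "\<lambda>n. v (r n) i", OF _ lim_v[OF i]] vF[OF i] c1[OF i] fl by fastforce
  note TB = transverse_basis[OF fl(1,3) tr13 b0, folded BC]
  note TC = transverse_basis[OF fl(4,5) tr c0, folded BC]
  define x0 where "x0 k = matrix_inv B0 *v w0 k" for k
  define y0 where "y0 k = matrix_inv C0 *v v0 k" for k
  have Bx0: "B0 *v x0 k = w0 k" and Cy0: "C0 *v y0 k = v0 k" for k
    using invertible_cancel(1)[OF TB(1)] invertible_cancel(1)[OF TC(1)]
    by (simp_all add: x0_def y0_def matrix_vector_mul_assoc)
  define x where "x n k = matrix_inv (cols (b (r n))) *v w (r n) k" for n k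
  define y where "y n k = matrix_inv (cols (c (r n))) *v v (r n) k" for n k
  have evB: "eventually (\<lambda>n. invertible (cols (b (r n)))) sequentially"
    and evC: "eventually (\<lambda>n. invertible (cols (c (r n)))) sequentially"
    using topological_tendstoD[OF lims(1) open_invertible] topological_tendstoD[OF lims(2) open_invertible] TB(1) TC(1)
    by auto
  have solve: "eventually (\<lambda>n. cols (b (r n)) *v x n k = w (r n) k \<and> cols (c (r n)) *v y n k = v (r n) k) sequentially" for k
    using evB evC by eventually_elim (simp add: x_def y_def matrix_vector_mul_assoc invertible_cancel)
  have limx: "(\<lambda>n. x n k) \<longlonglongrightarrow> x0 k" if k: "k \<in> {1..?d}" for k
  proof (rule tendsto_solve[OF lims(1) TB(1)], unfold Bx0)
    show "(\<lambda>n. cols (b (r n)) *v x n k) \<longlonglongrightarrow> w0 k"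
      by (rule Lim_transform_eventually[OF lim_w[OF k]]) (use solve[of k] in eventually_elim, simp)
  qed
  have limy: "(\<lambda>n. y n k) \<longlonglongrightarrow> y0 k" if k: "k \<in> {1..?d}" for k
  proof (rule tendsto_solve[OF lims(2) TC(1)], unfold Cy0)
    show "(\<lambda>n. cols (c (r n)) *v y n k) \<longlonglongrightarrow> v0 k"
      by (rule Lim_transform_eventually[OF lim_v[OF k]]) (use solve[of k] in eventually_elim, simp)
  qed
  \<comment> \<open>Both sides are coordinates of \<open>g w\<close> in the basis \<open>c\<close>, up to normalization.\<close>
  have rel: "eventually (\<lambda>n. \<forall>i\<in>{1..?d}. lam (r n) i * x n k $ coord i = nu (r n) k * y n k $ coord i) sequentially"
    if k: "k \<in> {1..?d}" for k
    using solve[of k] evC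
  proof eventually_elim
    case (elim n)
    let ?x = "\<chi> j. lam (r n) (idx j) * x n k $ j"
    have "g (r n) *v w (r n) k = (\<Sum>i\<in>{1..?d}. x n k $ coord i *\<^sub>R (g (r n) *v b (r n) i))"
      unfolding elim(1)[THEN conjunct1, symmetric] cols_mult
      by (simp add: linear_sum[OF matrix_vector_mul_linear] linear_scale[OF matrix_vector_mul_linear])
    also have "\<dots> = cols (c (r n)) *v ?x"
      unfolding cols_mult by (intro sum.cong refl) (simp add: gb idx_coord mult.commute)
    finally have "cols (c (r n)) *v ?x = nu (r n) k *\<^sub>R (cols (c (r n)) *v y n k)"
      using gb(2)[OF k] elim by simp
    then have "cols (c (r n)) *v (?x - nu (r n) k *\<^sub>R y n k) = 0"
      by (simp add: matrix_vector_mult_diff_distrib linear_scale[OF matrix_vector_mul_linear])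
    then have "?x = nu (r n) k *\<^sub>R y n k" using elim(2) unfolding invertible_iff_inj by auto
    then have xy: "?x $ coord i = (nu (r n) k *\<^sub>R y n k) $ coord i" for i by simp
    show ?case
    proof (rule ballI)
      fix i assume i: "i \<in> {1..?d}"
      show "lam (r n) i * x n k $ coord i = nu (r n) k * y n k $ coord i"
        using xy[of i] idx_coord[OF i] by simp
    qed
  qed
  have x0nz: "x0 k $ coord e \<noteq> 0" if k: "k \<in> {1..?d}" and e: "e \<in> {k..?d}" for k e
  proof (rule positive_triple_coordinates[OF fl(1,3) pos b0 k e, where y = "x0 k", folded BC, unfolded Bx0])
    show "w0 k \<in> T 2 k" "w0 k \<in> T 3 (?d - k + 1)" using w0[OF k] by auto
    show "x0 k \<noteq> 0" using w0[OF k] Bx0[of k] by auto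
  qed
  \<comment> \<open>The limit of \<open>g w\<close> lies in \<open>Fx k \<inter> Fp (d - k + 1)\<close>, the line spanned by \<open>c0 k\<close>.\<close>
  have y0z: "y0 k $ coord i = 0" if "k \<in> {1..?d}" "i \<in> {1..?d}" "i \<noteq> k" for k i
    using TC(3)[of "y0 k" k] TC(4)[of "y0 k" "?d - k + 1"] v0[OF that(1)] that unfolding Cy0
    by (cases "k < i") auto
  have y0nz: "y0 k $ coord k \<noteq> 0" if k: "k \<in> {1..?d}" for k
  proof
    assume "y0 k $ coord k = 0"
    then have "y0 k $ j = 0" for j using y0z[OF k idx_range[of j]] by (cases "idx j = k") auto
    then have "y0 k = 0" by (simp add: vec_eq_iff)
    then show False using Cy0[of k] v0[OF k] by simp
  qed
  have ratio: "(\<lambda>n. lam (r n) (Suc k) / lam (r n) k) \<longlonglongrightarrow> 0" if k: "k \<in> {1..<?d}" for k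
  proof -
    have kk: "k \<in> {1..?d}" "Suc k \<in> {1..?d}" "k \<in> {k..?d}" "Suc k \<in> {k..?d}" using k by auto
    have "(\<lambda>n. (y n k $ coord (Suc k) / x n k $ coord (Suc k)) / (y n k $ coord k / x n k $ coord k))
        \<longlonglongrightarrow> (y0 k $ coord (Suc k) / x0 k $ coord (Suc k)) / (y0 k $ coord k / x0 k $ coord k)"
      using kk x0nz y0nz by (intro tendsto_divide tendsto_vec_nth limx limy) auto
    moreover have "y0 k $ coord (Suc k) = 0" using kk by (intro y0z) auto
    moreover have "eventually (\<lambda>n. (y n k $ coord (Suc k) / x n k $ coord (Suc k)) / (y n k $ coord k / x n k $ coord k)
        = lam (r n) (Suc k) / lam (r n) k) sequentially"
      using rel[OF kk(1)] tendsto_imp_eventually_ne[OF tendsto_vec_nth[OF limx[OF kk(1)]] x0nz[OF kk(1,3)]]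
        tendsto_imp_eventually_ne[OF tendsto_vec_nth[OF limx[OF kk(1)]] x0nz[OF kk(1,4)]]
    proof eventually_elim
      case (elim n)
      have "y n k $ coord i = lam (r n) i * x n k $ coord i / nu (r n) k" if "i \<in> {1..?d}" for i
        using elim(1) that lam(2)[OF kk(1), of "r n"] by (simp add: field_simps)
      then show ?case using kk elim(2,3) lam(2)[OF kk(1), of "r n"] by simp
    qed
    ultimately show ?thesis by (simp add: tendsto_cong)
  qed
  have lm0: "transpose l0 ** l0 = mat 1" "transpose m0 ** m0 = mat 1"
    using tendsto_matrix_mult[OF tendsto_transpose[OF lims(5)] lims(5)]
      tendsto_matrix_mult[OF tendsto_transpose[OF lims(6)] lims(6)] orth
    by (simp_all add: orthogonal_matrix LIMSEQ_const_iff)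
  then have o0: "orthogonal_matrix l0" "orthogonal_matrix m0" by (simp_all add: orthogonal_matrix)
  have upper: "(transpose l0 ** C0) $ coord i $ coord j = 0"
    if ij: "i \<in> {1..?d}" "j \<in> {1..?d}" "j < i" for i j
  proof (rule cartan_ratio_upper_triangular[where s = "\<lambda>n. s (r n)" and lam = "\<lambda>n. lam (r n)",
        OF _ _ _ _ _ _ ratio _ ij])
    show "(\<lambda>n. m (r n) ** cols (b (r n))) \<longlonglongrightarrow> m0 ** B0"
      "(\<lambda>n. transpose (l (r n)) ** cols (c (r n))) \<longlonglongrightarrow> transpose l0 ** C0"
      by (intro tendsto_matrix_mult tendsto_transpose lims)+
    have "invertible B0" using TB(1) by blast
    then show "invertible (m0 ** B0)" by (rule invertible_mult[OF orthogonal_invertible[OF o0(2)]])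
    show "k \<in> {1..?d} \<Longrightarrow> s (r n) k > 0" "k \<in> {1..<?d} \<Longrightarrow> s (r n) (Suc k) \<le> s (r n) k" for n k
      using cartan[of "r n"] by (auto simp: cartan_def)
    show "k \<in> {1..?d} \<Longrightarrow> lam (r n) k > 0" for n k by (rule lam)
    fix n i j assume ij: "i \<in> {1..?d}" "j \<in> {1..?d}"
    obtain a where a: "\<forall>k\<in>{1..?d}. a *v std_basis k = s (r n) k *\<^sub>R std_basis k"
      and g: "g (r n) = l (r n) ** a ** m (r n)"
      using cartan[of "r n"] unfolding cartan_def by blast
    have col: "(A ** cols f) $ coord i $ coord j = (A *v f j) $ coord i" for A :: "real^'d^'d" and f
      unfolding matrix_mult_cols using idx_coord[OF ij(2)] by (simp add: cols_def)
    have "s (r n) i * (m (r n) ** cols (b (r n))) $ coord i $ coord j = (a *v (m (r n) *v b (r n) j)) $ coord i"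
      using ij by (simp add: col diagonal_nth[OF a] idx_coord)
    also have "a *v (m (r n) *v b (r n) j) = transpose (l (r n)) *v (g (r n) *v b (r n) j)"
      using orth(1)[of "r n"] unfolding g
      by (simp add: matrix_vector_mul_assoc matrix_mul_assoc orthogonal_matrix)
    also have "\<dots> = lam (r n) j *\<^sub>R (transpose (l (r n)) *v c (r n) j)"
      using gb(1)[OF ij(2)] by (simp add: linear_scale[OF matrix_vector_mul_linear])
    finally show "s (r n) i * (m (r n) ** cols (b (r n))) $ coord i $ coord j =
      (transpose (l (r n)) ** cols (c (r n))) $ coord i $ coord j * lam (r n) j"
      by (simp add: col)
  qed
  have l0fl: "flag_act l0 std_flag \<in> flags"
    using o0 by (intro flag_act_flags orthogonal_invertible std_flag_flags)
  have actC: "flag_act C0 std_flag = Fx" using TC(2) by blast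
  \<comment> \<open>An upper triangular matrix preserves the standard flag, so \<open>C0\<close> and \<open>l0\<close> map it to the same flag.\<close>
  have "Fx = flag_act l0 std_flag"
  proof (rule flags_eqI[OF fl(4) l0fl], rule subsetI)
    fix k u assume "u \<in> Fx k"
    then obtain t where t: "t \<in> std_flag k" "u = C0 *v t" unfolding actC[symmetric] by (auto simp: flag_act_def)
    have "(transpose l0 ** C0) *v t \<in> std_flag k"
      unfolding std_flag_iff
    proof (intro ballI impI)
      fix i assume i: "i \<in> {1..?d}" "k < i"
      show "((transpose l0 ** C0) *v t) $ coord i = 0"
        unfolding matrix_vector_mult_def vec_lambda_beta sum_coord
      proof (rule sum.neutral, rule ballI)
        fix j assume j: "j \<in> {1..?d}"
        show "(transpose l0 ** C0) $ coord i $ coord j * t $ coord j = 0"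
          using upper[OF i(1) j] t(1) i j by (cases "j < i") (auto simp: std_flag_iff)
      qed
    qed
    moreover have "l0 *v ((transpose l0 ** C0) *v t) = u"
      using o0(1) t by (simp add: matrix_vector_mul_assoc matrix_mul_assoc orthogonal_matrix_def)
    ultimately show "u \<in> flag_act l0 std_flag k" unfolding flag_act_def by (metis imageI)
  qed
  also have "flag_act l0 std_flag = F"
  proof (rule flags_eqI[OF l0fl Ff], rule subsetI)
    fix k u assume "u \<in> flag_act l0 std_flag k"
    then obtain t where t: "t \<in> std_flag k" "u = l0 *v t" by (auto simp: flag_act_def)
    have lu: "(\<lambda>n. l (r n) *v t) \<longlonglongrightarrow> u" unfolding t(2) by (intro tendsto_matrix_vector_mult lims tendsto_const)
    have "l (r n) *v t \<in> ((\<lambda>n. flag_act (l n) std_flag) \<circ> r) n k" for n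
      using t(1) by (simp add: flag_act_def)
    then show "u \<in> F k" by (rule flag_limit_mem[OF sub[OF limF] _ lu])
  qed
  finally show ?thesis by simp
qed

section \<open>Preimages in SL(d,R) of subgroups of PSL(d,R)\<close>

lemma group_SL: "group (SL :: (real^'d^'d) monoid)"
proof (rule groupI)
  fix A :: "real^'d^'d" assume "A \<in> carrier SL"
  then have d: "det A = 1" by (simp add: SL_def)
  then have i: "invertible A" by (simp add: invertible_det_nz)
  have "det A * det (matrix_inv A) = 1"
    using invertible_cancel(1)[OF i] by (metis det_I det_mul)
  then show "\<exists>B\<in>carrier SL. B \<otimes>\<^bsub>SL\<^esub> A = \<one>\<^bsub>SL\<^esub>"
    using invertible_cancel(2)[OF i] d by (intro bexI[of _ "matrix_inv A"]) (auto simp: SL_def)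
qed (auto simp: SL_def det_mul det_I matrix_mul_assoc)

lemma matrix_neg_mult:
  fixes A B :: "real^'d^'d"
  shows "(- A) ** B = - (A ** B)" "A ** (- B) = - (A ** B)"
  by (simp_all add: matrix_matrix_mult_def vec_eq_iff sum_negf)

lemma SL_centre_commute: "h \<in> SL_centre \<Longrightarrow> h ** A = A ** (h :: real^'d^'d)"
  by (auto simp: SL_centre_def matrix_neg_mult)

lemma SL_centre_mult: "h \<in> SL_centre \<Longrightarrow> k \<in> SL_centre \<Longrightarrow> h ** (k :: real^'d^'d) \<in> SL_centre"
  by (auto simp: SL_centre_def matrix_neg_mult det_mul)

lemma SL_centre_square: "h \<in> SL_centre \<Longrightarrow> h ** (h :: real^'d^'d) = mat 1"
  by (auto simp: SL_centre_def matrix_neg_mult)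

lemma one_SL_centre: "(mat 1 :: real^'d^'d) \<in> SL_centre"
  by (simp add: SL_centre_def det_I)

lemma subgroup_SL_centre: "subgroup SL_centre (SL :: (real^'d^'d) monoid)"
proof -
  interpret group "SL :: (real^'d^'d) monoid" by (rule group_SL)
  show ?thesis
  proof (rule subgroupI)
    show "SL_centre \<subseteq> carrier (SL :: (real^'d^'d) monoid)" by (auto simp: SL_centre_def SL_def)
    show "SL_centre \<noteq> ({} :: (real^'d^'d) set)" using one_SL_centre by blast
  next
    fix h :: "real^'d^'d" assume h: "h \<in> SL_centre"
    have "inv\<^bsub>SL\<^esub> h = h"
      by (rule inv_equality) (use h in \<open>auto simp: SL_def SL_centre_square SL_centre_def matrix_neg_mult\<close>)
    then show "inv\<^bsub>SL\<^esub> h \<in> SL_centre" using h by simp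
  next
    fix h k :: "real^'d^'d" assume "h \<in> SL_centre" "k \<in> SL_centre"
    then show "h \<otimes>\<^bsub>SL\<^esub> k \<in> SL_centre" by (simp add: SL_def SL_centre_mult)
  qed
qed

lemma normal_SL_centre: "SL_centre \<lhd> (SL :: (real^'d^'d) monoid)"
proof -
  interpret group "SL :: (real^'d^'d) monoid" by (rule group_SL)
  have "x \<otimes>\<^bsub>SL\<^esub> h \<otimes>\<^bsub>SL\<^esub> inv\<^bsub>SL\<^esub> x \<in> SL_centre"
    if x: "x \<in> carrier SL" and h: "h \<in> SL_centre" for x h :: "real^'d^'d"
  proof -
    have hc: "h \<in> carrier SL" using h by (simp add: SL_centre_def SL_def)
    have "x \<otimes>\<^bsub>SL\<^esub> h = h \<otimes>\<^bsub>SL\<^esub> x" using SL_centre_commute[OF h, of x] by (simp add: SL_def)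
    then have "x \<otimes>\<^bsub>SL\<^esub> h \<otimes>\<^bsub>SL\<^esub> inv\<^bsub>SL\<^esub> x = h \<otimes>\<^bsub>SL\<^esub> (x \<otimes>\<^bsub>SL\<^esub> inv\<^bsub>SL\<^esub> x)"
      using x hc by (simp add: m_assoc del: r_inv)
    then show ?thesis using x h hc by simp
  qed
  then show ?thesis using subgroup_SL_centre by (auto simp: normal_inv_iff)
qed

lemma group_PSL: "group (PSL :: (real^'d^'d) set monoid)"
  unfolding PSL_def by (rule normal.factorgroup_is_group[OF normal_SL_centre])

lemma PSL_carrier:
  assumes "\<alpha> \<in> carrier PSL"
  obtains A :: "real^'d^'d" where "det A = 1" "\<alpha> = (\<lambda>h. h ** A) ` SL_centre"
  using assms unfolding PSL_def carrier_FactGroup r_coset_def SL_def by auto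

lemma PSL_det: "\<alpha> \<in> carrier PSL \<Longrightarrow> A \<in> \<alpha> \<Longrightarrow> det (A :: real^'d^'d) = 1"
  by (erule PSL_carrier) (auto simp: det_mul SL_centre_def)

text \<open>Any lift of an element represents its coset, so two elements with a common lift are equal.\<close>

lemma PSL_coset:
  assumes \<alpha>: "\<alpha> \<in> carrier PSL" and A: "(A :: real^'d^'d) \<in> \<alpha>"
  shows "\<alpha> = (\<lambda>h. h ** A) ` SL_centre"
proof -
  obtain A0 where A0: "\<alpha> = (\<lambda>h. h ** A0) ` SL_centre" using \<alpha> by (rule PSL_carrier)
  then obtain k where k: "k \<in> SL_centre" "A = k ** A0" using A by auto
  show ?thesis
  proof (intro equalityI subsetI)
    fix B assume "B \<in> \<alpha>"
    then obtain h where h: "h \<in> SL_centre" "B = h ** A0" using A0 by auto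
    have "B = (h ** k) ** A" using SL_centre_square[OF k(1)]
      by (metis h(2) k(2) matrix_mul_assoc matrix_mul_lid)
    then show "B \<in> (\<lambda>h. h ** A) ` SL_centre" using SL_centre_mult[OF h(1) k(1)] by auto
  next
    fix B assume "B \<in> (\<lambda>h. h ** A) ` SL_centre"
    then obtain h where h: "h \<in> SL_centre" "B = h ** A" by auto
    then have "B = (h ** k) ** A0" by (simp add: k(2) matrix_mul_assoc)
    then show "B \<in> \<alpha>" using SL_centre_mult[OF h(1) k(1)] A0 by auto
  qed
qed

lemma PSL_mult: "\<alpha> \<otimes>\<^bsub>PSL\<^esub> \<beta> = {A ** B | A B. A \<in> \<alpha> \<and> B \<in> (\<beta> :: (real^'d^'d) set)}"
  by (auto simp: PSL_def FactGroup_def SL_def set_mult_def)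

lemma PSL_one: "\<one>\<^bsub>PSL\<^esub> = (SL_centre :: (real^'d^'d) set)"
  by (simp add: PSL_def FactGroup_def)

lemma PSL_nonempty: "\<alpha> \<in> carrier PSL \<Longrightarrow> \<exists>A :: real^'d^'d. A \<in> \<alpha>"
proof (erule PSL_carrier)
  fix A assume a: "\<alpha> = (\<lambda>h. h ** A) ` (SL_centre :: (real^'d^'d) set)"
  show ?thesis using a one_SL_centre by blast
qed

lemma lifts_subgroup:
  fixes \<Gamma> :: "(real^'d^'d) set set"
  assumes \<Gamma>: "subgroup \<Gamma> PSL"
  shows "A \<in> \<Union>\<Gamma> \<Longrightarrow> det A = 1"
    and "A \<in> \<Union>\<Gamma> \<Longrightarrow> B \<in> \<Union>\<Gamma> \<Longrightarrow> A ** B \<in> \<Union>\<Gamma>"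
    and "A \<in> \<Union>\<Gamma> \<Longrightarrow> matrix_inv A \<in> \<Union>\<Gamma>"
    and "mat 1 \<in> \<Union>\<Gamma>"
    and "\<alpha> \<in> \<Gamma> \<Longrightarrow> \<beta> \<in> \<Gamma> \<Longrightarrow> A \<in> \<alpha> \<Longrightarrow> A \<in> \<beta> \<Longrightarrow> \<alpha> = \<beta>"
proof -
  interpret group "PSL :: (real^'d^'d) set monoid" by (rule group_PSL)
  have car: "\<alpha> \<in> carrier PSL" if "\<alpha> \<in> \<Gamma>" for \<alpha> using subgroup.mem_carrier[OF \<Gamma> that] .
  show "A \<in> \<Union>\<Gamma> \<Longrightarrow> det A = 1" using PSL_det car by blast
  show "A \<in> \<Union>\<Gamma> \<Longrightarrow> B \<in> \<Union>\<Gamma> \<Longrightarrow> A ** B \<in> \<Union>\<Gamma>"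
  proof -
    assume "A \<in> \<Union>\<Gamma>" "B \<in> \<Union>\<Gamma>"
    then obtain \<alpha> \<beta> where "\<alpha> \<in> \<Gamma>" "\<beta> \<in> \<Gamma>" "A \<in> \<alpha>" "B \<in> \<beta>" by auto
    then have "\<alpha> \<otimes>\<^bsub>PSL\<^esub> \<beta> \<in> \<Gamma>" "A ** B \<in> \<alpha> \<otimes>\<^bsub>PSL\<^esub> \<beta>"
      using subgroup.m_closed[OF \<Gamma>] unfolding PSL_mult by auto
    then show "A ** B \<in> \<Union>\<Gamma>" by blast
  qed
  show "mat 1 \<in> \<Union>\<Gamma>"
    using subgroup.one_closed[OF \<Gamma>] one_SL_centre unfolding PSL_one by blast
  show "A \<in> \<Union>\<Gamma> \<Longrightarrow> matrix_inv A \<in> \<Union>\<Gamma>"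
  proof -
    assume "A \<in> \<Union>\<Gamma>"
    then obtain \<alpha> where \<alpha>: "\<alpha> \<in> \<Gamma>" "A \<in> \<alpha>" by auto
    let ?\<beta> = "inv\<^bsub>PSL\<^esub> \<alpha>"
    have \<beta>: "?\<beta> \<in> \<Gamma>" using subgroup.m_inv_closed[OF \<Gamma> \<alpha>(1)] .
    obtain B where B: "B \<in> ?\<beta>" using PSL_nonempty[OF car[OF \<beta>]] by auto
    have "A ** B \<in> \<alpha> \<otimes>\<^bsub>PSL\<^esub> ?\<beta>" using \<alpha> B unfolding PSL_mult by auto
    then have h: "A ** B \<in> SL_centre" using car[OF \<alpha>(1)] by (simp add: PSL_one[symmetric])
    have "(A ** B) ** B \<in> ?\<beta>" using PSL_coset[OF car[OF \<beta>] B] h by auto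
    moreover have "A ** ((A ** B) ** B) = mat 1"
      by (metis SL_centre_commute SL_centre_square h matrix_mul_assoc)
    moreover have "invertible A" using PSL_det[OF car[OF \<alpha>(1)] \<alpha>(2)] by (simp add: invertible_det_nz)
    ultimately have "matrix_inv A \<in> ?\<beta>"
      by (metis invertible_cancel(2) matrix_mul_assoc matrix_mul_lid matrix_mul_rid)
    then show "matrix_inv A \<in> \<Union>\<Gamma>" using \<beta> by blast
  qed
  show "\<alpha> \<in> \<Gamma> \<Longrightarrow> \<beta> \<in> \<Gamma> \<Longrightarrow> A \<in> \<alpha> \<Longrightarrow> A \<in> \<beta> \<Longrightarrow> \<alpha> = \<beta>"
    using PSL_coset car by metis
qed

text \<open>Infinitely many elements in a ball would contain a convergent sequence; the quotients of consecutive
  terms tend to the identity, which is isolated, so the sequence would have repetitions.\<close>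

lemma discrete_subgroup_finite_bounded:
  fixes G :: "(real^'d^'d) set"
  assumes det: "\<And>A. A \<in> G \<Longrightarrow> det A = 1"
    and mult: "\<And>A B. A \<in> G \<Longrightarrow> B \<in> G \<Longrightarrow> A ** B \<in> G"
    and inv: "\<And>A. A \<in> G \<Longrightarrow> matrix_inv A \<in> G" and one: "mat 1 \<in> G"
    and disc: "discrete G"
  shows "finite {A \<in> G. norm A \<le> R}"
proof (rule ccontr)
  assume "infinite {A \<in> G. norm A \<le> R}"
  then obtain A :: "nat \<Rightarrow> real^'d^'d" where A: "inj A" "range A \<subseteq> {A \<in> G. norm A \<le> R}"
    using infinite_countable_subset by blast
  then have "\<forall>n. A n \<in> cball 0 R" by auto
  moreover have "compact (cball (0 :: real^'d^'d) R)" by (rule compact_cball)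
  ultimately have "\<exists>L\<in>cball 0 R. \<exists>r. strict_mono r \<and> (A \<circ> r) \<longlonglongrightarrow> L"
    unfolding compact_def by (elim allE[of _ A] impE)
  then obtain L r where r: "strict_mono r" and L: "(A \<circ> r) \<longlonglongrightarrow> L"
    by (elim bexE exE conjE)
  have AG: "A n \<in> G" for n using A by auto
  then have inv_A: "invertible (A n)" for n using det by (simp add: invertible_det_nz)
  have "(\<lambda>n. det ((A \<circ> r) n)) \<longlonglongrightarrow> det L" by (rule tendsto_det[OF L])
  then have "det L = 1" using det AG by (simp add: LIMSEQ_const_iff)
  then have invL: "invertible L" by (simp add: invertible_det_nz)
  define C where "C n = matrix_inv (A (r n)) ** A (r (Suc n))" for n
  have CG: "C n \<in> G" for n unfolding C_def by (intro mult inv AG)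
  have AC: "A (r n) ** C n = A (r (Suc n))" for n
    using invertible_cancel(1)[OF inv_A] by (simp add: C_def matrix_mul_assoc)
  have Cv: "(\<lambda>n. C n *v v) \<longlonglongrightarrow> v" for v
  proof (rule tendsto_solve[OF L invL])
    have "(\<lambda>n. (A \<circ> r) (Suc n) *v v) \<longlonglongrightarrow> L *v v"
      by (rule tendsto_matrix_vector_mult[OF LIMSEQ_Suc[OF L] tendsto_const])
    then show "(\<lambda>n. (A \<circ> r) n *v (C n *v v)) \<longlonglongrightarrow> L *v v"
      by (simp add: matrix_vector_mul_assoc AC)
  qed
  have "C \<longlonglongrightarrow> mat 1"
  proof (intro vec_tendstoI)
    fix i j
    have "(\<lambda>n. (C n *v axis j 1) $ i) \<longlonglongrightarrow> axis j 1 $ i" by (rule tendsto_vec_nth[OF Cv])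
    moreover have "axis j 1 $ i = (mat 1 :: real^'d^'d) $ i $ j" by (simp add: axis_def mat_def)
    ultimately show "(\<lambda>n. C n $ i $ j) \<longlonglongrightarrow> (mat 1 :: real^'d^'d) $ i $ j"
      by (simp add: matrix_vector_mult_basis column_def)
  qed
  moreover obtain e where e: "e > 0" "\<And>B. B \<in> G \<Longrightarrow> dist (mat 1) B < e \<Longrightarrow> B = mat 1"
    using discreteD[OF disc one] unfolding isolated_in_dist_Ex_iff by auto
  ultimately have "eventually (\<lambda>n. dist (C n) (mat 1) < e) sequentially" by (intro tendstoD)
  then obtain n where "dist (C n) (mat 1) < e" unfolding eventually_sequentially by auto
  then have "C n = mat 1" using e(2)[OF CG] by (simp add: dist_commute)
  then have "A (r n) = A (r (Suc n))" using AC[of n] by simp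
  then have "r n = r (Suc n)" using A(1) by (simp add: inj_eq)
  then show False using r by (metis n_not_Suc_n strict_mono_eq)
qed

section \<open>The action on the disk\<close>

text \<open>The Cayley transform conjugates \<open>A\<close> to the matrix of SU(1,1) with first row \<open>(disk_a A, disk_b A)\<close> and
  second row the conjugates \<open>(cnj (disk_b A), cnj (disk_a A))\<close>.\<close>

definition disk_a :: "real^2^2 \<Rightarrow> complex" where
  "disk_a A = Complex ((A$1$1 + A$2$2) / 2) ((A$1$2 - A$2$1) / 2)"

definition disk_b :: "real^2^2 \<Rightarrow> complex" where
  "disk_b A = Complex ((A$1$1 - A$2$2) / 2) (- (A$1$2 + A$2$1) / 2)"

lemma disk_act_eq:
  "disk_act A w = (disk_a A * w + disk_b A) / (cnj (disk_b A) * w + cnj (disk_a A))"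
  by (simp add: disk_act_def disk_a_def disk_b_def Let_def)

lemma disk_ab_mult:
  "disk_a (A ** B) = disk_a A * disk_a B + disk_b A * cnj (disk_b B)"
  "disk_b (A ** B) = disk_a A * disk_b B + disk_b A * cnj (disk_a B)"
  by (simp_all add: disk_a_def disk_b_def complex_eq_iff matrix_matrix_mult_def sum_2
      add_divide_distrib diff_divide_distrib algebra_simps)

lemma cmod_disk_ab:
  "(cmod (disk_a A))\<^sup>2 = ((A$1$1 + A$2$2) / 2)\<^sup>2 + ((A$1$2 - A$2$1) / 2)\<^sup>2"
  "(cmod (disk_b A))\<^sup>2 = ((A$1$1 - A$2$2) / 2)\<^sup>2 + ((A$1$2 + A$2$1) / 2)\<^sup>2"
  unfolding disk_a_def disk_b_def cmod_power2 by (simp_all add: power_divide power2_commute power2_eq_square algebra_simps)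

lemma disk_ab_det: "(cmod (disk_a A))\<^sup>2 - (cmod (disk_b A))\<^sup>2 = det A"
  unfolding cmod_disk_ab det_2 by (simp add: power2_eq_square field_simps)

lemma disk_ab_norm: "(cmod (disk_a A))\<^sup>2 + (cmod (disk_b A))\<^sup>2 = (norm A)\<^sup>2 / 2"
proof -
  have "(norm A)\<^sup>2 = A$1$1 * A$1$1 + A$1$2 * A$1$2 + (A$2$1 * A$2$1 + A$2$2 * A$2$2)"
    unfolding power2_norm_eq_inner by (simp add: inner_vec_def sum_2)
  then show ?thesis
    unfolding cmod_disk_ab by (simp add: power2_eq_square field_simps)
qed

lemma disk_identity:
  assumes "(cmod a)\<^sup>2 - (cmod b)\<^sup>2 = 1"
  shows "(cmod (cnj b * w + cnj a))\<^sup>2 - (cmod (a * w + b))\<^sup>2 = 1 - (cmod w)\<^sup>2"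
proof -
  have "(cmod (cnj b * w + cnj a))\<^sup>2 - (cmod (a * w + b))\<^sup>2
     = ((cmod a)\<^sup>2 - (cmod b)\<^sup>2) * (1 - (cmod w)\<^sup>2)"
    unfolding cmod_power2 by (simp add: power2_eq_square algebra_simps)
  then show ?thesis using assms by simp
qed

lemma disk_denom_nz:
  assumes "det A = 1" "w \<in> cball 0 1"
  shows "cnj (disk_b A) * w + cnj (disk_a A) \<noteq> 0"
proof
  assume "cnj (disk_b A) * w + cnj (disk_a A) = 0"
  then have "cnj (disk_a A) = - (cnj (disk_b A) * w)" by (simp add: eq_neg_iff_add_eq_0 add.commute)
  then have "cmod (cnj (disk_a A)) = cmod (cnj (disk_b A) * w)" by simp
  then have "cmod (disk_a A) \<le> cmod (disk_b A)"
    using assms(2) mult_left_le[of "cmod w" "cmod (disk_b A)"] by (simp add: norm_mult)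
  then have "(cmod (disk_a A))\<^sup>2 \<le> (cmod (disk_b A))\<^sup>2" by (rule power_mono) simp
  moreover have "(cmod (disk_a A))\<^sup>2 - (cmod (disk_b A))\<^sup>2 = 1" using disk_ab_det[of A] assms(1) by simp
  ultimately show False by linarith
qed

lemma disk_act_norm:
  assumes "det A = 1" "w \<in> cball 0 1"
  shows "norm w = 1 \<Longrightarrow> norm (disk_act A w) = 1" "norm w < 1 \<Longrightarrow> norm (disk_act A w) < 1"
proof -
  let ?N = "cmod (disk_a A * w + disk_b A)" and ?D = "cmod (cnj (disk_b A) * w + cnj (disk_a A))"
  have D: "?D > 0" using disk_denom_nz[OF assms] by simp
  have id: "?D\<^sup>2 - ?N\<^sup>2 = 1 - (cmod w)\<^sup>2" using disk_identity disk_ab_det assms(1) by simp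
  have n: "norm (disk_act A w) = ?N / ?D" by (simp add: disk_act_eq norm_divide)
  show "norm w = 1 \<Longrightarrow> norm (disk_act A w) = 1"
  proof -
    assume "norm w = 1"
    then have "?D\<^sup>2 = ?N\<^sup>2" using id by simp
    then have "?D = ?N" by (simp add: power2_eq_iff_nonneg)
    then show ?thesis using n D by simp
  qed
  show "norm w < 1 \<Longrightarrow> norm (disk_act A w) < 1"
  proof -
    assume "norm w < 1"
    then have "(cmod w)\<^sup>2 < 1" by (simp add: power_less_one_iff)
    then have "?N\<^sup>2 < ?D\<^sup>2" using id by simp
    then have "?N < ?D" using D by (meson less_eq_real_def power_less_imp_less_base)
    then show ?thesis using n D by simp
  qed
qed

lemma disk_act_compose:
  assumes "det B = 1" "w \<in> cball 0 1"
  shows "disk_act A (disk_act B w) = disk_act (A ** B) w"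
proof -
  let ?D = "cnj (disk_b B) * w + cnj (disk_a B)" and ?N = "disk_a B * w + disk_b B"
  have D: "?D \<noteq> 0" by (rule disk_denom_nz[OF assms])
  have "disk_act A (disk_act B w) = (disk_a A * (?N / ?D) + disk_b A) / (cnj (disk_b A) * (?N / ?D) + cnj (disk_a A))"
    by (simp add: disk_act_eq)
  also have "\<dots> = ((disk_a A * (?N / ?D) + disk_b A) * ?D) / ((cnj (disk_b A) * (?N / ?D) + cnj (disk_a A)) * ?D)"
    using D by simp
  also have "(disk_a A * (?N / ?D) + disk_b A) * ?D = disk_a A * ?N + disk_b A * ?D"
    using D by (simp add: distrib_right[of _ _ ?D])
  also have "\<dots> = disk_a (A ** B) * w + disk_b (A ** B)"
    by (simp add: disk_ab_mult algebra_simps)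
  also have "(cnj (disk_b A) * (?N / ?D) + cnj (disk_a A)) * ?D = cnj (disk_b A) * ?N + cnj (disk_a A) * ?D"
    using D by (simp add: distrib_right[of _ _ ?D])
  also have "\<dots> = cnj (disk_b (A ** B)) * w + cnj (disk_a (A ** B))"
    by (simp add: disk_ab_mult algebra_simps)
  finally show ?thesis by (simp add: disk_act_eq)
qed

lemma disk_act_one: "disk_act (mat 1) w = w"
  by (simp add: disk_act_eq disk_a_def disk_b_def mat_def complex_eq_iff Complex_eq)

lemma matrix_inv_2:
  assumes "det (A :: real^2^2) = 1"
  shows "disk_a (matrix_inv A) = cnj (disk_a A)" "disk_b (matrix_inv A) = - disk_b A"
proof -
  define B :: "real^2^2" where "B = vector [vector [A$2$2, - (A$1$2)], vector [- (A$2$1), A$1$1]]"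
  have "A ** B = mat 1"
    using assms by (simp add: B_def vec_eq_iff matrix_matrix_mult_def sum_2 det_2 mat_def forall_2 algebra_simps)
  moreover have "invertible A" using assms by (simp add: invertible_det_nz)
  ultimately have "matrix_inv A = B"
    by (metis invertible_cancel(2) matrix_mul_assoc matrix_mul_lid matrix_mul_rid)
  then show "disk_a (matrix_inv A) = cnj (disk_a A)" "disk_b (matrix_inv A) = - disk_b A"
    by (simp_all add: B_def disk_a_def disk_b_def complex_eq_iff field_simps)
qed

text \<open>The convergence property of a divergent sequence. With \<open>a\<close>, \<open>b\<close> the entries of the matrix and
  \<open>Q = - cnj a / cnj b\<close>, the relation \<open>|a|^2 - |b|^2 = 1\<close> gives
  \<open>A w = a / cnj b - 1 / ((cnj b)^2 (w - Q))\<close>, whose second term tends to 0 unless \<open>w\<close> is the limit of \<open>Q\<close>.\<close>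

lemma disk_act_tendsto:
  fixes A :: "nat \<Rightarrow> real^2^2"
  assumes det: "\<And>n. det (A n) = 1" and b: "filterlim (\<lambda>n. cmod (disk_b (A n))) at_top sequentially"
    and P: "(\<lambda>n. disk_a (A n) / cnj (disk_b (A n))) \<longlonglongrightarrow> x"
    and Q: "(\<lambda>n. - cnj (disk_a (A n)) / cnj (disk_b (A n))) \<longlonglongrightarrow> y"
    and w: "w \<noteq> y"
  shows "(\<lambda>n. disk_act (A n) w) \<longlonglongrightarrow> x"
proof -
  let ?a = "\<lambda>n. disk_a (A n)" and ?b = "\<lambda>n. disk_b (A n)"
  let ?Q = "\<lambda>n. - cnj (?a n) / cnj (?b n)"
  have "filterlim (\<lambda>n. cnj (?b n)) at_infinity sequentially"
    using b by (intro filterlim_norm_at_top_imp_at_infinity) simp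
  then have inv0: "(\<lambda>n. inverse (cnj (?b n))) \<longlonglongrightarrow> 0"
    by (rule filterlim_compose[OF tendsto_inverse_0])
  have wQ: "(\<lambda>n. w - ?Q n) \<longlonglongrightarrow> w - y" by (intro tendsto_intros Q)
  have "(\<lambda>n. ?a n / cnj (?b n) - inverse (cnj (?b n)) * inverse (cnj (?b n)) * inverse (w - ?Q n)) \<longlonglongrightarrow>
      x - 0 * 0 * inverse (w - y)"
    using w by (intro tendsto_intros P inv0 wQ) auto
  moreover have wQ0: "eventually (\<lambda>n. w - ?Q n \<noteq> 0) sequentially"
    using tendsto_imp_eventually_ne[OF wQ, of 0] w by simp
  have "eventually (\<lambda>n. ?a n / cnj (?b n) - inverse (cnj (?b n)) * inverse (cnj (?b n)) * inverse (w - ?Q n)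
      = disk_act (A n) w) sequentially"
    using wQ0 filterlim_at_top_dense[THEN iffD1, OF b, rule_format, of 0]
  proof eventually_elim
    case (elim n)
    then have nz: "cnj (?b n) \<noteq> 0" "w - ?Q n \<noteq> 0" by auto
    have ab: "?a n * cnj (?a n) - ?b n * cnj (?b n) = 1"
      using disk_ab_det[of "A n"] det[of n] unfolding complex_norm_square[symmetric]
      by (metis of_real_1 of_real_diff of_real_power)
    have den: "cnj (?b n) * w + cnj (?a n) = cnj (?b n) * (w - ?Q n)" using nz by (simp add: algebra_simps)
    have num: "(?a n * w + ?b n) * cnj (?b n) = ?a n * (cnj (?b n) * (w - ?Q n)) - 1"
      using nz ab by (simp add: algebra_simps)
    have "disk_act (A n) w = ((?a n * w + ?b n) * cnj (?b n)) / (cnj (?b n) * (cnj (?b n) * (w - ?Q n)))"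
      using nz unfolding disk_act_eq den by simp
    also have "\<dots> = ?a n / cnj (?b n) - inverse (cnj (?b n)) * inverse (cnj (?b n)) * inverse (w - ?Q n)"
      unfolding num using nz by (simp add: diff_divide_distrib inverse_eq_divide)
    finally show ?case by simp
  qed
  ultimately show ?thesis by (simp add: tendsto_cong)
qed


section \<open>Dynamics of Fuchsian groups\<close>

lemma fuchsianD:
  assumes "fuchsian \<Gamma>"
  shows "subgroup \<Gamma> PSL" "discrete (\<Union>\<Gamma>)" "z \<in> cball 0 1 \<Longrightarrow> infinite (disk_orbit \<Gamma> z)"
  using assms by (auto simp: fuchsian_def)

lemma limit_set_sphere: "x \<in> limit_set \<Gamma> \<Longrightarrow> norm x = 1" "x \<in> limit_set \<Gamma> \<Longrightarrow> x \<in> cball 0 1"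
  by (auto simp: limit_set_def)

lemma disk_act_inv:
  assumes "det A = 1" "w \<in> cball 0 1"
  shows "disk_act A (disk_act (matrix_inv A) w) = w" "disk_act (matrix_inv A) (disk_act A w) = w"
proof -
  have i: "invertible A" using assms by (simp add: invertible_det_nz)
  have d: "det (matrix_inv A) = 1"
    using assms(1) invertible_cancel(1)[OF i] by (metis det_I det_mul mult_1)
  show "disk_act A (disk_act (matrix_inv A) w) = w" "disk_act (matrix_inv A) (disk_act A w) = w"
    using assms by (simp_all add: disk_act_compose d invertible_cancel[OF i] disk_act_one)
qed

lemma isCont_disk_act:
  assumes "det A = 1" "w \<in> cball 0 1"
  shows "isCont (disk_act A) w"
  unfolding disk_act_eq[abs_def]
  by (intro continuous_intros disk_denom_nz[OF assms])

lemma limit_set_invariant: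
  assumes \<Gamma>: "subgroup \<Gamma> PSL" and A: "A \<in> \<Union>\<Gamma>" and x: "x \<in> limit_set \<Gamma>"
  shows "disk_act A x \<in> limit_set \<Gamma>"
proof -
  note L = lifts_subgroup[OF \<Gamma>]
  obtain z where z: "z \<in> ball 0 1" "x islimpt disk_orbit \<Gamma> z" and x1: "norm x = 1"
    using x by (auto simp: limit_set_def)
  have det: "det A = 1" by (rule L(1)[OF A])
  have xc: "x \<in> cball 0 1" using x1 by simp
  obtain f where f: "\<And>n. f n \<in> disk_orbit \<Gamma> z - {x}" "f \<longlonglongrightarrow> x"
    using z(2) unfolding islimpt_sequential by auto
  have zc: "z \<in> cball 0 1" using z(1) by auto
  have fc: "f n \<in> cball 0 1" for n
  proof -
    obtain B where B: "B \<in> \<Union>\<Gamma>" "f n = disk_act B z" using f(1)[of n] by (auto simp: disk_orbit_def)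
    have "norm (f n) < 1" unfolding B(2) by (rule disk_act_norm(2)[OF L(1)[OF B(1)] zc]) (use z in simp)
    then show ?thesis by simp
  qed
  have "disk_act A (f n) \<in> disk_orbit \<Gamma> z - {disk_act A x}" for n
  proof -
    obtain B where B: "B \<in> \<Union>\<Gamma>" "f n = disk_act B z" using f(1)[of n] by (auto simp: disk_orbit_def)
    have "disk_act A (f n) = disk_act (A ** B) z" unfolding B(2) by (rule disk_act_compose[OF L(1)[OF B(1)] zc])
    then have "disk_act A (f n) \<in> disk_orbit \<Gamma> z" using L(2)[OF A B(1)] unfolding disk_orbit_def by blast
    moreover have "disk_act A (f n) \<noteq> disk_act A x"
      using disk_act_inv(2)[OF det fc[of n]] disk_act_inv(2)[OF det xc] f(1)[of n] by force
    ultimately show ?thesis by simp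
  qed
  moreover have "(\<lambda>n. disk_act A (f n)) \<longlonglongrightarrow> disk_act A x"
    using isCont_tendsto_compose[OF isCont_disk_act[OF det xc] f(2)] .
  ultimately have "disk_act A x islimpt disk_orbit \<Gamma> z"
    unfolding islimpt_sequential by (intro exI[of _ "\<lambda>n. disk_act A (f n)"]) simp
  moreover have "norm (disk_act A x) = 1" by (rule disk_act_norm(1)[OF det xc x1])
  ultimately show ?thesis using z(1) unfolding limit_set_def by auto
qed

text \<open>Discreteness makes the matrices unbounded, so \<open>|b|\<close> tends to infinity and the two points
  \<open>a / cnj b\<close> and \<open>- cnj a / cnj b\<close> of the previous lemma approach the circle. Passing to the inverse matrix
  interchanges them, which gives both convergence statements at once. The orbit of 0 shows that the
  limit points belong to the limit set.\<close>

lemma fuchsian_dynamics: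
  assumes \<Gamma>: "subgroup \<Gamma> PSL" "discrete (\<Union>\<Gamma>)" and A: "inj A" "\<And>n. A n \<in> \<Union>\<Gamma>"
  obtains r x y where "strict_mono (r :: nat \<Rightarrow> nat)" "x \<in> limit_set \<Gamma>" "y \<in> limit_set \<Gamma>"
    "\<And>w. w \<noteq> y \<Longrightarrow> (\<lambda>n. disk_act (A (r n)) w) \<longlonglongrightarrow> x"
    "\<And>w. w \<noteq> x \<Longrightarrow> (\<lambda>n. disk_act (matrix_inv (A (r n))) w) \<longlonglongrightarrow> y"
proof -
  note L = lifts_subgroup[OF \<Gamma>(1)]
  have det: "det (A n) = 1" for n by (rule L(1)[OF A(2)])
  have fin: "finite {B \<in> \<Union>\<Gamma>. norm B \<le> R}" for R
    by (rule discrete_subgroup_finite_bounded[OF L(1) L(2) L(3) L(4) \<Gamma>(2)])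
  have b: "filterlim (\<lambda>n. cmod (disk_b (A n))) at_top sequentially"
    unfolding filterlim_at_top
  proof
    fix Z :: real
    have "finite {n. A n \<in> {B \<in> \<Union>\<Gamma>. norm B \<le> 2 * \<bar>Z\<bar> + 2}}"
      using finite_vimageI[OF fin A(1)] by (simp add: vimage_def)
    then have "eventually (\<lambda>n. \<not> norm (A n) \<le> 2 * \<bar>Z\<bar> + 2) sequentially"
      unfolding cofinite_eq_sequentially[symmetric] eventually_cofinite using A(2) by simp
    then show "eventually (\<lambda>n. Z \<le> cmod (disk_b (A n))) sequentially"
    proof eventually_elim
      case (elim n)
      then have "(2 * \<bar>Z\<bar> + 2)\<^sup>2 \<le> (norm (A n))\<^sup>2" by (intro power_mono) auto
      then have "4 * \<bar>Z\<bar>\<^sup>2 + 8 * \<bar>Z\<bar> + 4 \<le> (norm (A n))\<^sup>2" by (simp add: power2_eq_square algebra_simps)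
      then have "\<bar>Z\<bar>\<^sup>2 \<le> (cmod (disk_b (A n)))\<^sup>2"
        using disk_ab_norm[of "A n"] disk_ab_det[of "A n"] det[of n] by linarith
      then have "\<bar>Z\<bar> \<le> cmod (disk_b (A n))" by (rule power2_le_imp_le) simp
      then show ?case by linarith
    qed
  qed
  define P where "P n = disk_a (A n) / cnj (disk_b (A n))" for n
  define Q where "Q n = - cnj (disk_a (A n)) / cnj (disk_b (A n))" for n
  have nPQ: "norm (P n) = norm (Q n)" for n by (simp add: P_def Q_def norm_divide)
  have nP: "(\<lambda>n. norm (P n)) \<longlonglongrightarrow> 1"
  proof -
    have i0: "(\<lambda>n. inverse (cmod (disk_b (A n)))) \<longlonglongrightarrow> 0" by (rule tendsto_inverse_0_at_top[OF b])
    have "(\<lambda>n. sqrt (1 + (inverse (cmod (disk_b (A n))))\<^sup>2)) \<longlonglongrightarrow> sqrt (1 + 0\<^sup>2)"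
      by (intro tendsto_intros i0)
    moreover have "eventually (\<lambda>n. sqrt (1 + (inverse (cmod (disk_b (A n))))\<^sup>2) = norm (P n)) sequentially"
      using filterlim_at_top_dense[THEN iffD1, OF b, rule_format, of 0]
    proof eventually_elim
      case (elim n)
      have "(norm (P n))\<^sup>2 = (cmod (disk_a (A n)))\<^sup>2 / (cmod (disk_b (A n)))\<^sup>2"
        by (simp add: P_def norm_divide power_divide)
      also have "\<dots> = 1 + (inverse (cmod (disk_b (A n))))\<^sup>2"
        using elim disk_ab_det[of "A n"] det[of n] by (simp add: field_simps power_inverse)
      finally show ?case by (metis norm_ge_zero real_sqrt_abs abs_of_nonneg)
    qed
    ultimately show ?thesis by (simp add: tendsto_cong)
  qed
  obtain K where K: "\<And>n. norm (P n) \<le> K"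
    using convergent_imp_Bseq[OF convergentI[OF nP]] by (auto simp: Bseq_def)
  have "\<forall>n. (P n, Q n) \<in> cball 0 K \<times> cball 0 K" using K nPQ by simp
  moreover have "compact (cball (0::complex) K \<times> cball (0::complex) K)" by (intro compact_Times compact_cball)
  ultimately have "\<exists>l\<in>cball 0 K \<times> cball 0 K. \<exists>r. strict_mono r \<and> ((\<lambda>n. (P n, Q n)) \<circ> r) \<longlonglongrightarrow> l"
    unfolding compact_def by (elim allE[of _ "\<lambda>n. (P n, Q n)"] impE)
  then obtain l r where r: "strict_mono r" and l: "((\<lambda>n. (P n, Q n)) \<circ> r) \<longlonglongrightarrow> l"
    by (elim bexE exE conjE)
  obtain x y where xy: "l = (x, y)" by (cases l)
  have Px: "(\<lambda>n. P (r n)) \<longlonglongrightarrow> x" and Qy: "(\<lambda>n. Q (r n)) \<longlonglongrightarrow> y"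
    using tendsto_fst[OF l] tendsto_snd[OF l] by (simp_all add: xy comp_def)
  have nPr: "(\<lambda>n. norm (P (r n))) \<longlonglongrightarrow> 1" using LIMSEQ_subseq_LIMSEQ[OF nP r] by (simp add: comp_def)
  have x1: "norm x = 1" using LIMSEQ_unique[OF tendsto_norm[OF Px] nPr] .
  have y1: "norm y = 1" using LIMSEQ_unique[OF tendsto_norm[OF Qy]] nPr by (simp add: nPQ)
  have br: "filterlim (\<lambda>n. cmod (disk_b (A (r n)))) at_top sequentially"
    using filterlim_compose[OF b filterlim_subseq[OF r]] .
  have toX: "(\<lambda>n. disk_act (A (r n)) w) \<longlonglongrightarrow> x" if "w \<noteq> y" for w
    by (rule disk_act_tendsto[OF det br Px[unfolded P_def] Qy[unfolded Q_def] that])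
  have detI: "det (matrix_inv (A n)) = 1" for n by (intro L(1) L(3) A(2))
  have toY: "(\<lambda>n. disk_act (matrix_inv (A (r n))) w) \<longlonglongrightarrow> y" if "w \<noteq> x" for w
  proof (rule disk_act_tendsto[OF detI _ _ _ that])
    show "filterlim (\<lambda>n. cmod (disk_b (matrix_inv (A (r n))))) at_top sequentially"
      using br by (simp add: matrix_inv_2[OF det])
    show "(\<lambda>n. disk_a (matrix_inv (A (r n))) / cnj (disk_b (matrix_inv (A (r n))))) \<longlonglongrightarrow> y"
      using Qy by (simp add: matrix_inv_2[OF det] Q_def)
    show "(\<lambda>n. - cnj (disk_a (matrix_inv (A (r n)))) / cnj (disk_b (matrix_inv (A (r n))))) \<longlonglongrightarrow> x"
      using Px by (simp add: matrix_inv_2[OF det] P_def)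
  qed
  have lim: "x' \<in> limit_set \<Gamma>" if "(\<lambda>n. disk_act (B n) 0) \<longlonglongrightarrow> x'" "norm x' = 1" "\<And>n. B n \<in> \<Union>\<Gamma>" for B x'
  proof -
    have n1: "norm (disk_act (B n) 0) < 1" for n by (rule disk_act_norm(2)[OF L(1)[OF that(3)]]) auto
    have "disk_act (B n) 0 \<in> disk_orbit \<Gamma> 0 - {x'}" for n
    proof -
      have "disk_act (B n) 0 \<in> disk_orbit \<Gamma> 0" using that(3)[of n] unfolding disk_orbit_def by blast
      moreover have "disk_act (B n) 0 \<noteq> x'" using n1[of n] that(2) by auto
      ultimately show ?thesis by simp
    qed
    then have "x' islimpt disk_orbit \<Gamma> 0" using that(1)
      unfolding islimpt_sequential by (intro exI[of _ "\<lambda>n. disk_act (B n) 0"]) simp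
    then show ?thesis unfolding limit_set_def using that(2) by (auto intro!: bexI[of _ 0])
  qed
  have "x \<in> limit_set \<Gamma>" using y1 by (intro lim[OF toX x1 A(2)]) auto
  moreover have "y \<in> limit_set \<Gamma>" using x1 by (intro lim[OF toY y1 L(3)[OF A(2)]]) auto
  ultimately show ?thesis using that r toX toY by blast
qed

text \<open>A finite limit set would contain a finite orbit, since it is invariant and nonempty.\<close>

lemma infinite_limit_set:
  assumes "fuchsian \<Gamma>"
  shows "infinite (limit_set \<Gamma>)"
proof
  assume fin: "finite (limit_set \<Gamma>)"
  note F = fuchsianD[OF assms]
  have "disk_orbit \<Gamma> 0 = (\<lambda>A. disk_act A 0) ` (\<Union>\<Gamma>)" by (auto simp: disk_orbit_def)
  then have "infinite (\<Union>\<Gamma>)" using F(3)[of 0] by auto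
  then obtain A :: "nat \<Rightarrow> real^2^2" where A: "inj A" "range A \<subseteq> \<Union>\<Gamma>"
    using infinite_countable_subset by blast
  then have "A n \<in> \<Union>\<Gamma>" for n by blast
  then obtain x where x: "x \<in> limit_set \<Gamma>" using fuchsian_dynamics[OF F(1,2) A(1)] by metis
  have "disk_orbit \<Gamma> x \<subseteq> limit_set \<Gamma>"
    unfolding disk_orbit_def using limit_set_invariant[OF F(1) _ x] by blast
  then show False using F(3)[of x] limit_set_sphere[OF x] fin finite_subset by metis
qed

section \<open>Hausdorff measures\<close>

lemma hausdorff_measure_eq_0I:
  assumes "\<And>\<delta> e. \<delta> > 0 \<Longrightarrow> e > 0 \<Longrightarrow> \<exists>U. S \<subseteq> (\<Union>i. U i) \<and>
      (\<forall>i. U i \<subseteq> M \<and> (\<forall>x\<in>U i. \<forall>y\<in>U i. dst x y \<le> \<delta>)) \<and>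
      (\<Sum>i. ennreal (diam_wrt dst (U i) powr s)) \<le> ennreal e"
  shows "hausdorff_measure M dst s S = 0"
proof -
  have "hausdorff_premeasure M dst s \<delta> S \<le> 0" if \<delta>: "\<delta> > 0" for \<delta>
  proof (rule ennreal_le_epsilon)
    fix e :: real assume "e > 0"
    from assms[OF \<delta> this] obtain U where U: "S \<subseteq> (\<Union>i. U i)"
      "\<forall>i. U i \<subseteq> M \<and> (\<forall>x\<in>U i. \<forall>y\<in>U i. dst x y \<le> \<delta>)"
      "(\<Sum>i. ennreal (diam_wrt dst (U i) powr s)) \<le> ennreal e" by blast
    have "hausdorff_premeasure M dst s \<delta> S \<le> (\<Sum>i. ennreal (diam_wrt dst (U i) powr s))"
      unfolding hausdorff_premeasure_def by (rule INF_lower) (use U in auto)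
    also have "\<dots> \<le> 0 + ennreal e" using U(3) by simp
    finally show "hausdorff_premeasure M dst s \<delta> S \<le> 0 + ennreal e" .
  qed
  then have "hausdorff_measure M dst s S \<le> 0"
    unfolding hausdorff_measure_def by (intro SUP_least) auto
  then show ?thesis by simp
qed

lemma hausdorff_measure_eq_0D:
  assumes "hausdorff_measure M dst s S = 0" "\<delta> > 0" "e > (0::ennreal)"
  obtains U where "S \<subseteq> (\<Union>i. U i)"
      "\<And>i. U i \<subseteq> M" "\<And>i x y. x \<in> U i \<Longrightarrow> y \<in> U i \<Longrightarrow> dst x y \<le> \<delta>"
      "(\<Sum>i. ennreal (diam_wrt dst (U i) powr s)) < e"
proof -
  have "hausdorff_premeasure M dst s \<delta> S \<le> hausdorff_measure M dst s S"
    unfolding hausdorff_measure_def by (rule SUP_upper) (use assms in auto)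
  then have "hausdorff_premeasure M dst s \<delta> S < e" using assms by simp
  then show ?thesis
    unfolding hausdorff_premeasure_def INF_less_iff using that by blast
qed

text \<open>Covers of the pieces of total weight at most \<open>e / 2^(n + 1)\<close> are merged into one sequence of sets.\<close>

lemma hausdorff_measure_UN_eq_0:
  fixes E :: "nat \<Rightarrow> 'a set"
  assumes E: "\<And>n. hausdorff_measure M dst s (E n) = 0" and S: "S \<subseteq> (\<Union>n. E n)"
  shows "hausdorff_measure M dst s S = 0"
proof (rule hausdorff_measure_eq_0I)
  fix \<delta> e :: real assume \<delta>: "\<delta> > 0" and e: "e > 0"
  let ?w = "\<lambda>U. ennreal (diam_wrt dst U powr s)"
  have "\<exists>U. E n \<subseteq> (\<Union>i. U i) \<and> (\<forall>i. U i \<subseteq> M) \<and> (\<forall>i. \<forall>x\<in>U i. \<forall>y\<in>U i. dst x y \<le> \<delta>) \<and>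
      (\<Sum>i. ?w (U i)) < ennreal (e * (1/2)^Suc n)" for n
  proof -
    have "ennreal (e * (1/2)^Suc n) > 0" using e by (simp del: power_Suc)
    from hausdorff_measure_eq_0D[OF E \<delta> this] show ?thesis by metis
  qed
  then obtain U where U: "\<And>n. E n \<subseteq> (\<Union>i. U n i)" "\<And>n i. U n i \<subseteq> M"
    "\<And>n i x y. x \<in> U n i \<Longrightarrow> y \<in> U n i \<Longrightarrow> dst x y \<le> \<delta>"
    "\<And>n. (\<Sum>i. ?w (U n i)) < ennreal (e * (1/2)^Suc n)" by metis
  define V where "V k = (case prod_decode k of (n, i) \<Rightarrow> U n i)" for k
  have "S \<subseteq> (\<Union>k. V k)"
  proof
    fix x assume "x \<in> S"
    then obtain n i where "x \<in> U n i" using S U(1) by blast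
    then have "x \<in> V (prod_encode (n, i))" by (simp add: V_def)
    then show "x \<in> (\<Union>k. V k)" by blast
  qed
  moreover have "V k \<subseteq> M \<and> (\<forall>x\<in>V k. \<forall>y\<in>V k. dst x y \<le> \<delta>)" for k
    using U(2,3) by (auto simp: V_def split: prod.splits)
  moreover have "(\<Sum>k. ?w (V k)) \<le> ennreal e"
  proof -
    have "(\<Sum>k. ?w (V k)) = (\<Sum>n. \<Sum>i. ?w (U n i))"
    proof -
      have "?w (V k) = (\<lambda>(n, i). ?w (U n i)) (prod_decode k)" for k
        by (simp add: V_def split: prod.split)
      then have "(\<Sum>k. ?w (V k)) = (\<Sum>k. (\<lambda>(n, i). ?w (U n i)) (prod_decode k))" by (simp only:)
      also have "\<dots> = (\<Sum>n. \<Sum>i. ?w (U n i))"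
        by (rule suminf_ennreal_2dimen) (simp only: case_prod_conv)
      finally show ?thesis .
    qed
    also have "\<dots> \<le> (\<Sum>n. ennreal (e * (1/2)^Suc n))"
    proof (rule suminf_le)
      fix n show "(\<Sum>i. ?w (U n i)) \<le> ennreal (e * (1/2)^Suc n)" using U(4)[of n] by (rule less_imp_le)
    qed (rule summableI)+
    also have "\<dots> = ennreal e"
    proof -
      have "(\<lambda>n. e * (1/2)^Suc n) sums (e * 1)" by (intro sums_mult power_half_series)
      moreover have "0 \<le> e * (1/2)^Suc n" for n using e by (intro mult_nonneg_nonneg zero_le_power) auto
      ultimately have "(\<Sum>n. ennreal (e * (1/2)^Suc n)) = ennreal (e * 1)" by (intro suminf_ennreal_eq)
      then show ?thesis by (simp only: mult_1_right)
    qed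
    finally show ?thesis .
  qed
  ultimately show "\<exists>U. S \<subseteq> (\<Union>i. U i) \<and>
      (\<forall>i. U i \<subseteq> M \<and> (\<forall>x\<in>U i. \<forall>y\<in>U i. dst x y \<le> \<delta>)) \<and>
      (\<Sum>i. ?w (U i)) \<le> ennreal e" by blast
qed

lemma diam_wrt_bounds:
  assumes "\<And>x y. x \<in> U \<Longrightarrow> y \<in> U \<Longrightarrow> 0 \<le> dst x y \<and> dst x y \<le> c" "c \<ge> 0"
  shows "0 \<le> diam_wrt dst U" "diam_wrt dst U \<le> c"
proof -
  have "0 \<le> diam_wrt dst U \<and> diam_wrt dst U \<le> c"
  proof (cases "U = {}")
    case True then show ?thesis using assms by (simp add: diam_wrt_def)
  next
    case False
    then obtain x where x: "x \<in> U" by auto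
    have bdd: "bdd_above ((\<lambda>(x, y). dst x y) ` (U \<times> U))"
      using assms(1) by (intro bdd_aboveI[of _ c]) auto
    have "0 \<le> dst x x" using assms(1) x by auto
    also have "\<dots> \<le> (SUP (x, y)\<in>U \<times> U. dst x y)"
      using cSUP_upper[OF _ bdd, of "(x, x)"] x by simp
    finally have "0 \<le> (SUP (x, y)\<in>U \<times> U. dst x y)" .
    moreover have "(SUP (x, y)\<in>U \<times> U. dst x y) \<le> c"
      by (rule cSUP_least) (use False assms(1) in auto)
    ultimately show ?thesis using False by (simp add: diam_wrt_def)
  qed
  then show "0 \<le> diam_wrt dst U" "diam_wrt dst U \<le> c" by auto
qed

text \<open>A set parametrized in a Lipschitz way by a bounded set of reals: cutting the parameter interval into
  pieces of length \<open>1 / N\<close> gives at most \<open>m N + 1\<close> sets of diameter at most \<open>D / N\<close>, and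
  \<open>N (1 / N)^s\<close> tends to 0 for \<open>s > 1\<close>. Stated with the inverse \<open>f\<close> of the parametrization, so that no
  parametrization has to be constructed.\<close>

lemma hausdorff_measure_real_parameter_eq_0:
  assumes M: "E \<subseteq> M" and s: "s > 1"
    and f: "\<And>x. x \<in> E \<Longrightarrow> 0 \<le> f x \<and> f x \<le> real m"
    and lip: "\<And>x y. x \<in> E \<Longrightarrow> y \<in> E \<Longrightarrow> 0 \<le> dst x y \<and> dst x y \<le> C * \<bar>f x - f y\<bar>"
  shows "hausdorff_measure M dst s E = 0"
proof (rule hausdorff_measure_eq_0I)
  fix \<delta> e :: real assume \<delta>: "\<delta> > 0" and e: "e > 0"
  \<comment> \<open>The bound below needs a positive Lipschitz constant.\<close>
  define D where "D = max C 1"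
  have D: "D > 0" and lipD: "\<And>x y. x \<in> E \<Longrightarrow> y \<in> E \<Longrightarrow> dst x y \<le> D * \<bar>f x - f y\<bar>"
  proof -
    show "D > 0" by (simp add: D_def)
    fix x y assume "x \<in> E" "y \<in> E"
    then have "dst x y \<le> C * \<bar>f x - f y\<bar>" using lip by blast
    also have "\<dots> \<le> D * \<bar>f x - f y\<bar>" by (intro mult_right_mono) (auto simp: D_def)
    finally show "dst x y \<le> D * \<bar>f x - f y\<bar>" .
  qed
  have "(\<lambda>n. (real m + 1) * D powr s * real (Suc n) powr (1 - s)) \<longlonglongrightarrow> (real m + 1) * D powr s * 0"
    using s by (intro tendsto_mult tendsto_const tendsto_neg_powr filterlim_compose[OF filterlim_real_sequentially filterlim_Suc]) auto
  then have "eventually (\<lambda>n. (real m + 1) * D powr s * real (Suc n) powr (1 - s) < e) sequentially"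
    using e by (intro order_tendstoD(2)) auto
  moreover have "(\<lambda>n. D * inverse (real (Suc n))) \<longlonglongrightarrow> D * 0"
    by (intro tendsto_mult tendsto_const LIMSEQ_inverse_real_of_nat)
  then have "eventually (\<lambda>n. D * inverse (real (Suc n)) < \<delta>) sequentially"
    using \<delta> by (intro order_tendstoD(2)) auto
  ultimately have "eventually (\<lambda>n. (real m + 1) * D powr s * real (Suc n) powr (1 - s) < e \<and> D * inverse (real (Suc n)) < \<delta>) sequentially"
    by (rule eventually_conj)
  then obtain n where n: "(real m + 1) * D powr s * real (Suc n) powr (1 - s) < e" "D * inverse (real (Suc n)) < \<delta>"
    unfolding eventually_sequentially by auto
  define N where "N = Suc n"
  define U where "U j = {x \<in> E. \<lfloor>f x * real N\<rfloor> = int j}" for j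
  have N: "N > 0" by (simp add: N_def)
  have small: "0 \<le> dst x y \<and> dst x y \<le> D / real N" if "x \<in> U j" "y \<in> U j" for x y j
  proof -
    have xy: "x \<in> E" "y \<in> E" using that by (auto simp: U_def)
    have "\<lfloor>f x * real N\<rfloor> = int j" "\<lfloor>f y * real N\<rfloor> = int j" using that by (auto simp: U_def)
    then have "\<bar>f x * real N - f y * real N\<bar> \<le> 1" by linarith
    then have "\<bar>f x - f y\<bar> * real N \<le> 1" by (simp add: left_diff_distrib[symmetric] abs_mult)
    then have "\<bar>f x - f y\<bar> \<le> 1 / real N" using N by (simp add: field_simps)
    then have "D * \<bar>f x - f y\<bar> \<le> D * (1 / real N)" using D by (intro mult_left_mono) auto
    then show ?thesis using lipD[OF xy] lip[OF xy] by simp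
  qed
  have DN: "D / real N \<ge> 0" using D by simp
  have empty: "U j = {}" if "j > m * N" for j
  proof (rule ccontr)
    assume "U j \<noteq> {}"
    then obtain x where x: "x \<in> E" "\<lfloor>f x * real N\<rfloor> = int j" by (auto simp: U_def)
    have "f x * real N \<le> real m * real N" using f[OF x(1)] by (intro mult_right_mono) auto
    then have "\<lfloor>f x * real N\<rfloor> \<le> int (m * N)" by (simp add: floor_le_iff)
    then have "int j \<le> int (m * N)" using x(2) by simp
    then have "j \<le> m * N" by (rule of_nat_le_iff[THEN iffD1])
    then show False using that by simp
  qed
  have "E \<subseteq> (\<Union>j. U j)"
  proof
    fix x assume x: "x \<in> E"
    then have "f x * real N \<ge> 0" using f by simp
    then have "\<lfloor>f x * real N\<rfloor> = int (nat \<lfloor>f x * real N\<rfloor>)" by simp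
    then have "x \<in> U (nat \<lfloor>f x * real N\<rfloor>)" using x by (simp add: U_def)
    then show "x \<in> (\<Union>j. U j)" by blast
  qed
  moreover have "U j \<subseteq> M \<and> (\<forall>x\<in>U j. \<forall>y\<in>U j. dst x y \<le> \<delta>)" for j
  proof -
    have "D / real N < \<delta>" using n(2) by (simp add: N_def divide_inverse)
    then show ?thesis using M small[of _ j] by (force simp: U_def)
  qed
  moreover have "(\<Sum>j. ennreal (diam_wrt dst (U j) powr s)) \<le> ennreal e"
  proof -
    have "(\<Sum>j. ennreal (diam_wrt dst (U j) powr s)) = (\<Sum>j\<le>m * N. ennreal (diam_wrt dst (U j) powr s))"
      by (rule suminf_finite) (auto simp: empty diam_wrt_def)
    also have "\<dots> \<le> (\<Sum>j\<le>m * N. ennreal ((D / real N) powr s))"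
      using s diam_wrt_bounds[OF small DN] by (intro sum_mono ennreal_leI powr_mono2) auto
    also have "\<dots> = ennreal (\<Sum>j\<le>m * N. (D / real N) powr s)"
      by (rule sum_ennreal) simp
    also have "(\<Sum>j\<le>m * N. (D / real N) powr s) = (real (m * N) + 1) * (D / real N) powr s"
      by (simp add: algebra_simps)
    also have "(real (m * N) + 1) * (D / real N) powr s \<le> ((real m + 1) * real N) * (D / real N) powr s"
      using N by (intro mult_right_mono) (auto simp: algebra_simps)
    also have "\<dots> = (real m + 1) * D powr s * real N powr (1 - s)"
    proof -
      have "(D / real N) powr s = D powr s / real N powr s"
        using N D by (simp add: powr_divide)
      moreover have "real N powr (1 - s) = real N / real N powr s"
        using N by (simp add: powr_diff)
      ultimately show ?thesis by (simp only: times_divide_eq_right times_divide_eq_left mult.assoc mult.commute mult.left_commute)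
    qed
    also have "\<dots> \<le> e" using n(1) by (simp add: N_def)
    finally show ?thesis by (simp only: ennreal_leI)
  qed
  ultimately show "\<exists>U. E \<subseteq> (\<Union>i. U i) \<and>
      (\<forall>i. U i \<subseteq> M \<and> (\<forall>x\<in>U i. \<forall>y\<in>U i. dst x y \<le> \<delta>)) \<and>
      (\<Sum>i. ennreal (diam_wrt dst (U i) powr s)) \<le> ennreal e" by blast
qed

lemma hausdorff_dim_le_1:
  assumes "\<And>s. s > 1 \<Longrightarrow> hausdorff_measure M dst s S = 0"
  shows "hausdorff_dim M dst S \<le> 1"
proof (rule ennreal_le_epsilon)
  fix e :: real assume e: "e > 0"
  have "hausdorff_dim M dst S \<le> ennreal (1 + e)"
    unfolding hausdorff_dim_def by (rule Inf_lower, intro CollectI exI[of _ "1 + e"] conjI refl) (use assms[of "1 + e"] e in auto)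
  also have "\<dots> = 1 + ennreal e" using e by (simp add: ennreal_plus)
  finally show "hausdorff_dim M dst S \<le> 1 + ennreal e" .
qed

section \<open>Riemannian distance along segments of matrices\<close>

lemma bilinear_matrix_mult: "bilinear ((**) :: real^'d^'d \<Rightarrow> real^'d^'d \<Rightarrow> real^'d^'d)"
  unfolding bilinear_def
  by (auto intro!: linearI simp: matrix_matrix_mult_def vec_eq_iff algebra_simps sum.distrib sum_distrib_left)

lemma continuous_on_matrix_inv: "continuous_on {A :: real^'d^'d. invertible A} matrix_inv"
  unfolding continuous_on_def
proof (rule ballI, intro vec_tendstoI)
  fix A :: "real^'d^'d" and i j
  assume A: "A \<in> {A. invertible A}"
  let ?net = "at A within {A. invertible A}"
  have "((\<lambda>B. matrix_inv B *v axis j 1) \<longlongrightarrow> matrix_inv A *v axis j 1) ?net"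
  proof (rule tendsto_solve[where A = "\<lambda>B. B" and ?A0.0 = A])
    show "((\<lambda>B. B) \<longlongrightarrow> A) ?net" by (rule tendsto_ident_at)
    show "invertible A" using A by simp
    have "eventually (\<lambda>B. axis j 1 = B *v (matrix_inv B *v axis j 1)) ?net"
      unfolding eventually_at_filter
    proof (intro always_eventually allI impI)
      fix B :: "real^'d^'d" assume "B \<in> {A. invertible A}"
      then show "axis j 1 = B *v (matrix_inv B *v axis j 1)"
        using invertible_cancel(1)[of B] by (simp add: matrix_vector_mul_assoc)
    qed
    from Lim_transform_eventually[OF tendsto_const this]
    have "((\<lambda>B. B *v (matrix_inv B *v axis j 1)) \<longlongrightarrow> axis j 1) ?net" .
    moreover have "axis j 1 = A *v (matrix_inv A *v axis j 1)"
      using A invertible_cancel(1)[of A] by (simp add: matrix_vector_mul_assoc)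
    ultimately show "((\<lambda>B. B *v (matrix_inv B *v axis j 1)) \<longlongrightarrow> A *v (matrix_inv A *v axis j 1)) ?net"
      by (rule subst[rotated])
  qed
  from tendsto_vec_nth[OF this, of i]
  show "((\<lambda>B. matrix_inv B $ i $ j) \<longlongrightarrow> matrix_inv A $ i $ j) ?net"
    by (simp add: matrix_vector_mult_basis column_def)
qed

text \<open>The coefficients of the metric with respect to a basis of matrices are continuous, hence bounded on a
  compact set of matrices.\<close>

lemma metric_bounded_on_compact:
  fixes g :: "'d::finite flag \<Rightarrow> real^'d^'d \<Rightarrow> real^'d^'d \<Rightarrow> real"
  assumes g: "flag_riemannian_metric g" and K: "compact K" "K \<subseteq> {A. invertible A}"
  obtains C where "C > 0" "\<And>A X. A \<in> K \<Longrightarrow> sqrt (g (flag_act A std_flag) X X) \<le> C * norm X"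
proof -
  have cont: "continuous_on {A. invertible A} (\<lambda>A. g (flag_act A std_flag) X Y)" for X Y
  proof -
    have "Ck_on 0 (\<lambda>A. g (flag_act A std_flag) X Y) {A. invertible A}"
      using g unfolding flag_riemannian_metric_def by blast
    then show ?thesis by simp
  qed
  have "\<exists>M. \<forall>A\<in>K. \<bar>g (flag_act A std_flag) X Y\<bar> \<le> M" for X Y
  proof -
    have "compact ((\<lambda>A. g (flag_act A std_flag) X Y) ` K)"
      by (rule compact_continuous_image[OF continuous_on_subset[OF cont K(2)] K(1)])
    then have "bounded ((\<lambda>A. g (flag_act A std_flag) X Y) ` K)" by (rule compact_imp_bounded)
    then show ?thesis by (auto simp: bounded_iff)
  qed
  then obtain M where M: "\<And>X Y A. A \<in> K \<Longrightarrow> \<bar>g (flag_act A std_flag) X Y\<bar> \<le> M X Y" by metis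
  define S where "S = (\<Sum>(b, c)\<in>Basis \<times> Basis. \<bar>M b c\<bar>)"
  have S0: "S \<ge> 0" unfolding S_def by (intro sum_nonneg) auto
  show ?thesis
  proof (rule that[of "sqrt (S + 1)"])
    show "sqrt (S + 1) > 0" using S0 by simp
    fix A and X :: "real^'d^'d" assume A: "A \<in> K"
    let ?h = "g (flag_act A std_flag)"
    have fl: "flag_act A std_flag \<in> flags" using A K flag_act_flags std_flag_flags by blast
    have bil: "bilinear ?h" using g fl unfolding flag_riemannian_metric_def by blast
    have "?h X X = ?h (\<Sum>b\<in>Basis. (X \<bullet> b) *\<^sub>R b) (\<Sum>c\<in>Basis. (X \<bullet> c) *\<^sub>R c)"
      by (simp only: euclidean_representation)
    also have "\<dots> = (\<Sum>(b, c)\<in>Basis \<times> Basis. ?h ((X \<bullet> b) *\<^sub>R b) ((X \<bullet> c) *\<^sub>R c))"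
      by (rule bilinear_sum[OF bil])
    also have "\<dots> \<le> (\<Sum>(b, c)\<in>Basis \<times> Basis. (norm X)\<^sup>2 * \<bar>M b c\<bar>)"
    proof (rule sum_mono, clarify)
      fix b c :: "real^'d^'d" assume b: "b \<in> Basis" and c: "c \<in> Basis"
      have "?h ((X \<bullet> b) *\<^sub>R b) ((X \<bullet> c) *\<^sub>R c) = (X \<bullet> b) * (X \<bullet> c) * ?h b c"
        by (simp add: bilinear_lmul[OF bil] bilinear_rmul[OF bil])
      also have "\<dots> \<le> \<bar>X \<bullet> b\<bar> * \<bar>X \<bullet> c\<bar> * \<bar>?h b c\<bar>" by (metis abs_ge_self abs_mult)
      also have "\<dots> \<le> norm X * norm X * \<bar>M b c\<bar>"
        using M[OF A, of b c] Basis_le_norm[OF b, of X] Basis_le_norm[OF c, of X] by (intro mult_mono) auto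
      finally show "?h ((X \<bullet> b) *\<^sub>R b) ((X \<bullet> c) *\<^sub>R c) \<le> (norm X)\<^sup>2 * \<bar>M b c\<bar>"
        by (simp add: power2_eq_square)
    qed
    also have "\<dots> = (norm X)\<^sup>2 * S"
      unfolding S_def by (simp add: sum_distrib_left case_prod_unfold)
    also have "\<dots> \<le> (S + 1) * (norm X)\<^sup>2" by (simp add: algebra_simps)
    finally have "sqrt (?h X X) \<le> sqrt ((S + 1) * (norm X)\<^sup>2)" by simp
    then show "sqrt (?h X X) \<le> sqrt (S + 1) * norm X" by (simp add: real_sqrt_mult)
  qed
qed

lemma flag_path_length_nonneg:
  fixes g :: "'d::finite flag \<Rightarrow> real^'d^'d \<Rightarrow> real^'d^'d \<Rightarrow> real"
  assumes g: "flag_riemannian_metric g" and A: "\<forall>t\<in>{0..1}. invertible (A t)"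
  shows "flag_path_length g A \<ge> 0"
proof -
  let ?f = "\<lambda>t. let X = vector_derivative A (at t) ** matrix_inv (A t) in sqrt (g (flag_act (A t) std_flag) X X)"
  have nn: "?f t \<ge> 0" if "t \<in> {0..1}" for t
  proof -
    have "flag_act (A t) std_flag \<in> flags" using A that by (intro flag_act_flags std_flag_flags) auto
    then have "0 \<le> g (flag_act (A t) std_flag) X X" for X
      using g unfolding flag_riemannian_metric_def by blast
    then show ?thesis by (simp add: Let_def)
  qed
  show ?thesis
  proof (cases "?f integrable_on {0..1}")
    case True
    then show ?thesis unfolding flag_path_length_def using nn by (rule integral_nonneg)
  next
    case False
    then show ?thesis unfolding flag_path_length_def by (simp add: not_integrable_integral)
  qed
qed

text \<open>The straight segment from \<open>S\<close> to \<open>T\<close> stays in the convex set \<open>U\<close>, and along it the velocity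
  \<open>(T - S) A0 A(t)^(-1)\<close> is at most a constant times \<open>norm (T - S)\<close>. A bound on the integrand suffices for a
  bound on the length: where the integrand is not integrable its integral is 0 by convention.\<close>

lemma flag_dist_lipschitz:
  fixes g :: "'d::finite flag \<Rightarrow> real^'d^'d \<Rightarrow> real^'d^'d \<Rightarrow> real"
    and A0 :: "real^'d^'d"
  assumes g: "flag_riemannian_metric g" and U: "compact U" "convex U" "U \<subseteq> {T. invertible T}"
    and A0: "invertible A0"
  obtains C where "C > 0" "\<And>S T. S \<in> U \<Longrightarrow> T \<in> U \<Longrightarrow>
    0 \<le> flag_dist g (flag_act (S ** A0) std_flag) (flag_act (T ** A0) std_flag) \<and>
    flag_dist g (flag_act (S ** A0) std_flag) (flag_act (T ** A0) std_flag) \<le> C * norm (S - T)"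
proof -
  let ?K = "(\<lambda>T. T ** A0) ` U"
  have "continuous_on U (\<lambda>T :: real^'d^'d. T ** A0)"
    unfolding continuous_on_def by (auto intro!: tendsto_matrix_mult tendsto_const tendsto_ident_at)
  then have K: "compact ?K" using U(1) by (intro compact_continuous_image)
  have Kinv: "?K \<subseteq> {A. invertible A}" using U(3) A0 by (auto intro!: invertible_mult)
  obtain C where C: "C > 0" "\<And>A X. A \<in> ?K \<Longrightarrow> sqrt (g (flag_act A std_flag) X X) \<le> C * norm X"
    using metric_bounded_on_compact[OF g K Kinv] by metis
  have "compact (matrix_inv ` ?K)"
    by (rule compact_continuous_image[OF continuous_on_subset[OF continuous_on_matrix_inv Kinv] K])
  then have "bounded (matrix_inv ` ?K)" by (rule compact_imp_bounded)
  then obtain R where R': "\<forall>X\<in>matrix_inv ` ?K. norm X \<le> R" unfolding bounded_iff by (rule exE)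
  have R: "norm (matrix_inv A) \<le> R" if "A \<in> ?K" for A
    using R' imageI[OF that] by (rule bspec)
  have "\<exists>B>0. \<forall>(X :: real^'d^'d) (Y :: real^'d^'d). norm (X ** Y) \<le> B * norm X * norm Y"
    by (rule bilinear_bounded_pos[OF bilinear_matrix_mult])
  then obtain B where B: "B > 0" and B': "\<forall>(X :: real^'d^'d) (Y :: real^'d^'d). norm (X ** Y) \<le> B * norm X * norm Y"
    by (elim exE conjE)
  define D where "D = C * (B * (B * norm A0) * \<bar>R\<bar>) + 1"
  have D0: "D > 0"
  proof -
    have "0 \<le> C * (B * (B * norm A0) * \<bar>R\<bar>)"
      using C(1) B by (intro mult_nonneg_nonneg) (simp_all add: less_imp_le)
    then show ?thesis by (simp add: D_def)
  qed
  show ?thesis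
  proof (rule that[OF D0])
    fix S T assume ST: "S \<in> U" "T \<in> U"
    let ?F = "flag_act (S ** A0) std_flag" and ?G = "flag_act (T ** A0) std_flag"
    let ?L = "{flag_path_length g A | A. A C1_differentiable_on {0..1} \<and> (\<forall>t\<in>{0..1}. invertible (A t)) \<and>
        flag_act (A 0) std_flag = ?F \<and> flag_act (A 1) std_flag = ?G}"
    define V where "V = (T - S) ** A0"
    \<comment> \<open>The same segment in the affine form from which its derivative can be read off.\<close>
    define A where "A t = S ** A0 + t *\<^sub>R V" for t
    have A_eq: "A t = ((1 - t) *\<^sub>R S + t *\<^sub>R T) ** A0" for t
      unfolding A_def V_def
      by (simp add: matrix_matrix_mult_def vec_eq_iff sum_distrib_left sum.distrib[symmetric] algebra_simps)
    have AK: "A t \<in> ?K" if "t \<in> {0..1}" for t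
      unfolding A_eq using convexD_alt[OF U(2) ST, of t] that by auto
    then have Ainv: "\<forall>t\<in>{0..1}. invertible (A t)" using Kinv by blast
    have der: "(A has_vector_derivative V) (at t)" for t
      unfolding A_def[abs_def] by (auto intro!: derivative_eq_intros)
    have C1: "A C1_differentiable_on {0..1}"
      unfolding C1_differentiable_on_def using der by (intro exI[of _ "\<lambda>_. V"]) auto
    have "A 0 = S ** A0" "A 1 = T ** A0" unfolding A_eq by simp_all
    then have mem: "flag_path_length g A \<in> ?L" using C1 Ainv by auto
    have lower: "0 \<le> x" if "x \<in> ?L" for x
      using that by (elim CollectE exE conjE) (simp only: flag_path_length_nonneg[OF g])
    then have bdd: "bdd_below ?L" by (rule bdd_belowI)
    have "0 \<le> flag_dist g ?F ?G"
      unfolding flag_dist_def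
    proof (rule cInf_greatest)
      show "?L \<noteq> {}" using mem by (metis empty_iff)
    qed (rule lower)
    moreover have "flag_dist g ?F ?G \<le> flag_path_length g A"
      unfolding flag_dist_def by (rule cInf_lower[OF mem bdd])
    moreover have "flag_path_length g A \<le> D * norm (S - T)"
    proof -
      let ?f = "\<lambda>t. let X = vector_derivative A (at t) ** matrix_inv (A t) in sqrt (g (flag_act (A t) std_flag) X X)"
      have fle: "?f t \<le> D * norm (S - T)" if t: "t \<in> {0..1}" for t
      proof -
        have "?f t = sqrt (g (flag_act (A t) std_flag) (V ** matrix_inv (A t)) (V ** matrix_inv (A t)))"
          by (simp add: Let_def vector_derivative_at[OF der])
        also have "\<dots> \<le> C * norm (V ** matrix_inv (A t))" by (rule C(2)[OF AK[OF t]])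
        also have "\<dots> \<le> C * (B * (B * norm (T - S) * norm A0) * \<bar>R\<bar>)"
        proof (rule mult_left_mono)
          have "norm (V ** matrix_inv (A t)) \<le> B * norm V * norm (matrix_inv (A t))" using B' by (elim allE)
          also have "\<dots> \<le> B * (B * norm (T - S) * norm A0) * \<bar>R\<bar>"
          proof (rule mult_mono)
            have "norm V \<le> B * norm (T - S) * norm A0" unfolding V_def using B' by (elim allE)
            then show "B * norm V \<le> B * (B * norm (T - S) * norm A0)" using B by simp
            show "norm (matrix_inv (A t)) \<le> \<bar>R\<bar>" using R[OF AK[OF t]] by linarith
          qed (use B in auto)
          finally show "norm (V ** matrix_inv (A t)) \<le> B * (B * norm (T - S) * norm A0) * \<bar>R\<bar>" .
        qed (use C in simp)
        also have "\<dots> \<le> D * norm (S - T)"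
          unfolding D_def by (simp add: algebra_simps norm_minus_commute)
        finally show ?thesis .
      qed
      show ?thesis
      proof (cases "?f integrable_on {0..1}")
        case True
        then have "integral {0..1} ?f \<le> integral {0..1} (\<lambda>_::real. D * norm (S - T))"
          by (rule integral_le) (use fle in auto)
        then show ?thesis unfolding flag_path_length_def by simp
      next
        case False
        then show ?thesis unfolding flag_path_length_def using D0 by (simp add: not_integrable_integral)
      qed
    qed
    ultimately show "0 \<le> flag_dist g ?F ?G \<and> flag_dist g ?F ?G \<le> D * norm (S - T)" by simp
  qed
qed

section \<open>The unipotent group of a flag\<close>

text \<open>The matrices that are strictly upper triangular with respect to \<open>F\<close>. Adding the identity to them
  gives the unipotent radical of the stabilizer of \<open>F\<close>. Being an affine subspace, this group is convex, which makes straight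
  segments available for estimating distances.\<close>

definition flag_nil :: "'d::finite flag \<Rightarrow> (real^'d^'d) set" where
  "flag_nil F = {X. \<forall>k. \<forall>v\<in>F (Suc k). X *v v \<in> F k}"

lemma subspace_flag_nil:
  assumes "F \<in> flags" shows "subspace (flag_nil F)"
  using flagsD(1)[OF assms] unfolding subspace_def flag_nil_def
  by (auto simp: matrix_vector_mult_add_rdistrib scaleR_matrix_vector_assoc[symmetric])

lemma flag_nil_mem:
  assumes F: "F \<in> flags" and X: "X \<in> flag_nil F" and v: "(v :: real^'d) \<in> F k"
  shows "X *v v \<in> F k"
proof (cases k)
  case 0
  then show ?thesis using v flag_zero[OF F] by simp
next
  case (Suc j)
  then show ?thesis using X v flagsD(3)[OF F, of j k] unfolding flag_nil_def by auto
qed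

lemma flag_nil_mult:
  assumes F: "F \<in> flags" and X: "X \<in> flag_nil F" "Y \<in> flag_nil F"
  shows "X ** (Y :: real^'d^'d) \<in> flag_nil F"
  unfolding flag_nil_def mem_Collect_eq
proof (intro allI ballI)
  fix k v assume "v \<in> F (Suc k)"
  then have "Y *v v \<in> F k" using X(2) by (simp add: flag_nil_def)
  then have "X *v (Y *v v) \<in> F k" by (rule flag_nil_mem[OF F X(1)])
  then show "(X ** Y) *v v \<in> F k" by (simp add: matrix_vector_mul_assoc)
qed

text \<open>Descend through the flag: if \<open>v\<close> is in \<open>F (i + 1)\<close> for some \<open>i \<ge> j\<close>, then \<open>X v\<close> is in \<open>F i\<close>, and subtracting
  it from \<open>v + X v\<close> puts \<open>v\<close> into \<open>F i\<close>.\<close>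

lemma flag_nil_reflect:
  assumes F: "F \<in> flags" and X: "X \<in> flag_nil F" and v: "v + X *v (v :: real^'d) \<in> F j"
  shows "v \<in> F j"
proof -
  have "v \<in> F (j + n) \<Longrightarrow> v \<in> F j" for n
  proof (induction n)
    case (Suc n)
    have "X *v v \<in> F (j + n)" using X Suc.prems by (simp add: flag_nil_def)
    moreover have "v + X *v v \<in> F (j + n)" using v flagsD(3)[OF F, of j "j + n"] by auto
    ultimately have "(v + X *v v) - X *v v \<in> F (j + n)" by (intro subspace_diff[OF flagsD(1)[OF F]])
    then show ?case using Suc.IH by simp
  qed simp
  moreover have "v \<in> F (j + CARD('d))" using flag_UNIV[OF F, of "j + CARD('d)"] by simp
  ultimately show ?thesis by blast
qed

lemma unipotent_invertible:
  assumes F: "F \<in> flags" and T: "T - mat 1 \<in> flag_nil F"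
  shows "invertible (T :: real^'d^'d)"
  unfolding invertible_iff_inj
proof (intro allI impI)
  fix v assume "T *v v = 0"
  then have "v + (T - mat 1) *v v \<in> F 0"
    using flag_zero[OF F] by (simp add: matrix_vector_mult_diff_rdistrib)
  then have "v \<in> F 0" by (rule flag_nil_reflect[OF F T])
  then show "v = 0" using flag_zero[OF F] by simp
qed

lemma matrix_diff_mult:
  fixes A B C :: "real^'d^'d"
  shows "(A - B) ** C = A ** C - B ** C" "C ** (A - B) = C ** A - C ** B"
  by (simp_all add: matrix_matrix_mult_def vec_eq_iff left_diff_distrib right_diff_distrib sum_subtractf)

lemma cols_cong:
  fixes b c :: "nat \<Rightarrow> real^'d"
  assumes "\<And>i. i \<in> {1..CARD('d)} \<Longrightarrow> b i = c i"
  shows "cols b = cols c"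
proof -
  have "b (idx j) = c (idx j)" for j :: 'd using assms idx_range by blast
  then show ?thesis by (simp add: cols_def)
qed

lemma unipotent_mult:
  assumes F: "F \<in> flags" and S: "S - mat 1 \<in> flag_nil F" and T: "T - mat 1 \<in> flag_nil F"
  shows "S ** T - mat 1 \<in> flag_nil (F :: 'd::finite flag)"
proof -
  have "S ** T - mat 1 = (S - mat 1) ** (T - mat 1) + (S - mat 1) + (T - mat 1)"
    by (simp add: matrix_diff_mult)
  also have "\<dots> \<in> flag_nil F"
    by (intro subspace_add[OF subspace_flag_nil[OF F]] flag_nil_mult[OF F] S T)
  finally show ?thesis .
qed

text \<open>The unipotent group of \<open>F\<close> acts freely on the flags transverse to \<open>F\<close>. If \<open>T b = S v\<close> for a vector \<open>b\<close>
  of the line \<open>F i \<inter> G (d - i + 1)\<close> and \<open>v\<close> in \<open>G (d - i + 1)\<close>, then \<open>v - b\<close> lies in \<open>F (i - 1)\<close> as well as in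
  \<open>G (d - i + 1)\<close>, hence vanishes. So \<open>S\<close> and \<open>T\<close> agree on a basis. This makes the unipotent coordinate of
  a flag independent of the positive tuple from which it is obtained.\<close>

lemma unipotent_unique:
  fixes S T :: "real^'d^'d"
  assumes F: "F \<in> flags" and G: "G \<in> flags" and tr: "transverse F G"
    and S: "S - mat 1 \<in> flag_nil F" and T: "T - mat 1 \<in> flag_nil F"
    and eq: "flag_act S G = flag_act T G"
    and b: "\<And>i. i \<in> {1..CARD('d)} \<Longrightarrow> b i \<noteq> 0 \<and> b i \<in> F i \<and> b i \<in> G (CARD('d) - i + 1)"
  shows "S = T"
proof -
  let ?d = "CARD('d)"
  have Tb: "T *v b i = S *v b i" if i: "i \<in> {1..?d}" for i
  proof -
    let ?k = "?d - i + 1"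
    have "T *v b i \<in> flag_act S G ?k" unfolding eq using b[OF i] by (auto simp: flag_act_def)
    then obtain v where v: "v \<in> G ?k" "T *v b i = S *v v" by (auto simp: flag_act_def)
    define e where "e = v - b i"
    have "e \<in> G ?k" unfolding e_def using v b[OF i] by (intro subspace_diff[OF flagsD(1)[OF G]]) auto
    have bi: "b i \<in> F (Suc (i - 1))" using b[OF i] i by simp
    have "e + (S - mat 1) *v e = (T - mat 1) *v b i - (S - mat 1) *v b i"
      unfolding e_def using v(2) by (simp add: matrix_vector_mult_diff_rdistrib matrix_vector_mult_diff_distrib)
    also have "\<dots> \<in> F (i - 1)"
      using S T bi unfolding flag_nil_def by (intro subspace_diff[OF flagsD(1)[OF F]]) auto
    finally have "e \<in> F (i - 1)" by (rule flag_nil_reflect[OF F S])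
    moreover have "i - 1 \<le> ?d" "?k = ?d - (i - 1)" using i by auto
    ultimately have "e = 0" using \<open>e \<in> G ?k\<close> tr unfolding transverse_def by (metis IntI singletonD)
    then show ?thesis using v(2) by (simp add: e_def)
  qed
  have inv: "invertible (cols b)" by (rule transverse_basis(1)[OF F G tr b])
  have "T ** cols b = S ** cols b"
    unfolding matrix_mult_cols using Tb by (rule cols_cong)
  then have "(T ** cols b) ** matrix_inv (cols b) = (S ** cols b) ** matrix_inv (cols b)" by simp
  then show ?thesis using invertible_cancel(1)[OF inv] by (simp add: matrix_mul_assoc[symmetric])
qed

section \<open>Monotonicity along positive maps\<close>

text \<open>The minors of size 1 are the entries, so the matrix of \<open>u\<close> is nonnegative.\<close>

lemma U_pos_matrix:
  fixes b :: "nat \<Rightarrow> real^'d"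
  assumes u: "u \<in> U_pos b"
  obtains C :: "real^'d^'d" where "u ** cols b = cols b ** C"
    "\<And>i j. C $ i $ j \<ge> 0" "\<And>i. C $ i $ i = 1" "\<And>i j. idx j < idx i \<Longrightarrow> C $ i $ j = 0"
proof -
  let ?d = "CARD('d)"
  obtain c where c: "\<forall>j\<in>{1..?d}. u *v b j = (\<Sum>i\<in>{1..?d}. c i j *\<^sub>R b i)"
    and up: "upper_triangular ?d c" and one: "\<forall>i\<in>{1..?d}. c i i = 1"
    and pos: "\<forall>k\<in>{1..?d}. \<forall>r s. minor_index ?d k r \<and> minor_index ?d k s \<and>
        \<not> forced_zero_minor ?d k r s \<longrightarrow> minor k r s c > 0"
    using u unfolding U_pos_def by blast
  have c_pos: "c i j > 0" if ij: "i \<in> {1..?d}" "j \<in> {1..?d}" "i \<le> j" for i j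
  proof -
    have mi: "minor_index ?d 1 (\<lambda>_. i)" "minor_index ?d 1 (\<lambda>_. j)"
      using ij by (auto simp: minor_index_def strict_mono_on_def)
    have "\<not> forced_zero_minor ?d 1 (\<lambda>_. i) (\<lambda>_. j)" by (rule not_forced_zero[OF mi]) (use ij in simp)
    then have "minor 1 (\<lambda>_. i) (\<lambda>_. j) c > 0" using pos mi ij by fastforce
    moreover have "{p. p permutes {1::nat..1}} = {id}" by (auto simp: permutes_sing)
    ultimately show ?thesis by (simp add: minor_def sign_id)
  qed
  define C :: "real^'d^'d" where "C = (\<chi> i j. c (idx i) (idx j))"
  have "u ** cols b = cols b ** C"
  proof -
    have "(u ** cols b) $ r $ j = (cols b ** C) $ r $ j" for r j
    proof -
      have "(u ** cols b) $ r $ j = (u *v b (idx j)) $ r"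
        unfolding matrix_mult_cols by (simp add: cols_def)
      also have "\<dots> = (\<Sum>i\<in>{1..?d}. c i (idx j) *\<^sub>R b i) $ r" using c idx_range[of j] by simp
      also have "\<dots> = (cols b ** C) $ r $ j"
        unfolding matrix_matrix_mult_def vec_lambda_beta sum_coord
        by (simp add: cols_def C_def sum_component, intro sum.cong refl) (simp add: idx_coord)
      finally show ?thesis .
    qed
    then show ?thesis by (simp add: vec_eq_iff)
  qed
  moreover have "C $ i $ j \<ge> 0" for i j
    using c_pos[OF idx_range[of i] idx_range[of j]] up idx_range[of i] idx_range[of j]
    unfolding upper_triangular_def by (cases "idx i \<le> idx j") (auto simp: C_def)
  moreover have "C $ i $ i = 1" for i using one idx_range[of i] by (simp add: C_def)
  moreover have "C $ i $ j = 0" if "idx j < idx i" for i j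
    using up idx_range[of i] idx_range[of j] that unfolding upper_triangular_def by (simp add: C_def)
  ultimately show ?thesis using that by blast
qed

lemma U_pos_unipotent:
  fixes b :: "nat \<Rightarrow> real^'d"
  assumes F: "F \<in> flags" and G: "G \<in> flags" and tr: "transverse F G"
    and b: "\<And>i. i \<in> {1..CARD('d)} \<Longrightarrow> b i \<noteq> 0 \<and> b i \<in> F i \<and> b i \<in> G (CARD('d) - i + 1)"
    and u: "u \<in> U_pos b"
  shows "u - mat 1 \<in> flag_nil F"
proof -
  let ?d = "CARD('d)"
  obtain C :: "real^'d^'d" where C: "u ** cols b = cols b ** C"
    "\<And>i. C $ i $ i = 1" "\<And>i j. idx j < idx i \<Longrightarrow> C $ i $ j = 0"
    using U_pos_matrix[OF u] by metis
  note B = transverse_basis[OF F G tr b]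
  have inv: "invertible (cols b)" using B(1) by blast
  show ?thesis
    unfolding flag_nil_def mem_Collect_eq
  proof (intro allI ballI)
    fix k v assume v: "v \<in> F (Suc k)"
    define y where "y = matrix_inv (cols b) *v v"
    have y: "cols b *v y = v"
      using invertible_cancel(1)[OF inv] by (simp add: y_def matrix_vector_mul_assoc)
    have y0: "y $ coord i = 0" if "i \<in> {1..?d}" "Suc k < i" for i
      using B(3)[of y "Suc k"] v that unfolding y by blast
    have "(u - mat 1) *v v = (u ** cols b) *v y - cols b *v y"
    proof -
      have "(u - mat 1) *v v = u *v v - v" by (simp add: matrix_vector_mult_diff_rdistrib)
      also have "u *v v = (u ** cols b) *v y" unfolding y[symmetric] by (rule matrix_vector_mul_assoc)
      finally show ?thesis using y by simp
    qed
    also have "\<dots> = cols b *v (C *v y - y)"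
      unfolding C(1) by (simp add: matrix_vector_mult_diff_distrib matrix_vector_mul_assoc)
    also have "\<dots> \<in> F k"
    proof -
      have "(C *v y - y) $ coord i = 0" if i: "i \<in> {1..?d}" "k < i" for i
      proof -
        have "(C *v y) $ coord i = (\<Sum>j\<in>{1..?d}. C $ coord i $ coord j * y $ coord j)"
          by (simp add: matrix_vector_mult_def sum_coord)
        also have "\<dots> = (\<Sum>j\<in>{i}. C $ coord i $ coord j * y $ coord j)"
        proof (rule sum.mono_neutral_right)
          show "\<forall>j\<in>{1..?d} - {i}. C $ coord i $ coord j * y $ coord j = 0"
          proof
            fix j assume j: "j \<in> {1..?d} - {i}"
            show "C $ coord i $ coord j * y $ coord j = 0"
            proof (cases "j < i")
              case True
              then have "idx (coord j :: 'd) < idx (coord i :: 'd)" using idx_coord[where 'd='d, of i] idx_coord[where 'd='d, of j] i j by auto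
              then show ?thesis using C(3) by simp
            next
              case False
              then show ?thesis using y0[of j] i j by auto
            qed
          qed
        qed (use i in auto)
        finally show ?thesis using C(2) by simp
      qed
      then show ?thesis using B(3)[of "C *v y - y" k] by blast
    qed
    finally show "(u - mat 1) *v v \<in> F k" .
  qed
qed

definition entry_sum :: "real^'d^'d \<Rightarrow> real" where
  "entry_sum N = (\<Sum>i\<in>UNIV. \<Sum>j\<in>UNIV. \<bar>N $ i $ j\<bar>)"

lemma norm_le_entry_sum: "norm (N :: real^'d^'d) \<le> entry_sum N"
proof -
  have "norm N \<le> (\<Sum>i\<in>UNIV. norm (N $ i))"
    unfolding norm_vec_def[of N] by (rule L2_set_le_sum) simp
  also have "\<dots> \<le> entry_sum N"
    unfolding entry_sum_def by (intro sum_mono norm_le_l1_cart)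
  finally show ?thesis .
qed

lemma entry_sum_nonneg: "entry_sum N \<ge> 0"
  unfolding entry_sum_def by (intro sum_nonneg) auto

text \<open>In the positive basis \<open>b\<close>, multiplying \<open>v\<close> on the right by a matrix with nonnegative entries and unit
  diagonal can only increase the entries. Passing to the fixed basis \<open>b0\<close> multiplies the entry \<open>(i, j)\<close> by
  the factor \<open>t i / t j\<close>, which is the same for all matrices, so that the absolute values still
  increase entry by entry.\<close>

lemma entry_sum_monotone:
  fixes b b0 :: "nat \<Rightarrow> real^'d"
  assumes b: "\<And>i. i \<in> {1..CARD('d)} \<Longrightarrow> t i \<noteq> 0 \<and> b i = t i *\<^sub>R b0 i"
    and inv: "invertible (cols b0)" and u: "u \<in> U_pos b" "v \<in> U_pos b"
  defines "N \<equiv> \<lambda>T. matrix_inv (cols b0) ** T ** cols b0"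
  shows "entry_sum (N (v ** u) - N v) = entry_sum (N (v ** u)) - entry_sum (N v)"
proof -
  obtain C where C: "u ** cols b = cols b ** C" "\<And>i j. C $ i $ j \<ge> 0" "\<And>i. C $ i $ i = 1"
    using U_pos_matrix[OF u(1)] by metis
  obtain E where E: "v ** cols b = cols b ** E" "\<And>i j. E $ i $ j \<ge> 0"
    using U_pos_matrix[OF u(2)] by metis
  define D :: "real^'d^'d" where "D = (\<chi> i j. if i = j then t (idx i) else 0)"
  have bD: "cols b = cols b0 ** D"
  proof -
    have "(cols b0 ** D) $ r $ j = cols b $ r $ j" for r j
    proof -
      have "(cols b0 ** D) $ r $ j = (\<Sum>k\<in>UNIV. if k = j then b0 (idx j) $ r * t (idx j) else 0)"
        unfolding matrix_matrix_mult_def vec_lambda_beta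
        by (intro sum.cong refl) (auto simp: D_def cols_def)
      also have "\<dots> = cols b $ r $ j" using b[OF idx_range[of j]] by (simp add: cols_def)
      finally show ?thesis .
    qed
    then show ?thesis by (simp add: vec_eq_iff)
  qed
  have entry: "N T $ i $ j = t (idx i) / t (idx j) * A $ i $ j" if A: "T ** cols b = cols b ** A" for T A i j
  proof -
    have "N T ** D = matrix_inv (cols b0) ** (T ** cols b)"
      by (simp add: N_def bD matrix_mul_assoc)
    also have "\<dots> = matrix_inv (cols b0) ** (cols b ** A)" by (simp only: A)
    also have "\<dots> = (matrix_inv (cols b0) ** cols b0) ** (D ** A)"
      by (simp add: bD matrix_mul_assoc)
    finally have "N T ** D = D ** A" using invertible_cancel(2)[OF inv] by simp
    then have e: "(N T ** D) $ i $ j = (D ** A) $ i $ j" by simp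
    have "(N T ** D) $ i $ j = (\<Sum>k\<in>UNIV. if k = j then N T $ i $ j * t (idx j) else 0)"
      unfolding matrix_matrix_mult_def vec_lambda_beta by (intro sum.cong refl) (auto simp: D_def)
    moreover have "(D ** A) $ i $ j = (\<Sum>k\<in>UNIV. if k = i then t (idx i) * A $ i $ j else 0)"
      unfolding matrix_matrix_mult_def vec_lambda_beta by (intro sum.cong refl) (auto simp: D_def)
    ultimately have "N T $ i $ j * t (idx j) = t (idx i) * A $ i $ j" using e by simp
    then show ?thesis using b[OF idx_range[of j]] by (simp add: field_simps)
  qed
  have vu: "(v ** u) ** cols b = cols b ** (E ** C)"
    by (metis C(1) E(1) matrix_mul_assoc)
  have le: "E $ i $ j \<le> (E ** C) $ i $ j" for i j
  proof -
    have "E $ i $ j = E $ i $ j * C $ j $ j" by (simp add: C(3))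
    also have "\<dots> \<le> (\<Sum>k\<in>UNIV. E $ i $ k * C $ k $ j)"
      by (rule member_le_sum) (auto intro: mult_nonneg_nonneg C E)
    finally show ?thesis by (simp add: matrix_matrix_mult_def)
  qed
  have "\<bar>(N (v ** u) - N v) $ i $ j\<bar> = \<bar>N (v ** u) $ i $ j\<bar> - \<bar>N v $ i $ j\<bar>" for i j
  proof -
    let ?q = "t (idx i) / t (idx j)"
    have "\<bar>(N (v ** u) - N v) $ i $ j\<bar> = \<bar>?q * ((E ** C) $ i $ j - E $ i $ j)\<bar>"
      by (simp add: entry[OF vu] entry[OF E(1)] right_diff_distrib)
    also have "\<dots> = \<bar>?q\<bar> * ((E ** C) $ i $ j) - \<bar>?q\<bar> * (E $ i $ j)"
      unfolding abs_mult using le[of i j] by (simp only: abs_of_nonneg diff_ge_0_iff_ge right_diff_distrib)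
    also have "\<dots> = \<bar>N (v ** u) $ i $ j\<bar> - \<bar>N v $ i $ j\<bar>"
      using le[of i j] E(2)[of i j] by (simp add: entry[OF vu] entry[OF E(1)] abs_mult)
    finally show ?thesis .
  qed
  then show ?thesis by (simp add: entry_sum_def sum_subtractf)
qed

section \<open>Positive arcs\<close>

lemma entry_sum_minus_commute: "entry_sum (A - B) = entry_sum (B - A)"
  unfolding entry_sum_def by (simp add: abs_minus_commute)

text \<open>Every flag \<open>X\<close> of the arc is \<open>T G\<close> for a unique \<open>T\<close> in the unipotent group of \<open>F\<close>. The sum \<open>f X\<close> of the
  absolute values of the entries of \<open>T\<close> is a coordinate on the arc, and by monotonicity the difference
  of two unipotent matrices is bounded by the difference of their values under \<open>f\<close>. On the part of the arc
  where \<open>f\<close> is bounded the matrices stay in a compact convex set, so the Riemannian distance is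
  bounded in the same way.\<close>

lemma hausdorff_measure_positive_arc:
  fixes g :: "'d::finite flag \<Rightarrow> real^'d^'d \<Rightarrow> real^'d^'d \<Rightarrow> real"
  assumes F: "F \<in> flags" and G: "G \<in> flags" and tr: "transverse F G"
    and g: "flag_riemannian_metric g" and s: "s > 1"
    and H: "\<And>X. X \<in> H \<Longrightarrow> \<exists>b u. compatible_basis b F G \<and> u \<in> U_pos b \<and> X = flag_act u G"
    and HH: "\<And>X Y. X \<in> H \<Longrightarrow> Y \<in> H \<Longrightarrow> X \<noteq> Y \<Longrightarrow>
      \<exists>b u v. compatible_basis b F G \<and> u \<in> U_pos b \<and> v \<in> U_pos b \<and>
        (Y = flag_act v G \<and> X = flag_act (v ** u) G \<or> X = flag_act v G \<and> Y = flag_act (v ** u) G)"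
  shows "hausdorff_measure flags (flag_dist g) s H = 0"
proof -
  let ?d = "CARD('d)"
  have "\<exists>v. norm v = 1 \<and> v \<in> F i \<and> v \<in> G (?d - i + 1)" if "i \<in> {1..?d}" for i
    using unit_vector_in_Int[OF flagsD(1)[OF F] flagsD(1)[OF G], of i "?d - i + 1"]
      flagsD(2)[OF F, of i] flagsD(2)[OF G, of "?d - i + 1"] that by fastforce
  then obtain b0 where b0': "\<And>i. i \<in> {1..?d} \<Longrightarrow> norm (b0 i) = 1 \<and> b0 i \<in> F i \<and> b0 i \<in> G (?d - i + 1)" by metis
  have b0: "b0 i \<noteq> 0 \<and> b0 i \<in> F i \<and> b0 i \<in> G (?d - i + 1)" if "i \<in> {1..?d}" for i
    using b0'[OF that] by auto
  let ?B = "cols b0"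
  have inv: "invertible ?B" using transverse_basis(1)[OF F G tr b0] by blast
  define N where "N T = matrix_inv ?B ** T ** ?B" for T
  have cb: "b i \<noteq> 0 \<and> b i \<in> F i \<and> b i \<in> G (?d - i + 1)" if "compatible_basis b F G" "i \<in> {1..?d}" for b i
    using compatible_basis_nonzero[OF that] by auto
  have uni: "u - mat 1 \<in> flag_nil F" if "compatible_basis b F G" "u \<in> U_pos b" for b u
    by (rule U_pos_unipotent[OF F G tr cb[OF that(1)] that(2)])
  have uniq: "S = T" if "S - mat 1 \<in> flag_nil F" "T - mat 1 \<in> flag_nil F" "flag_act S G = flag_act T G" for S T
    by (rule unipotent_unique[OF F G tr that b0])
  \<comment> \<open>The unipotent coordinate; by uniqueness the choice is immaterial.\<close>
  define Tf where "Tf X = (SOME T. T - mat 1 \<in> flag_nil F \<and> flag_act T G = X)" for X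
  have Tf: "Tf X - mat 1 \<in> flag_nil F" "flag_act (Tf X) G = X" if "X \<in> H" for X
  proof -
    have "\<exists>T. T - mat 1 \<in> flag_nil F \<and> flag_act T G = X" using H[OF that] uni by blast
    then have "Tf X - mat 1 \<in> flag_nil F \<and> flag_act (Tf X) G = X" unfolding Tf_def by (rule someI_ex)
    then show "Tf X - mat 1 \<in> flag_nil F" "flag_act (Tf X) G = X" by auto
  qed
  define f where "f X = entry_sum (N (Tf X))" for X
  have mono: "entry_sum (N (Tf X) - N (Tf Y)) = \<bar>f X - f Y\<bar>" if XY: "X \<in> H" "Y \<in> H" for X Y
  proof (cases "X = Y")
    case True then show ?thesis by (simp add: entry_sum_def)
  next
    case False
    have main: "entry_sum (N (Tf X') - N (Tf Y')) = f X' - f Y'"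
      if h: "compatible_basis b F G" "u \<in> U_pos b" "v \<in> U_pos b" "Y' = flag_act v G" "X' = flag_act (v ** u) G"
        "X' \<in> H" "Y' \<in> H" for X' Y' b u v
    proof -
      have "Tf Y' = v" using uniq[OF Tf(1)[OF h(7)] uni[OF h(1,3)]] Tf(2)[OF h(7)] h(4) by simp
      moreover have "Tf X' = v ** u"
        using uniq[OF Tf(1)[OF h(6)] unipotent_mult[OF F uni[OF h(1,3)] uni[OF h(1,2)]]] Tf(2)[OF h(6)] h(5) by simp
      moreover obtain t where "\<And>i. i \<in> {1..?d} \<Longrightarrow> t i \<noteq> 0 \<and> b i = t i *\<^sub>R b0 i"
        using transverse_lines[OF F G tr b0 cb[OF h(1)]] by metis
      from entry_sum_monotone[OF this inv h(2,3)]
      have "entry_sum (N (v ** u) - N v) = entry_sum (N (v ** u)) - entry_sum (N v)" unfolding N_def .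
      ultimately show ?thesis by (simp add: f_def)
    qed
    from HH[OF XY False] obtain b u v where h: "compatible_basis b F G" "u \<in> U_pos b" "v \<in> U_pos b"
      "Y = flag_act v G \<and> X = flag_act (v ** u) G \<or> X = flag_act v G \<and> Y = flag_act (v ** u) G" by blast
    from h(4) show ?thesis
    proof
      assume "Y = flag_act v G \<and> X = flag_act (v ** u) G"
      then have e: "entry_sum (N (Tf X) - N (Tf Y)) = f X - f Y" using main[OF h(1-3)] XY by blast
      then show ?thesis using entry_sum_nonneg[of "N (Tf X) - N (Tf Y)"] by simp
    next
      assume "X = flag_act v G \<and> Y = flag_act (v ** u) G"
      then have e: "entry_sum (N (Tf Y) - N (Tf X)) = f Y - f X" using main[OF h(1-3)] XY by blast
      then show ?thesis using entry_sum_nonneg[of "N (Tf Y) - N (Tf X)"]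
        by (simp add: entry_sum_minus_commute[of "N (Tf X)"])
    qed
  qed
  obtain A0 where A0: "invertible A0" "G = flag_act A0 std_flag" using flag_transitive[OF G] by metis
  have "\<exists>B>0. \<forall>(X :: real^'d^'d) (Y :: real^'d^'d). norm (X ** Y) \<le> B * norm X * norm Y"
    by (rule bilinear_bounded_pos[OF bilinear_matrix_mult])
  then obtain B where B: "B > 0" and B': "\<forall>(X :: real^'d^'d) (Y :: real^'d^'d). norm (X ** Y) \<le> B * norm X * norm Y"
    by (elim exE conjE)
  \<comment> \<open>Undoing the conjugation by \<open>cols b0\<close> costs a constant factor.\<close>
  define K where "K = B * (B * norm ?B) * norm (matrix_inv ?B)"
  have K0: "K \<ge> 0" unfolding K_def using B by (intro mult_nonneg_nonneg) (simp_all add: less_imp_le)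
  have K: "norm T \<le> K * entry_sum (N T)" for T
  proof -
    have "?B ** N T ** matrix_inv ?B = (?B ** matrix_inv ?B) ** T ** (?B ** matrix_inv ?B)"
      by (simp only: N_def matrix_mul_assoc)
    then have "T = ?B ** N T ** matrix_inv ?B" by (simp add: invertible_cancel(1)[OF inv])
    then have "norm T = norm (?B ** N T ** matrix_inv ?B)" by simp
    also have "\<dots> \<le> B * norm (?B ** N T) * norm (matrix_inv ?B)" using B' by (elim allE)
    also have "\<dots> \<le> B * (B * norm ?B * norm (N T)) * norm (matrix_inv ?B)"
    proof -
      have "norm (?B ** N T) \<le> B * norm ?B * norm (N T)" using B' by (elim allE)
      then show ?thesis using B by (intro mult_right_mono mult_left_mono) auto
    qed
    also have "\<dots> = K * norm (N T)" by (simp add: K_def)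
    also have "\<dots> \<le> K * entry_sum (N T)" using K0 norm_le_entry_sum by (intro mult_left_mono)
    finally show ?thesis .
  qed
  have N_diff: "N (S - T) = N S - N T" for S T by (simp add: N_def matrix_diff_mult)
  define E where "E m = {X \<in> H. f X \<le> real m}" for m :: nat
  have Hfl: "X \<in> flags" if "X \<in> H" for X
    using Tf[OF that] flag_act_flags[OF unipotent_invertible[OF F Tf(1)[OF that]] G] by simp
  show ?thesis
  proof (rule hausdorff_measure_UN_eq_0[of _ _ _ E])
    fix m
    let ?U = "((+) (mat 1) ` flag_nil F) \<inter> cball 0 (K * real m)"
    have U_mem: "T \<in> ?U \<longleftrightarrow> T - mat 1 \<in> flag_nil F \<and> norm T \<le> K * real m" for T
    proof -
      have "T \<in> (+) (mat 1) ` flag_nil F \<longleftrightarrow> T - mat 1 \<in> flag_nil F"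
        by (auto simp: image_iff) (metis add_diff_cancel_left' diff_add_cancel add.commute)
      then show ?thesis by simp
    qed
    have comp: "compact ?U"
      by (intro closed_Int_compact closed_translation closed_subspace subspace_flag_nil F compact_cball)
    have conv: "convex ?U"
      by (intro convex_Int convex_translation subspace_imp_convex subspace_flag_nil F convex_cball)
    have invU: "?U \<subseteq> {T. invertible T}"
      using unipotent_invertible[OF F] U_mem by blast
    obtain C where C: "C > 0" "\<And>S T. S \<in> ?U \<Longrightarrow> T \<in> ?U \<Longrightarrow>
        0 \<le> flag_dist g (flag_act (S ** A0) std_flag) (flag_act (T ** A0) std_flag) \<and>
        flag_dist g (flag_act (S ** A0) std_flag) (flag_act (T ** A0) std_flag) \<le> C * norm (S - T)"
      by (rule flag_dist_lipschitz[OF g comp conv invU A0(1)]) blast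
    show "hausdorff_measure flags (flag_dist g) s (E m) = 0"
    proof (rule hausdorff_measure_real_parameter_eq_0[OF _ s])
      show "E m \<subseteq> flags" using Hfl by (auto simp: E_def)
      show "0 \<le> f X \<and> f X \<le> real m" if "X \<in> E m" for X
        using that entry_sum_nonneg by (simp add: E_def f_def)
      fix X Y assume XY: "X \<in> E m" "Y \<in> E m"
      have TU: "Tf Z \<in> ?U" if "Z \<in> E m" for Z
      proof -
        have "norm (Tf Z) \<le> K * f Z" using K[of "Tf Z"] by (simp add: f_def)
        also have "\<dots> \<le> K * real m" using that K0 by (intro mult_left_mono) (auto simp: E_def)
        finally show ?thesis unfolding U_mem using Tf(1) that by (simp add: E_def)
      qed
      have eq: "flag_act (Tf Z ** A0) std_flag = Z" if "Z \<in> E m" for Z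
        using Tf(2)[of Z] that A0(2) by (simp add: flag_act_compose[symmetric] E_def)
      have "norm (Tf X - Tf Y) \<le> K * \<bar>f X - f Y\<bar>"
        using K[of "Tf X - Tf Y"] mono[of X Y] XY by (simp add: N_diff E_def)
      then have "C * norm (Tf X - Tf Y) \<le> C * (K * \<bar>f X - f Y\<bar>)" using C(1) by simp
      then show "0 \<le> flag_dist g X Y \<and> flag_dist g X Y \<le> (C * K) * \<bar>f X - f Y\<bar>"
        using C(2)[OF TU[OF XY(1)] TU[OF XY(2)]] by (simp add: eq XY mult.assoc)
    qed
  next
    show "H \<subseteq> (\<Union>m. E m)"
    proof
      fix X assume "X \<in> H"
      moreover obtain m :: nat where "f X \<le> real m" using real_arch_simple by blast
      ultimately show "X \<in> (\<Union>m. E m)" by (auto simp: E_def)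
    qed
  qed
qed

section \<open>Positive maps on subsets of the circle\<close>

lemma positive_mapD:
  assumes pos: "positive_map X \<xi>" and n: "n \<ge> 2"
    and t: "strict_mono_on {1..n} t" "t n < t 1 + 2 * pi" "\<And>k. k \<in> {1..n} \<Longrightarrow> cis (t k) \<in> X"
  shows "positive_tuple n (\<lambda>k. \<xi> (cis (t k)))"
proof -
  have "cyclically_ordered n (\<lambda>k. cis (t k))" unfolding cyclically_ordered_def using t by blast
  moreover have "(\<lambda>k. cis (t k)) ` {1..n} \<subseteq> X" using t(3) by auto
  ultimately show ?thesis using pos n unfolding positive_map_def by blast
qed

lemma positive_pair:
  assumes "positive_map X \<xi>" "cis a \<in> X" "cis c \<in> X" "a < c" "c < a + 2 * pi"
  shows "transverse (\<xi> (cis a)) (\<xi> (cis c))"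
proof -
  let ?t = "\<lambda>k::nat. if k = 1 then a else c"
  have "positive_tuple 2 (\<lambda>k. \<xi> (cis (?t k)))"
    by (rule positive_mapD[OF assms(1)]) (use assms in \<open>auto simp: strict_mono_on_def\<close>)
  then show ?thesis by (simp add: positive_tuple_def)
qed

lemma positive_triple:
  assumes "positive_map X \<xi>" "cis a \<in> X" "cis b \<in> X" "cis c \<in> X" "a < b" "b < c" "c < a + 2 * pi"
  shows "positive_tuple 3 (\<lambda>k. \<xi> (cis (if k = 1 then a else if k = 2 then b else c)))"
  by (rule positive_mapD[OF assms(1)]) (use assms in \<open>auto simp: strict_mono_on_def\<close>)

lemma positive_triple_U_pos:
  assumes "positive_map X \<xi>" "cis a \<in> X" "cis b \<in> X" "cis c \<in> X" "a < b" "b < c" "c < a + 2 * pi"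
  shows "\<exists>B u. compatible_basis B (\<xi> (cis a)) (\<xi> (cis c)) \<and> u \<in> U_pos B \<and>
    \<xi> (cis b) = flag_act u (\<xi> (cis c))"
proof -
  let ?t = "\<lambda>k::nat. if k = 1 then a else if k = 2 then b else c"
  obtain B u where B: "compatible_basis B (\<xi> (cis (?t 1))) (\<xi> (cis (?t 3)))"
    and u: "\<forall>i\<in>{2..<3}. u i \<in> U_pos B"
    and Fs: "\<forall>i\<in>{2..<3}. \<xi> (cis (?t i)) = flag_act (desc_prod u i (3 - i)) (\<xi> (cis (?t 3)))"
    using positive_triple[OF assms] unfolding positive_tuple_def by (elim conjE exE)
  have two: "(2::nat) \<in> {2..<3}" by simp
  have "desc_prod u 2 (3 - 2) = u 2" using desc_prod.simps(2)[of u 2 0] by simp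
  then have "\<xi> (cis b) = flag_act (u 2) (\<xi> (cis c))" using bspec[OF Fs two] by simp
  then show ?thesis using B bspec[OF u two] by auto
qed

lemma positive_quadruple_U_pos:
  assumes "positive_map X \<xi>" "cis a \<in> X" "cis b \<in> X" "cis b' \<in> X" "cis c \<in> X"
    "a < b" "b < b'" "b' < c" "c < a + 2 * pi"
  shows "\<exists>B u v. compatible_basis B (\<xi> (cis a)) (\<xi> (cis c)) \<and> u \<in> U_pos B \<and> v \<in> U_pos B \<and>
    \<xi> (cis b') = flag_act v (\<xi> (cis c)) \<and> \<xi> (cis b) = flag_act (v ** u) (\<xi> (cis c))"
proof -
  let ?t = "\<lambda>k::nat. if k = 1 then a else if k = 2 then b else if k = 3 then b' else c"
  have "positive_tuple 4 (\<lambda>k. \<xi> (cis (?t k)))"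
    by (rule positive_mapD[OF assms(1)]) (use assms in \<open>auto simp: strict_mono_on_def\<close>)
  then obtain B u where B: "compatible_basis B (\<xi> (cis (?t 1))) (\<xi> (cis (?t 4)))"
    and u: "\<forall>i\<in>{2..<4}. u i \<in> U_pos B"
    and Fs: "\<forall>i\<in>{2..<4}. \<xi> (cis (?t i)) = flag_act (desc_prod u i (4 - i)) (\<xi> (cis (?t 4)))"
    unfolding positive_tuple_def by (elim conjE exE)
  have two: "(2::nat) \<in> {2..<4}" and three: "(3::nat) \<in> {2..<4}" by simp_all
  have d3: "desc_prod u 3 (4 - 3) = u 3" using desc_prod.simps(2)[of u 3 0] by simp
  have "desc_prod u 2 (4 - 2) = desc_prod u 2 (Suc (Suc 0))" by (simp add: numeral_eq_Suc)
  also have "\<dots> = u 3 ** u 2" by simp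
  finally have d2: "desc_prod u 2 (4 - 2) = u 3 ** u 2" .
  have "\<xi> (cis b') = flag_act (u 3) (\<xi> (cis c))" using bspec[OF Fs three] d3 by simp
  moreover have "\<xi> (cis b) = flag_act (u 3 ** u 2) (\<xi> (cis c))" using bspec[OF Fs two] d2 by simp
  ultimately show ?thesis using B bspec[OF u two] bspec[OF u three] by auto
qed

lemma circle_angle:
  assumes "norm z = 1"
  obtains t where "a \<le> t" "t < a + 2 * pi" "z = cis t"
proof -
  let ?w = "z * cis (- a)"
  have "norm ?w = 1" using assms by (simp add: norm_mult)
  then have "?w = cis (Arg2pi ?w)" using Arg2pi_eq[of ?w] by (simp add: cis_conv_exp)
  then have "z * cis (- a) * cis a = cis (Arg2pi ?w) * cis a" by (rule arg_cong)
  then have "z = cis (a + Arg2pi ?w)" by (simp add: cis_mult mult.assoc add.commute)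
  then show ?thesis using that[of "a + Arg2pi ?w"] Arg2pi_ge_0[of ?w] Arg2pi_lt_2pi[of ?w] by simp
qed

text \<open>The angles of two further points are measured from that of \<open>y\<close>, so that together with \<open>c + 2 * pi\<close> they
  also describe the cyclic order \<open>(a, b, y)\<close>.\<close>

lemma three_points:
  assumes inf: "infinite X" and X: "\<And>x. x \<in> X \<Longrightarrow> norm x = 1" and y: "y \<in> X"
  obtains c a b where "y = cis c" "c < a" "a < b" "b < c + 2 * pi" "cis a \<in> X" "cis b \<in> X"
proof -
  obtain c where c: "y = cis c" using circle_angle[OF X[OF y]] by metis
  have "infinite (X - {y})" using inf by simp
  then obtain u where u: "u \<in> X - {y}" using infinite_imp_nonempty by blast
  have "infinite (X - {y} - {u})" using inf by simp
  then obtain v where v: "v \<in> X - {y} - {u}" using infinite_imp_nonempty by blast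
  have angle: "\<exists>t. c < t \<and> t < c + 2 * pi \<and> x = cis t" if "x \<in> X - {y}" for x
  proof -
    have x1: "norm x = 1" using that X by auto
    obtain t where t: "c \<le> t" "t < c + 2 * pi" "x = cis t" using circle_angle[OF x1] by metis
    moreover have "t \<noteq> c" using t that c by auto
    ultimately show ?thesis by (intro exI[of _ t]) simp
  qed
  obtain s where s: "c < s" "s < c + 2 * pi" "u = cis s" using angle[OF u] by auto
  obtain t where t: "c < t" "t < c + 2 * pi" "v = cis t" using angle[of v] v by auto
  have "s \<noteq> t" using s t v by auto
  then show ?thesis using that[of c s t] that[of c t s] c s t u v by (cases "s < t") auto
qed

text \<open>An arc does not contain its end points. Three arcs between three points, each end point being
  interior to another arc, cover the circle.\<close>

lemma hausdorff_measure_positive_map: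
  fixes g :: "'d::finite flag \<Rightarrow> real^'d^'d \<Rightarrow> real^'d^'d \<Rightarrow> real"
  assumes pos: "positive_map X \<xi>" and \<xi>: "\<And>x. x \<in> X \<Longrightarrow> \<xi> x \<in> flags"
    and inf: "infinite X" and X: "\<And>x. x \<in> X \<Longrightarrow> norm x = 1"
    and g: "flag_riemannian_metric g" and s: "s > 1"
  shows "hausdorff_measure flags (flag_dist g) s (\<xi> ` X) = 0"
proof -
  define arc where "arc a c = {x \<in> X. \<exists>t. a < t \<and> t < c \<and> x = cis t}" for a c
  have arc0: "hausdorff_measure flags (flag_dist g) s (\<xi> ` arc a c) = 0"
    if ac: "cis a \<in> X" "cis c \<in> X" "a < c" "c < a + 2 * pi" for a c
  proof (rule hausdorff_measure_positive_arc[OF \<xi>[OF ac(1)] \<xi>[OF ac(2)] positive_pair[OF pos ac] g s])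
    fix Y assume "Y \<in> \<xi> ` arc a c"
    then obtain t where t: "Y = \<xi> (cis t)" "cis t \<in> X" "a < t" "t < c" by (auto simp: arc_def)
    show "\<exists>b u. compatible_basis b (\<xi> (cis a)) (\<xi> (cis c)) \<and> u \<in> U_pos b \<and> Y = flag_act u (\<xi> (cis c))"
      unfolding t(1) by (rule positive_triple_U_pos[OF pos ac(1) t(2) ac(2) t(3,4) ac(4)])
  next
    fix Y Z assume "Y \<in> \<xi> ` arc a c" "Z \<in> \<xi> ` arc a c" "Y \<noteq> Z"
    then obtain t t' where t: "Y = \<xi> (cis t)" "cis t \<in> X" "a < t" "t < c"
      and t': "Z = \<xi> (cis t')" "cis t' \<in> X" "a < t'" "t' < c" by (auto simp: arc_def)
    have "t \<noteq> t'" using \<open>Y \<noteq> Z\<close> t t' by auto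
    then consider "t < t'" | "t' < t" by linarith
    then show "\<exists>b u v. compatible_basis b (\<xi> (cis a)) (\<xi> (cis c)) \<and> u \<in> U_pos b \<and> v \<in> U_pos b \<and>
        (Z = flag_act v (\<xi> (cis c)) \<and> Y = flag_act (v ** u) (\<xi> (cis c)) \<or>
         Y = flag_act v (\<xi> (cis c)) \<and> Z = flag_act (v ** u) (\<xi> (cis c)))"
    proof cases
      case 1
      show ?thesis using positive_quadruple_U_pos[OF pos ac(1) t(2) t'(2) ac(2) t(3) 1 t'(4) ac(4)]
        unfolding t(1) t'(1) by blast
    next
      case 2
      show ?thesis using positive_quadruple_U_pos[OF pos ac(1) t'(2) t(2) ac(2) t'(3) 2 t(4) ac(4)]
        unfolding t(1) t'(1) by blast
    qed
  qed
  obtain y where "y \<in> X" using infinite_imp_nonempty[OF inf] by blast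
  then obtain c a b where abc: "y = cis c" "c < a" "a < b" "b < c + 2 * pi" "cis a \<in> X" "cis b \<in> X"
    using three_points[OF inf X] by metis
  have cX: "cis c \<in> X" using abc(1) \<open>y \<in> X\<close> by simp
  have per: "cis (r + 2 * pi) = cis r" for r by (simp add: complex_eq_iff)
  \<comment> \<open>The point \<open>cis c\<close> is covered by the third arc, at the angle \<open>c + 2 * pi\<close>.\<close>
  define E where "E n = (if n = 0 then \<xi> ` arc c b else if n = 1 then \<xi> ` arc a (c + 2 * pi)
      else \<xi> ` arc b (a + 2 * pi))" for n :: nat
  show ?thesis
  proof (rule hausdorff_measure_UN_eq_0[of _ _ _ E])
    fix n
    show "hausdorff_measure flags (flag_dist g) s (E n) = 0"
      unfolding E_def using abc cX by (auto intro!: arc0 simp: per)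
  next
    show "\<xi> ` X \<subseteq> (\<Union>n. E n)"
    proof
      fix Y assume "Y \<in> \<xi> ` X"
      then obtain x where x: "x \<in> X" "Y = \<xi> x" by auto
      obtain t where t: "c \<le> t" "t < c + 2 * pi" "x = cis t" using circle_angle[OF X[OF x(1)]] by metis
      consider "t = c" | "c < t" "t < b" | "b \<le> t" using t by linarith
      then show "Y \<in> (\<Union>n. E n)"
      proof cases
        case 1
        have "x \<in> arc b (a + 2 * pi)"
          unfolding arc_def using x t 1 abc per[of c] by (auto intro!: exI[of _ "c + 2 * pi"])
        then have "Y \<in> E 2" using x by (simp add: E_def)
        then show ?thesis by blast
      next
        case 2
        then have "Y \<in> E 0" using x t by (auto simp: E_def arc_def)
        then show ?thesis by blast
      next
        case 3
        then have "a < t" using abc by simp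
        then have "x \<in> arc a (c + 2 * pi)" unfolding arc_def using x t by blast
        then have "Y \<in> E 1" using x by (simp add: E_def)
        then show ?thesis by blast
      qed
    qed
  qed
qed

section \<open>The limit set lies on the positive curve\<close>

text \<open>Let \<open>\<rho> (\<alpha> n)\<close> have Cartan flags converging to \<open>F\<close>. After passing to a subsequence, \<open>\<alpha> n\<close> moves all points
  but \<open>y\<close> to \<open>x\<close>, and its inverse moves all points but \<open>x\<close> to \<open>y\<close>. For \<open>a\<close>, \<open>b\<close> different from \<open>y\<close> and \<open>p\<close>
  different from \<open>x\<close>, equivariance and continuity translate this into the hypotheses of
  the convergence lemma for Cartan flags, with \<open>Fy n\<close> the flag of the preimage of \<open>p\<close>.\<close>

lemma flag_limit_set_subset:
  fixes \<rho> :: "(real^2^2) set \<Rightarrow> (real^'d::finite^'d) set"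
  assumes fuch: "fuchsian \<Gamma>"
    and cont: "continuous_map (top_of_set (limit_set \<Gamma>)) flag_topology \<xi>"
    and pos: "positive_map (limit_set \<Gamma>) \<xi>"
    and equiv: "\<And>\<gamma> A B x. \<gamma> \<in> \<Gamma> \<Longrightarrow> A \<in> \<gamma> \<Longrightarrow> B \<in> \<rho> \<gamma> \<Longrightarrow> x \<in> limit_set \<Gamma> \<Longrightarrow>
      \<xi> (disk_act A x) = flag_act B (\<xi> x)"
  shows "flag_limit_set (\<rho> ` \<Gamma>) \<subseteq> \<xi> ` limit_set \<Gamma>"
proof
  let ?L = "limit_set \<Gamma>"
  note \<Gamma> = fuchsianD[OF fuch]
  note L = lifts_subgroup[OF \<Gamma>(1)]
  have \<xi>: "\<xi> x \<in> flags" if "x \<in> ?L" for x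
    using continuous_map_image_subset_topspace[OF cont] that by (auto simp: topspace_flag_topology)
  fix F assume "F \<in> flag_limit_set (\<rho> ` \<Gamma>)"
  then obtain \<gamma> Fs where \<gamma>: "inj \<gamma>" "range \<gamma> \<subseteq> \<rho> ` \<Gamma>"
    and U: "\<forall>n::nat. \<exists>g\<in>\<gamma> n. U_Delta g (Fs n)"
    and lim: "limitin flag_topology Fs F sequentially" unfolding flag_limit_set_def by blast
  have "\<forall>n. \<exists>\<alpha>. \<alpha> \<in> \<Gamma> \<and> \<gamma> n = \<rho> \<alpha>" using \<gamma>(2) by blast
  then obtain \<alpha> where \<alpha>: "\<And>n. \<alpha> n \<in> \<Gamma>" "\<And>n. \<gamma> n = \<rho> (\<alpha> n)" by metis
  have "\<forall>n. \<exists>A. A \<in> \<alpha> n" using PSL_nonempty subgroup.mem_carrier[OF \<Gamma>(1) \<alpha>(1)] by blast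
  then obtain A where A: "\<And>n. A n \<in> \<alpha> n" by metis
  have "\<forall>n. \<exists>g l s m. g \<in> \<gamma> n \<and> cartan g l s m \<and> Fs n = flag_act l std_flag"
    using U unfolding U_Delta_def by blast
  then obtain g l s m where glsm: "\<And>n. g n \<in> \<gamma> n" "\<And>n. cartan (g n) (l n) (s n) (m n)"
    "\<And>n. Fs n = flag_act (l n) std_flag" by metis
  have injA: "inj A"
  proof (rule injI)
    fix i j assume "A i = A j"
    then have "\<alpha> i = \<alpha> j" using L(5)[OF \<alpha>(1) \<alpha>(1) A] A by metis
    then show "i = j" using \<alpha>(2) \<gamma>(1) by (metis injD)
  qed
  have AG: "A n \<in> \<Union>\<Gamma>" for n using A \<alpha>(1) by blast
  obtain r x y where r: "strict_mono (r :: nat \<Rightarrow> nat)" and xy: "x \<in> ?L" "y \<in> ?L"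
    and toX: "\<And>w. w \<noteq> y \<Longrightarrow> (\<lambda>n. disk_act (A (r n)) w) \<longlonglongrightarrow> x"
    and toY: "\<And>w. w \<noteq> x \<Longrightarrow> (\<lambda>n. disk_act (matrix_inv (A (r n))) w) \<longlonglongrightarrow> y"
    using fuchsian_dynamics[OF \<Gamma>(1,2) injA AG] by metis
  have act: "flag_act (g n) (\<xi> w) = \<xi> (disk_act (A n) w)" if "w \<in> ?L" for n w
    using equiv[OF \<alpha>(1) A _ that, of "g n" n] glsm(1)[of n] \<alpha>(2)[of n] by simp
  have inv: "disk_act B w \<in> ?L" if "B \<in> \<Union>\<Gamma>" "w \<in> ?L" for B w by (rule limit_set_invariant[OF \<Gamma>(1) that])
  have lim\<xi>: "limitin flag_topology (\<lambda>n. \<xi> (f n)) (\<xi> w) sequentially"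
    if "f \<longlonglongrightarrow> w" "\<And>n. f n \<in> ?L" "w \<in> ?L" for f w
  proof -
    have "limitin (top_of_set ?L) f w sequentially"
      using that by (simp add: limitin_subtopology limitin_canonical_iff)
    from continuous_map_limit[OF cont this] show ?thesis by (simp add: comp_def)
  qed
  have infL: "infinite ?L" by (rule infinite_limit_set[OF fuch])
  have n1: "norm w = 1" if "w \<in> ?L" for w by (rule limit_set_sphere(1)[OF that])
  obtain c a b where abc: "y = cis c" "c < a" "a < b" "b < c + 2 * pi" "cis a \<in> ?L" "cis b \<in> ?L"
    using three_points[OF infL n1 xy(2)] by metis
  obtain e p p' where e: "x = cis e" "e < p" "p < p'" "p' < e + 2 * pi" "cis p \<in> ?L" "cis p' \<in> ?L"
    using three_points[OF infL n1 xy(1)] by metis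
  have tr: "transverse (\<xi> x) (\<xi> (cis p))"
    unfolding e(1) by (rule positive_pair[OF pos]) (use e xy in auto)
  \<comment> \<open>The point \<open>y\<close> has to come last in the triple, hence the angle \<open>c + 2 * pi\<close>.\<close>
  let ?T = "\<lambda>k::nat. \<xi> (cis (if k = 1 then a else if k = 2 then b else c + 2 * pi))"
  have per: "cis (c + 2 * pi) = y" using abc(1) by (simp add: complex_eq_iff)
  have pos3: "positive_tuple 3 ?T"
    by (rule positive_triple[OF pos]) (use abc per xy in auto)
  have cis_inj: "cis t \<noteq> cis u" if "u < t" "t < u + 2 * pi" for t u
  proof
    assume h: "cis t = cis u"
    have "cis (t - u) = 1" using h by (simp add: cis_divide[symmetric])
    then have "cos (t - u) = 1" by (simp add: complex_eq_iff)
    then obtain k :: int where k: "t - u = real_of_int k * 2 * pi" by (auto simp: cos_one_2pi_int)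
    then have "0 < real_of_int k * 2 * pi" "real_of_int k * 2 * pi < 1 * 2 * pi" using that by linarith+
    then have "0 < real_of_int k" "real_of_int k < 1" by (simp_all add: zero_less_mult_iff)
    then have "0 < k" "k < 1" by simp_all
    then show False by linarith
  qed
  have ne: "cis a \<noteq> y" "cis b \<noteq> y" "cis p \<noteq> x"
    using cis_inj[of c a] cis_inj[of c b] cis_inj[of e p] abc e by auto
  have "F = \<xi> x"
  proof (rule cartan_flag_limit[where g = "\<lambda>n. g (r n)" and l = "\<lambda>n. l (r n)" and s = "\<lambda>n. s (r n)"
        and m = "\<lambda>n. m (r n)" and T = ?T and Fp = "\<xi> (cis p)"
        and Fy = "\<lambda>n. \<xi> (disk_act (matrix_inv (A (r n))) (cis p))"])
    show "?T 1 \<in> flags" "?T 2 \<in> flags" "?T 3 \<in> flags" "\<xi> x \<in> flags" "\<xi> (cis p) \<in> flags"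
      using \<xi> abc e xy per by auto
    show "\<xi> (disk_act (matrix_inv (A (r n))) (cis p)) \<in> flags" for n by (rule \<xi>[OF inv[OF L(3)[OF AG] e(5)]])
    show "positive_tuple 3 ?T" by (rule pos3)
    show "transverse (\<xi> x) (\<xi> (cis p))" by (rule tr)
    have "limitin flag_topology (\<lambda>n. \<xi> (disk_act (matrix_inv (A (r n))) (cis p))) (\<xi> y) sequentially"
      by (rule lim\<xi>[OF toY[OF ne(3)] inv[OF L(3)[OF AG] e(5)] xy(2)])
    then show "limitin flag_topology (\<lambda>n. \<xi> (disk_act (matrix_inv (A (r n))) (cis p))) (?T 3) sequentially"
      using per by simp
    have "limitin flag_topology (\<lambda>n. \<xi> (disk_act (A (r n)) (cis a))) (\<xi> x) sequentially"
      by (rule lim\<xi>[OF toX[OF ne(1)] inv[OF AG abc(5)] xy(1)])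
    then show "limitin flag_topology (\<lambda>n. flag_act (g (r n)) (?T 1)) (\<xi> x) sequentially"
      by (simp add: act abc)
    have "limitin flag_topology (\<lambda>n. \<xi> (disk_act (A (r n)) (cis b))) (\<xi> x) sequentially"
      by (rule lim\<xi>[OF toX[OF ne(2)] inv[OF AG abc(6)] xy(1)])
    then show "limitin flag_topology (\<lambda>n. flag_act (g (r n)) (?T 2)) (\<xi> x) sequentially"
      by (simp add: act abc)
    show "flag_act (g (r n)) (\<xi> (disk_act (matrix_inv (A (r n))) (cis p))) = \<xi> (cis p)" for n
    proof -
      have "disk_act (A (r n)) (disk_act (matrix_inv (A (r n))) (cis p)) = cis p"
        by (rule disk_act_inv(1)[OF L(1)[OF AG] limit_set_sphere(2)[OF e(5)]])
      then show ?thesis using act[OF inv[OF L(3)[OF AG] e(5)], of "r n" "r n"] by simp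
    qed
    show "cartan (g (r n)) (l (r n)) (s (r n)) (m (r n))" for n by (rule glsm)
    show "limitin flag_topology (\<lambda>n. flag_act (l (r n)) std_flag) F sequentially"
      using limitin_subsequence[OF r lim] glsm(3) by (simp add: comp_def)
  qed
  then show "F \<in> \<xi> ` ?L" using xy by blast
qed

theorem proposition1p6:
  fixes \<Gamma> :: "(real^2^2) set set"
    and \<rho> :: "(real^2^2) set \<Rightarrow> (real^'d::finite^'d) set"
    and g :: "'d flag \<Rightarrow> real^'d^'d \<Rightarrow> real^'d^'d \<Rightarrow> real"
  assumes "fuchsian \<Gamma>"
    and "hitchin \<Gamma> \<rho>"
    and "flag_riemannian_metric g"
  shows "hausdorff_dim flags (flag_dist g) (flag_limit_set (\<rho> ` \<Gamma>)) \<le> 1"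
proof (rule hausdorff_dim_le_1)
  fix s :: real assume s: "s > 1"
  let ?L = "limit_set \<Gamma>"
  obtain \<xi> :: "complex \<Rightarrow> 'd flag" where cont: "continuous_map (top_of_set ?L) flag_topology \<xi>"
    and pos: "positive_map ?L \<xi>"
    and equiv: "\<forall>\<gamma>\<in>\<Gamma>. \<forall>A\<in>\<gamma>. \<forall>B\<in>\<rho> \<gamma>. \<forall>x\<in>?L. \<xi> (disk_act A x) = flag_act B (\<xi> x)"
    using assms(2) unfolding hitchin_def by blast
  have \<xi>: "\<xi> x \<in> flags" if "x \<in> ?L" for x
    using continuous_map_image_subset_topspace[OF cont] that by (auto simp: topspace_flag_topology)
  have null: "hausdorff_measure flags (flag_dist g) s (\<xi> ` ?L) = 0"
    by (rule hausdorff_measure_positive_map[OF pos \<xi> infinite_limit_set[OF assms(1)] limit_set_sphere(1) assms(3) s])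
  have "flag_limit_set (\<rho> ` \<Gamma>) \<subseteq> \<xi> ` ?L"
    by (rule flag_limit_set_subset[OF assms(1) cont pos]) (use equiv in blast)
  then have "flag_limit_set (\<rho> ` \<Gamma>) \<subseteq> (\<Union>n::nat. \<xi> ` ?L)" by blast
  with null show "hausdorff_measure flags (flag_dist g) s (flag_limit_set (\<rho> ` \<Gamma>)) = 0"
    by (rule hausdorff_measure_UN_eq_0)
qed

end
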